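(* Let $X$ be an infinite dimensional locally convex space admitting an $\ell_1$-sequence with dense span. Assume also that there is an $\ell_1$-sequence $\{f_n\}_{n\in\mathbb Z_+}$ with dense span in $X'_\beta$ and that at least one of the following conditions is satisfied: (1) the topology of $X$ coincides with $\sigma(X,X')$; (2) the topology of $X$ coincides with $\tau(X,X')$; (3) the set $\{f_n:n\in\mathbb Z_+\}$ is uniformly equicontinuous. Then $X$ admits a dual hypercyclic operator.
   Context: Conventions: $\mathbb K$ is $\mathbb R$ or $\mathbb C$; all vector spaces are over $\mathbb K$; all topological spaces are Hausdorff; $\mathbb Z_+=\{0,1,2,\dots\}$. $L(X)$ is the space of continuous linear operators on $X$, $X'$ the space of continuous linear functionals on $X$, and for $T\in L(X)$, $T':X'\to X'$ is given by $(T'f)(x)=f(Tx)$. A sequence $\{x_n\}_{n\in\mathbb Z_+}$ in a topological vector space $X$ is an $\ell_1$-sequence if $x_n\to0$ in $X$ and $\sum_{n=0}^\infty a_nx_n$ converges in $X$ for each $a\in\ell_1$. $\sigma(X,X')$ is the weakest topology on $X$ making all functionals in $X'$ continuous; $\tau(X,X')$ is the Mackey topology, i.e. the topology of uniform convergence on compact convex subsets of $(X',\sigma(X',X))$. $X'_\beta$ is $X'$ with the strong topology $\beta(X',X)$, i.e. the topology of uniform convergence on bounded subsets of $(X,\sigma(X,X'))$. A set $A\subset X'$ is uniformly equicontinuous if there is a neighborhood $U$ of zero in $X$ such that $|f(x)|\le1$ for any $x\in U$ and $f\in A$. An operator $S$ on a topological vector space $Z$ is hypercyclic if $\{S^nz:n\in\mathbb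 Z_+\}$ is dense in $Z$ for some $z\in Z$. $T\in L(X)$ is dual hypercyclic if $T$ is hypercyclic on $X$ and $T'$ is hypercyclic on $X'_\beta$. *)

theory Defs
  imports "HOL-Analysis.Analysis" "HOL-Library.Function_Algebras"
begin

(* The scalar field K: a normed field that is R, or is generated over R by a square root of -1.
   Multiplicativity of the norm forces it to be the usual absolute value, so up to isometric
   isomorphism the members of this class are exactly R and C. *)
class real_or_complex = real_normed_field +
  assumes real_or_complex:
    "(\<forall>x. \<exists>a. x = a *\<^sub>R 1) \<or>
     (\<exists>i. i * i = - 1 \<and> (\<forall>x. \<exists>a b. x = a *\<^sub>R 1 + b *\<^sub>R i))"

instance real :: real_or_complex
  by standard simp

instance complex :: real_or_complex
proof
  have "\<exists>a b. x = a *\<^sub>R 1 + b *\<^sub>R \<i>" for x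
    by (rule exI[of _ "Re x"], rule exI[of _ "Im x"]) (simp add: complex_eq_iff)
  then have "\<i> * \<i> = - 1 \<and> (\<forall>x. \<exists>a b. x = a *\<^sub>R 1 + b *\<^sub>R \<i>)"
    by simp
  then show "(\<forall>x::complex. \<exists>a. x = a *\<^sub>R 1) \<or>
     (\<exists>i::complex. i * i = - 1 \<and> (\<forall>x. \<exists>a b. x = a *\<^sub>R 1 + b *\<^sub>R i))"
    by (intro disjI2 exI)
qed

definition convex_over ::
    "('k::real_or_complex \<Rightarrow> 'v::ab_group_add \<Rightarrow> 'v) \<Rightarrow> 'v set \<Rightarrow> bool" where
  "convex_over smul C \<longleftrightarrow>
     (\<forall>x\<in>C. \<forall>y\<in>C. \<forall>u\<in>{0..1}.
        smul (of_real (1 - u)) x + smul (of_real u) y \<in> C)"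

locale locally_convex_space = vector_space smul
  for smul :: "'k::real_or_complex \<Rightarrow> 'a::ab_group_add \<Rightarrow> 'a" +
  fixes X :: "'a topology"
  assumes topspace_UNIV: "topspace X = UNIV"
    and Hausdorff: "Hausdorff_space X"
    and continuous_add: "continuous_map (prod_topology X X) X (\<lambda>(x, y). x + y)"
    and continuous_scale: "continuous_map (prod_topology euclidean X) X (\<lambda>(c, x). smul c x)"
    and locally_convex:
      "\<And>U. openin X U \<Longrightarrow> 0 \<in> U \<Longrightarrow>
         \<exists>V. openin X V \<and> 0 \<in> V \<and> V \<subseteq> U \<and> convex_over smul V"

definition infinite_dimensional ::
    "('k::field \<Rightarrow> 'a::ab_group_add \<Rightarrow> 'a) \<Rightarrow> bool" where
  "infinite_dimensional smul \<longleftrightarrow> (\<nexists>B. finite B \<and> module.span smul B = UNIV)"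

(* The notions below up to hypercyclic take a topology whose topspace may be a proper linear
   subspace of the ambient type, so that they apply to X and to its dual alike. *)

definition ell1_sequence ::
    "('k::real_or_complex \<Rightarrow> 'v::ab_group_add \<Rightarrow> 'v) \<Rightarrow> 'v topology \<Rightarrow> (nat \<Rightarrow> 'v) \<Rightarrow> bool" where
  "ell1_sequence smul Z x \<longleftrightarrow>
     range x \<subseteq> topspace Z \<and>
     limitin Z x 0 sequentially \<and>
     (\<forall>a. summable (\<lambda>n. norm (a n)) \<longrightarrow>
        (\<exists>l. limitin Z (\<lambda>N. \<Sum>n<N. smul (a n) (x n)) l sequentially))"

definition has_dense_span ::
    "('k::real_or_complex \<Rightarrow> 'v::ab_group_add \<Rightarrow> 'v) \<Rightarrow> 'v topology \<Rightarrow> (nat \<Rightarrow> 'v) \<Rightarrow> bool" where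
  "has_dense_span smul Z x \<longleftrightarrow> Z closure_of (module.span smul (range x)) = topspace Z"

definition bounded_in ::
    "('k::real_or_complex \<Rightarrow> 'v::ab_group_add \<Rightarrow> 'v) \<Rightarrow> 'v topology \<Rightarrow> 'v set \<Rightarrow> bool" where
  "bounded_in smul Z B \<longleftrightarrow>
     B \<subseteq> topspace Z \<and>
     (\<forall>U. openin Z U \<and> 0 \<in> U \<longrightarrow> (\<exists>s>0. \<forall>t>s. B \<subseteq> smul (of_real t) ` U))"

definition hypercyclic :: "'v topology \<Rightarrow> ('v \<Rightarrow> 'v) \<Rightarrow> bool" where
  "hypercyclic Z S \<longleftrightarrow> (\<exists>z\<in>topspace Z. Z closure_of (range (\<lambda>n. (S ^^ n) z)) = topspace Z)"

definition continuous_operators ::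
    "('k::real_or_complex \<Rightarrow> 'a::ab_group_add \<Rightarrow> 'a) \<Rightarrow> 'a topology \<Rightarrow> ('a \<Rightarrow> 'a) set" where
  "continuous_operators smul X = {T. Vector_Spaces.linear smul smul T \<and> continuous_map X X T}"

definition continuous_dual ::
    "('k::real_or_complex \<Rightarrow> 'a::ab_group_add \<Rightarrow> 'a) \<Rightarrow> 'a topology \<Rightarrow> ('a \<Rightarrow> 'k) set" where
  "continuous_dual smul X = {f. Vector_Spaces.linear smul (*) f \<and> continuous_map X euclidean f}"

definition fun_smul :: "'k::real_or_complex \<Rightarrow> ('a \<Rightarrow> 'k) \<Rightarrow> 'a \<Rightarrow> 'k" where
  "fun_smul c f = (\<lambda>x. c * f x)"

lemma vector_space_fun_smul: "vector_space fun_smul"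
  by standard (auto simp: fun_smul_def algebra_simps)

definition dual_operator :: "('a \<Rightarrow> 'a) \<Rightarrow> ('a \<Rightarrow> 'k) \<Rightarrow> 'a \<Rightarrow> 'k" where
  "dual_operator T f = (\<lambda>x. f (T x))"

lemma dual_operator_in_continuous_dual:
  assumes "T \<in> continuous_operators smul X" "f \<in> continuous_dual smul X"
  shows "dual_operator T f \<in> continuous_dual smul X"
proof -
  have eq: "dual_operator T f = f \<circ> T"
    by (simp add: dual_operator_def fun_eq_iff)
  have "Vector_Spaces.linear smul smul T" "Vector_Spaces.linear smul (*) f"
    and cont: "continuous_map X X T" "continuous_map X euclidean f"
    using assms by (simp_all add: continuous_dual_def continuous_operators_def)
  from Vector_Spaces.linear_compose[OF this(1,2)] continuous_map_compose[OF cont] show ?thesis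
    by (simp add: continuous_dual_def eq)
qed

definition initial_topology ::
    "'v set \<Rightarrow> ('v \<Rightarrow> 'k::topological_space) set \<Rightarrow> 'v topology" where
  "initial_topology S \<Phi> = topology_generated_by {{v \<in> S. \<phi> v \<in> U} |\<phi> U. \<phi> \<in> \<Phi> \<and> open U}"

lemma topspace_initial_topology: "\<Phi> \<noteq> {} \<Longrightarrow> topspace (initial_topology S \<Phi>) = S"
  unfolding initial_topology_def topology_generated_by_topspace
proof (rule antisym)
  assume "\<Phi> \<noteq> {}"
  then obtain \<phi> where "\<phi> \<in> \<Phi>" by blast
  then have "{v \<in> S. \<phi> v \<in> UNIV} \<in> {{v \<in> S. \<phi> v \<in> U} |\<phi> U. \<phi> \<in> \<Phi> \<and> open U}"
    using open_UNIV by blast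
  then show "S \<subseteq> \<Union>{{v \<in> S. \<phi> v \<in> U} |\<phi> U. \<phi> \<in> \<Phi> \<and> open U}"
    by (simp add: Sup_upper)
qed blast

(* Uniform convergence on the members of A, where v in S is regarded as the function ev v.
   Finite unions are taken because A is not assumed to be directed. *)
definition uniform_convergence_topology ::
    "'v set \<Rightarrow> ('v \<Rightarrow> 'w \<Rightarrow> 'k::real_normed_vector) \<Rightarrow> 'w set set \<Rightarrow> 'v topology" where
  "uniform_convergence_topology S ev \<A> = topology (\<lambda>U.
     U \<subseteq> S \<and>
     (\<forall>u\<in>U. \<exists>\<F> \<epsilon>. finite \<F> \<and> \<F> \<subseteq> \<A> \<and> \<epsilon> > 0 \<and>
        {v \<in> S. \<forall>w\<in>\<Union>\<F>. norm (ev v w - ev u w) < \<epsilon>} \<subseteq> U))"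

lemma openin_uniform_convergence_topology:
  "openin (uniform_convergence_topology S ev \<A>) U \<longleftrightarrow>
     U \<subseteq> S \<and>
     (\<forall>u\<in>U. \<exists>\<F> \<epsilon>. finite \<F> \<and> \<F> \<subseteq> \<A> \<and> \<epsilon> > 0 \<and>
        {v \<in> S. \<forall>w\<in>\<Union>\<F>. norm (ev v w - ev u w) < \<epsilon>} \<subseteq> U)"
proof -
  define N where "N u \<F> \<epsilon> = {v \<in> S. \<forall>w\<in>\<Union>\<F>. norm (ev v w - ev u w) < \<epsilon>}" for u \<F> \<epsilon>
  define P where "P u U \<longleftrightarrow> (\<exists>\<F> \<epsilon>. finite \<F> \<and> \<F> \<subseteq> \<A> \<and> \<epsilon> > 0 \<and> N u \<F> \<epsilon> \<subseteq> U)" for u U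
  have int: "P u (U \<inter> V)" if "P u U" "P u V" for u U V
  proof -
    from that(1) obtain \<F> \<epsilon> where F: "finite \<F>" "\<F> \<subseteq> \<A>" "\<epsilon> > 0" "N u \<F> \<epsilon> \<subseteq> U"
      unfolding P_def by blast
    from that(2) obtain \<G> \<delta> where G: "finite \<G>" "\<G> \<subseteq> \<A>" "\<delta> > 0" "N u \<G> \<delta> \<subseteq> V"
      unfolding P_def by blast
    have "N u (\<F> \<union> \<G>) (min \<epsilon> \<delta>) \<subseteq> N u \<F> \<epsilon> \<inter> N u \<G> \<delta>"
      by (auto simp: N_def)
    then have "N u (\<F> \<union> \<G>) (min \<epsilon> \<delta>) \<subseteq> U \<inter> V"
      using F(4) G(4) by blast
    moreover have "finite (\<F> \<union> \<G>)" "\<F> \<union> \<G> \<subseteq> \<A>" "min \<epsilon> \<delta> > 0"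
      using F G by simp_all
    ultimately show ?thesis
      unfolding P_def by blast
  qed
  have mono: "P u V" if "P u U" "U \<subseteq> V" for u U V
    using that(1) subset_trans[OF _ that(2)] unfolding P_def by blast
  have "istopology (\<lambda>U. U \<subseteq> S \<and> (\<forall>u\<in>U. P u U))"
    unfolding istopology_def
  proof (rule conjI; intro allI impI)
    fix U V assume "U \<subseteq> S \<and> (\<forall>u\<in>U. P u U)" "V \<subseteq> S \<and> (\<forall>u\<in>V. P u V)"
    then show "U \<inter> V \<subseteq> S \<and> (\<forall>u\<in>U \<inter> V. P u (U \<inter> V))"
      by (simp add: int le_infI1)
  next
    fix \<K> assume K: "\<forall>U\<in>\<K>. U \<subseteq> S \<and> (\<forall>u\<in>U. P u U)"
    have "P u (\<Union>\<K>)" if "U \<in> \<K>" "u \<in> U" for u U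
      by (rule mono[of u U]) (use K that in auto)
    with K show "\<Union>\<K> \<subseteq> S \<and> (\<forall>u\<in>\<Union>\<K>. P u (\<Union>\<K>))"
      by (simp add: Sup_le_iff)
  qed
  from topology_inverse'[OF this] show ?thesis
    unfolding uniform_convergence_topology_def P_def N_def by simp
qed

lemma topspace_uniform_convergence_topology:
  "topspace (uniform_convergence_topology S ev \<A>) = S"
proof (rule antisym)
  have "openin (uniform_convergence_topology S ev \<A>) S"
    unfolding openin_uniform_convergence_topology
    by (auto intro!: exI[of _ "{}"] exI[of _ "1::real"])
  then show "S \<subseteq> topspace (uniform_convergence_topology S ev \<A>)"
    by (rule openin_subset)
  show "topspace (uniform_convergence_topology S ev \<A>) \<subseteq> S"
    using openin_topspace[of "uniform_convergence_topology S ev \<A>"]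
    unfolding openin_uniform_convergence_topology by (rule conjunct1)
qed

(* sigma(X,X') *)
definition weak_topology ::
    "('k::real_or_complex \<Rightarrow> 'a::ab_group_add \<Rightarrow> 'a) \<Rightarrow> 'a topology \<Rightarrow> 'a topology" where
  "weak_topology smul X = initial_topology UNIV (continuous_dual smul X)"

(* sigma(X',X) *)
definition weak_star_topology ::
    "('k::real_or_complex \<Rightarrow> 'a::ab_group_add \<Rightarrow> 'a) \<Rightarrow> 'a topology \<Rightarrow> ('a \<Rightarrow> 'k) topology" where
  "weak_star_topology smul X = initial_topology (continuous_dual smul X) (range (\<lambda>x f. f x))"

(* tau(X,X') *)
definition mackey_topology ::
    "('k::real_or_complex \<Rightarrow> 'a::ab_group_add \<Rightarrow> 'a) \<Rightarrow> 'a topology \<Rightarrow> 'a topology" where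
  "mackey_topology smul X =
     uniform_convergence_topology UNIV (\<lambda>x f. f x)
       {K. compactin (weak_star_topology smul X) K \<and> convex_over fun_smul K}"

(* X' with the topology beta(X',X) *)
definition strong_dual ::
    "('k::real_or_complex \<Rightarrow> 'a::ab_group_add \<Rightarrow> 'a) \<Rightarrow> 'a topology \<Rightarrow> ('a \<Rightarrow> 'k) topology" where
  "strong_dual smul X =
     uniform_convergence_topology (continuous_dual smul X) (\<lambda>f x. f x)
       {B. bounded_in smul (weak_topology smul X) B}"

definition uniformly_equicontinuous :: "'a::zero topology \<Rightarrow> ('a \<Rightarrow> 'k::real_or_complex) set \<Rightarrow> bool" where
  "uniformly_equicontinuous X A \<longleftrightarrow>
     (\<exists>U. openin X U \<and> 0 \<in> U \<and> (\<forall>x\<in>U. \<forall>f\<in>A. norm (f x) \<le> 1))"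

definition dual_hypercyclic ::
    "('k::real_or_complex \<Rightarrow> 'a::ab_group_add \<Rightarrow> 'a) \<Rightarrow> 'a topology \<Rightarrow> ('a \<Rightarrow> 'a) \<Rightarrow> bool" where
  "dual_hypercyclic smul X T \<longleftrightarrow>
     T \<in> continuous_operators smul X \<and>
     hypercyclic X T \<and>
     hypercyclic (strong_dual smul X) (dual_operator T)"

end

theory Submission
  imports Defs
begin

text \<open>
  Biorthogonalising the two given \<open>\<ell>\<^sub>1\<close>-sequences yields \<open>e\<^sub>i\<close> in \<open>X\<close> and \<open>g\<^sub>i\<close> in \<open>X'\<close>, indexed by the
  integers, with \<open>g\<^sub>i (e\<^sub>j) = \<delta>\<^sub>i\<^sub>j\<close> and dense spans, together with rapidly decreasing \<open>s\<^sub>i\<close> and \<open>t\<^sub>i\<close> such that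
  \<open>\<Sum> a\<^sub>i e\<^sub>i\<close> and \<open>\<Sum> b\<^sub>i g\<^sub>i\<close> converge whenever \<open>a\<^sub>i = O(s\<^sub>i)\<close> and \<open>b\<^sub>i = O(t\<^sub>i)\<close>. For weights with
  \<open>|w\<^sub>i| \<le> s\<^sub>i\<^sub>-\<^sub>1 t\<^sub>i\<close> the operator \<open>T v = v + \<Sum> w\<^sub>i g\<^sub>i(v) e\<^sub>i\<^sub>-\<^sub>1\<close> acts on the coefficients \<open>a\<close> as
  \<open>1 + weighted backward shift\<close>, and \<open>T'\<close> acts on the coefficients \<open>b\<close> as \<open>1 + weighted forward shift\<close>. Each of
  the three conditions makes \<open>T\<close> continuous: the second one implies that the functionals \<open>2\<^sup>-\<^sup>k f\<^sub>k\<close> are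
  equicontinuous, as the third one does, and under the first one it suffices that \<open>T'\<close> preserves \<open>X'\<close>.

  It remains to choose \<open>w\<close>, \<open>a\<close> and \<open>b\<close> such that both coefficient orbits are dense. This is a Baire-type
  construction. Once the weights and vectors are fixed on a finite window, new weights are attached at the
  right end; on this longer window the backward shift is a Jordan block, and arbitrarily small new entries of
  \<open>a\<close> steer the orbit into any prescribed target. The same at the left end takes care of \<open>b\<close>.
\<close>

section \<open>Lagrange interpolation and the operator 1 + backward shift\<close>

text \<open>Neither \<open>X\<close> nor its strong dual is assumed complete, metrizable or Baire,
  so no category argument can run in the spaces themselves. It runs on coefficient families bounded
  by \<open>s\<close> and \<open>t\<close>, where coordinatewise limits always exist; the
  ell1-hypotheses then turn such a family into a vector. One weight sequence has to serve both
  spaces. A coordinate g_i(v) is only known to be O(1/t_i), while the coefficient that it feeds at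
  i-1 must be O(s_{i-1}). This dictates |w_i| <= s_{i-1} t_i, a bound that is symmetric under
  exchanging the two spaces. Steering works because on a block of length 2d the operator 1 +
  backward shift is translation of polynomials of degree below 2d: d coefficients of the start and d
  of the arrival can be prescribed, and a long translation drives the nodes apart, so that the
  remaining coefficients at both ends tend to 0. For a fixed number of iterations the orbit depends
  continuously, in the weighted sup norm, on weights and vector together. Hence later windows can
  alter the tails without spoiling earlier hits.\<close>

definition shift_step :: "(nat \<Rightarrow> 'k::comm_ring_1) \<Rightarrow> nat \<Rightarrow> 'k" where
  "shift_step q i = q i + q (Suc i)"

definition fwd_diff :: "(nat \<Rightarrow> 'k::comm_ring_1) \<Rightarrow> nat \<Rightarrow> 'k" where
  "fwd_diff Q z = Q (Suc z) - Q z"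

lemma fwd_diff_Suc: "(fwd_diff ^^ Suc i) Q z = (fwd_diff ^^ i) Q (Suc z) - (fwd_diff ^^ i) Q z"
  by (simp add: fwd_diff_def)

lemma fwd_diff_Suc': "(fwd_diff ^^ Suc i) Q = (\<lambda>z. (fwd_diff ^^ i) Q (Suc z) - (fwd_diff ^^ i) Q z)"
  by (rule ext) (rule fwd_diff_Suc)

text \<open>Since \<open>Q (Suc z) = Q z + fwd_diff Q z\<close>, one step re-expands a polynomial
  given by its Newton coefficients at \<open>m\<close> around \<open>m + 1\<close>.\<close>

lemma shift_step_fwd_diff:
  "(shift_step ^^ n) (\<lambda>i. (fwd_diff ^^ i) Q m) = (\<lambda>i. (fwd_diff ^^ i) Q (m + n))"
  by (induction n) (auto simp: shift_step_def fwd_diff_def)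

text \<open>The converse dictionary: at \<open>z = 0\<close> it exhibits an arbitrary
  \<open>u\<close> as the Newton coefficients of
  \<open>\<lambda>z. (shift_step ^^ z) u 0\<close>.\<close>

lemma fwd_diff_shift_step:
  "(fwd_diff ^^ i) (\<lambda>z. (shift_step ^^ z) u k) = (\<lambda>z. (shift_step ^^ z) u (k + i))"
  by (induction i) (auto simp: shift_step_def fwd_diff_def fun_eq_iff)

text \<open>Locality of differences: agreement at \<open>d\<close> consecutive nodes already fixes
  the first \<open>d\<close> Newton coefficients.\<close>

lemma fwd_diff_cong:
  assumes "\<And>h. h \<le> i \<Longrightarrow> Q (m + h) = R (m + h)"
  shows "(fwd_diff ^^ i) Q m = (fwd_diff ^^ i) R m"
  using assms
proof (induction i arbitrary: m)
  case (Suc i)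
  have "(fwd_diff ^^ i) Q (Suc m) = (fwd_diff ^^ i) R (Suc m)"
  proof (rule Suc.IH)
    fix h assume "h \<le> i"
    then show "Q (Suc m + h) = R (Suc m + h)" using Suc.prems[of "Suc h"] by simp
  qed
  moreover have "(fwd_diff ^^ i) Q m = (fwd_diff ^^ i) R m"
    using Suc.prems by (intro Suc.IH) simp
  ultimately show ?case by (simp only: fwd_diff_Suc)
qed simp

lemma fwd_diff_zero: "(fwd_diff ^^ i) (\<lambda>z. 0) = (\<lambda>z. 0)"
  by (induction i) (auto simp: fwd_diff_def)

lemma fwd_diff_mono:
  assumes "(fwd_diff ^^ i) Q = (\<lambda>z. 0)" "i \<le> j"
  shows "(fwd_diff ^^ j) Q = (\<lambda>z. 0)"
proof -
  have "(fwd_diff ^^ j) Q = (fwd_diff ^^ (j - i)) ((fwd_diff ^^ i) Q)"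
    using assms(2) by (simp flip: funpow_add comp_apply[of "_ ^^ _" "_ ^^ _"])
  then show ?thesis by (simp add: assms fwd_diff_zero)
qed

lemma fwd_diff_sum:
  "(fwd_diff ^^ i) (\<lambda>z. \<Sum>j\<in>A. c j * F j z) = (\<lambda>z. \<Sum>j\<in>A. c j * (fwd_diff ^^ i) (F j) z)"
  by (induction i) (auto simp: fwd_diff_def sum_subtractf algebra_simps)

lemma fwd_diff_add:
  "(fwd_diff ^^ i) (\<lambda>z. F z + G z) = (\<lambda>z. (fwd_diff ^^ i) F z + (fwd_diff ^^ i) G z)"
  by (induction i) (auto simp: fwd_diff_def)

text \<open>Leibniz rule for differences; only two terms survive because the second difference of an
  affine factor vanishes.\<close>

lemma fwd_diff_affine_mult:
  "(fwd_diff ^^ Suc k) (\<lambda>z. (\<alpha> * of_nat z + \<beta>) * Q z) =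
   (\<lambda>z. (\<alpha> * of_nat z + \<beta>) * (fwd_diff ^^ Suc k) Q z
         + of_nat (Suc k) * \<alpha> * (fwd_diff ^^ k) Q (Suc z))"
proof (induction k)
  case 0
  show ?case by (auto simp: fwd_diff_def algebra_simps)
next
  case (Suc k)
  show ?case
    unfolding fwd_diff_Suc'[of "Suc k"] Suc.IH
    by (rule ext, simp only: fwd_diff_Suc) (simp add: algebra_simps)
qed

text \<open>By the Leibniz rule each affine factor raises the degree by at most one; degree is
  expressed by the vanishing of higher differences.\<close>

lemma fwd_diff_prod_affine:
  assumes "finite A"
  shows "(fwd_diff ^^ Suc (card A)) (\<lambda>z. \<Prod>a\<in>A. (\<alpha> a * of_nat z + \<beta> a)) = (\<lambda>z. 0)"
  using assms
proof (induction A)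
  case empty
  show ?case by (simp add: fwd_diff_def)
next
  case (insert a A)
  have "(fwd_diff ^^ Suc (Suc (card A))) (\<lambda>z. \<Prod>a\<in>A. (\<alpha> a * of_nat z + \<beta> a)) = (\<lambda>z. 0)"
    by (rule fwd_diff_mono[OF insert.IH]) simp
  then show ?case
    using insert.hyps insert.IH
    by (simp add: fwd_diff_affine_mult del: funpow.simps)
qed

lemma fwd_diff_tendsto:
  fixes Q :: "nat \<Rightarrow> nat \<Rightarrow> 'k::real_normed_field" and z i :: nat
  assumes "\<And>z. (\<lambda>n. Q n z) \<longlonglongrightarrow> R z"
  shows "(\<lambda>n. (fwd_diff ^^ i) (Q n) z) \<longlonglongrightarrow> (fwd_diff ^^ i) R z"
proof (induction i arbitrary: z)
  case 0
  show ?case by (simp add: assms)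
next
  case (Suc i)
  show ?case
    using tendsto_diff[OF Suc.IH[of "Suc z"] Suc.IH[of z]] by (simp add: fwd_diff_def)
qed

section \<open>Lagrange bases on one and on two blocks of nodes\<close>

definition lagr :: "nat \<Rightarrow> nat \<Rightarrow> 'k::field \<Rightarrow> 'k" where
  "lagr d j \<zeta> = (\<Prod>k\<in>{..<d}-{j}. (\<zeta> - of_nat k) / (of_nat j - of_nat k))"

text \<open>The Lagrange basis for the nodes \<open>0..d-1\<close> and \<open>s..s+d-1\<close>, with
  \<open>j\<close> in the first block. The other block is served by translating the argument and
  negating \<open>s\<close>.\<close>

definition lagr2 :: "nat \<Rightarrow> nat \<Rightarrow> 'k::field \<Rightarrow> 'k \<Rightarrow> 'k" where
  "lagr2 d j s \<zeta> = lagr d j \<zeta> * (\<Prod>k<d. (\<zeta> - s - of_nat k) / (of_nat j - s - of_nat k))"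

lemma lagr_node:
  fixes h j d :: nat
  assumes "h < d" "j < d"
  shows "lagr d j (of_nat h :: 'k::field_char_0) = (if h = j then 1 else 0)"
proof (cases "h = j")
  case True
  have "lagr d j (of_nat h :: 'k) = (\<Prod>k\<in>{..<d}-{j}. 1)"
    unfolding lagr_def by (rule prod.cong) (auto simp: True)
  then show ?thesis using True by simp
next
  case False
  then show ?thesis unfolding lagr_def using assms by (auto intro!: prod_zero)
qed

lemma lagr2_node:
  fixes s :: "'k::field_char_0"
  assumes "h < d" "j < d" and s: "\<And>k. k < d \<Longrightarrow> of_nat j - s \<noteq> of_nat k"
  shows "lagr2 d j s (of_nat h) = (if h = j then 1 else 0)"
    and "lagr2 d j s (of_nat h + s) = 0"
proof -
  have "(\<Prod>k<d. (of_nat j - s - of_nat k) / (of_nat j - s - of_nat k)) = (\<Prod>k<d. 1)"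
    using s by (intro prod.cong) auto
  then show "lagr2 d j s (of_nat h) = (if h = j then 1 else 0)"
    unfolding lagr2_def lagr_node[OF assms(1,2)] by auto
  show "lagr2 d j s (of_nat h + s) = 0"
    unfolding lagr2_def using assms(1) by (auto intro!: prod_zero)
qed

lemma at_infinity_ratio:
  fixes s :: "nat \<Rightarrow> 'k::real_normed_field"
  assumes "filterlim s at_infinity sequentially"
  shows "(\<lambda>n. c / (b - s n)) \<longlonglongrightarrow> 0"
    and "\<forall>\<^sub>F n in sequentially. b - s n \<noteq> 0"
proof -
  have "filterlim (\<lambda>n. - s n) at_infinity sequentially"
    using assms by (simp add: filterlim_at_infinity[OF order_refl])
  then have lim: "filterlim (\<lambda>n. b - s n) at_infinity sequentially"
    using tendsto_add_filterlim_at_infinity[OF tendsto_const[of b]] by fastforce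
  show "(\<lambda>n. c / (b - s n)) \<longlonglongrightarrow> 0"
    by (rule tendsto_divide_0[OF tendsto_const lim])
  show "\<forall>\<^sub>F n in sequentially. b - s n \<noteq> 0"
    using lim by (rule filterlim_at_infinity_imp_eventually_ne)
qed

text \<open>A factor belonging to a distant node is a quotient of two quantities that both differ
  from \<open>- s n\<close> by a constant, so it tends to 1.\<close>

lemma lagr2_tendsto:
  fixes s :: "nat \<Rightarrow> 'k::real_normed_field"
  assumes s: "filterlim s at_infinity sequentially"
  shows "(\<lambda>n. lagr2 d j (s n) \<zeta>) \<longlonglongrightarrow> lagr d j \<zeta>"
proof -
  have ratio: "of_nat j - s n - of_nat k = (of_nat j - of_nat k) - s n" for k n
    by simp
  have "(\<lambda>n. (\<zeta> - s n - of_nat k) / (of_nat j - s n - of_nat k)) \<longlonglongrightarrow> 1" for k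
  proof -
    have "(\<lambda>n. 1 + (\<zeta> - of_nat j) / ((of_nat j - of_nat k) - s n)) \<longlonglongrightarrow> 1 + 0"
      by (intro tendsto_add tendsto_const at_infinity_ratio s)
    moreover have "\<forall>\<^sub>F n in sequentially. 1 + (\<zeta> - of_nat j) / ((of_nat j - of_nat k) - s n)
        = (\<zeta> - s n - of_nat k) / (of_nat j - s n - of_nat k)"
      using at_infinity_ratio(2)[OF s, of "of_nat j - of_nat k"]
      by eventually_elim (subst ratio, simp add: add_divide_eq_iff)
    ultimately show ?thesis using Lim_transform_eventually by fastforce
  qed
  then have "(\<lambda>n. lagr d j \<zeta> * (\<Prod>k<d. (\<zeta> - s n - of_nat k) / (of_nat j - s n - of_nat k)))
      \<longlonglongrightarrow> lagr d j \<zeta> * (\<Prod>k<d. 1)"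
    by (intro tendsto_mult tendsto_const tendsto_prod)
  then show ?thesis by (simp add: lagr2_def)
qed

text \<open>At the distant block \<open>d - 1\<close> numerators and \<open>d\<close> denominators
  grow like \<open>s n\<close>. After pairing them by \<open>k\<close>, the unpaired factor
  \<open>k = j\<close> forces the limit 0.\<close>

lemma lagr2_tendsto_0:
  fixes s :: "nat \<Rightarrow> 'k::real_normed_field"
  assumes s: "filterlim s at_infinity sequentially" and j: "j < d"
  shows "(\<lambda>n. lagr2 d j (s n) (\<zeta> + s n)) \<longlonglongrightarrow> 0"
proof -
  have eq: "lagr2 d j (s n) (\<zeta> + s n) =
    (\<Prod>k\<in>{..<d}-{j}. ((\<zeta> - of_nat k + s n) / ((of_nat j - of_nat k) - s n)) *
        ((\<zeta> - of_nat k) / (of_nat j - of_nat k))) * ((\<zeta> - of_nat j) / (0 - s n))" for n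
  proof -
    have "(\<Prod>k<d. (\<zeta> - of_nat k) / (of_nat j - s n - of_nat k)) =
      ((\<zeta> - of_nat j) / (0 - s n)) * (\<Prod>k\<in>{..<d}-{j}. (\<zeta> - of_nat k) / (of_nat j - s n - of_nat k))"
      using j by (subst prod.remove[of _ j]) auto
    moreover have "(\<Prod>k\<in>{..<d}-{j}. ((\<zeta> - of_nat k + s n) / ((of_nat j - of_nat k) - s n)) *
        ((\<zeta> - of_nat k) / (of_nat j - of_nat k)))
      = (\<Prod>k\<in>{..<d}-{j}. ((\<zeta> + s n - of_nat k) / (of_nat j - of_nat k)) *
        ((\<zeta> - of_nat k) / (of_nat j - s n - of_nat k)))"
      by (rule prod.cong) (auto simp: algebra_simps)
    ultimately show ?thesis
      unfolding lagr2_def lagr_def prod.distrib by (simp only: mult_ac add_diff_cancel_right')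
  qed
  have neg1: "-1 + x / b = (x - b) / b" if "b \<noteq> 0" for x b :: 'k
    using that by (simp add: diff_divide_distrib)
  have "(\<lambda>n. (\<zeta> - of_nat k + s n) / ((of_nat j - of_nat k) - s n)) \<longlonglongrightarrow> -1" for k
  proof -
    have "(\<lambda>n. -1 + (\<zeta> + of_nat j - 2 * of_nat k) / ((of_nat j - of_nat k) - s n)) \<longlonglongrightarrow> -1 + 0"
      by (intro tendsto_add tendsto_const at_infinity_ratio s)
    moreover have "\<forall>\<^sub>F n in sequentially.
        -1 + (\<zeta> + of_nat j - 2 * of_nat k) / ((of_nat j - of_nat k) - s n)
        = (\<zeta> - of_nat k + s n) / ((of_nat j - of_nat k) - s n)"
      using at_infinity_ratio(2)[OF s, of "of_nat j - of_nat k"]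
      by eventually_elim (subst neg1, auto intro!: arg_cong2[where f="(/)"])
    ultimately show ?thesis using Lim_transform_eventually by fastforce
  qed
  then have "(\<lambda>n. lagr2 d j (s n) (\<zeta> + s n)) \<longlonglongrightarrow>
     (\<Prod>k\<in>{..<d}-{j}. -1 * ((\<zeta> - of_nat k) / (of_nat j - of_nat k))) * 0"
    unfolding eq by (intro tendsto_mult tendsto_prod tendsto_const at_infinity_ratio s)
  then show ?thesis by simp
qed

lemma fwd_diff_lagr:
  assumes "j < d"
  shows "(fwd_diff ^^ d) (\<lambda>z. lagr d j (of_nat z)) = (\<lambda>z. 0)"
proof -
  let ?D = "\<lambda>k. of_nat j - of_nat k"
  have "lagr d j (of_nat z) = (\<Prod>k\<in>{..<d}-{j}. (1 / ?D k) * of_nat z + (- of_nat k / ?D k))" for z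
    unfolding lagr_def by (rule prod.cong) (auto simp: diff_divide_distrib)
  then have eq: "(\<lambda>z. lagr d j (of_nat z)) =
      (\<lambda>z. \<Prod>k\<in>{..<d}-{j}. (1 / ?D k) * of_nat z + (- of_nat k / ?D k))" ..
  have "Suc (card ({..<d}-{j})) = d"
    using assms by simp
  then show ?thesis
    using fwd_diff_prod_affine[of "{..<d}-{j}" "\<lambda>k. 1 / ?D k" "\<lambda>k. - of_nat k / ?D k",
        OF finite_Diff[OF finite_lessThan]]
    unfolding eq by (simp only:)
qed

text \<open>A product of \<open>(d - 1) + d\<close> affine factors has degree below
  \<open>2 * d\<close>. The translation \<open>c\<close> covers the second block, whose basis is
  used in the variable \<open>z - n\<close>.\<close>

lemma fwd_diff_lagr2:
  assumes "j < d"
  shows "(fwd_diff ^^ (2 * d)) (\<lambda>z. lagr2 d j s (of_nat z - c)) = (\<lambda>z. 0)"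
proof -
  let ?A = "({..<d}-{j}) <+> {..<d}"
  let ?D = "\<lambda>k. of_nat j - of_nat k" and ?E = "\<lambda>k. of_nat j - s - of_nat k"
  let ?a = "case_sum (\<lambda>k. 1 / ?D k) (\<lambda>k. 1 / ?E k)"
  let ?b = "case_sum (\<lambda>k. (- c - of_nat k) / ?D k) (\<lambda>k. (- c - s - of_nat k) / ?E k)"
  have *: "lagr2 d j s (of_nat z - c) = (\<Prod>a\<in>?A. ?a a * of_nat z + ?b a)" for z
  proof -
    have "(of_nat z - c - of_nat k) / ?D k = 1 / ?D k * of_nat z + (- c - of_nat k) / ?D k"
      "(of_nat z - c - s - of_nat k) / ?E k = 1 / ?E k * of_nat z + (- c - s - of_nat k) / ?E k" for k
      by (simp_all flip: add_divide_distrib)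
    then show ?thesis
      unfolding lagr2_def lagr_def by (subst prod.Plus) (simp_all only: finite_lessThan finite_Diff sum.case comp_def)
  qed
  have "card ?A = (d - 1) + d"
    using assms by (subst card_Plus) auto
  then have "Suc (card ?A) = 2 * d"
    using assms by linarith
  then show ?thesis
    using fwd_diff_prod_affine[of ?A ?a ?b, OF finite_Plus[OF finite_Diff finite_lessThan]]
    unfolding * by (simp only: finite_lessThan)
qed

text \<open>Identifying \<open>q\<close> with the polynomial \<open>Q\<close> whose Newton coefficients are \<open>q i = (\<Delta>^i Q) 0\<close>
  turns the operator \<open>1 + backward shift\<close> into the translation \<open>Q \<mapsto> Q (\<cdot> + 1)\<close>, so that the orbit
  condition becomes Lagrange interpolation at the nodes \<open>0..d-1\<close> and \<open>n..n+d-1\<close>.\<close>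
lemma shift_step_hits:
  fixes u v :: "nat \<Rightarrow> 'k::real_normed_field"
  assumes u: "\<And>i. i \<ge> d \<Longrightarrow> u i = 0" and v: "\<And>i. i \<ge> d \<Longrightarrow> v i = 0" and \<delta>: "\<delta> > 0"
  obtains n q where "\<And>i. i < d \<Longrightarrow> q i = u i" "\<And>i. i \<ge> 2 * d \<Longrightarrow> q i = 0"
    "\<And>i. i \<ge> d \<Longrightarrow> norm (q i) < \<delta>" "\<And>i. i < d \<Longrightarrow> (shift_step ^^ n) q i = v i"
    "\<And>i. i \<ge> d \<Longrightarrow> norm ((shift_step ^^ n) q i) < \<delta>"
proof -
  \<comment> \<open>\<open>U\<close> and \<open>V\<close> have Newton coefficients \<open>u\<close>
    and \<open>v\<close>; their values at \<open>0..d-1\<close> are the data to be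
    interpolated.\<close>
  define U V where "U z = (shift_step ^^ z) u 0" and "V z = (shift_step ^^ z) v 0" for z
  have U: "(fwd_diff ^^ i) U 0 = u i" and V: "(fwd_diff ^^ i) V 0 = v i" for i
    using fwd_diff_shift_step[of i u 0] fwd_diff_shift_step[of i v 0]
    unfolding U_def V_def by simp_all
  \<comment> \<open>\<open>Q n\<close> takes the values of \<open>U\<close> at \<open>0..d-1\<close>
    and those of \<open>V\<close> at \<open>n..n+d-1\<close>. The second sum is centred at
    \<open>n\<close>, from where the first block sits at offset \<open>- n\<close>.\<close>
  define Q where "Q n z = (\<Sum>j<d. U j * lagr2 d j (of_nat n) (of_nat z))
     + (\<Sum>j<d. V j * lagr2 d j (- of_nat n) (of_nat z - of_nat n))" for n z
  \<comment> \<open>The limits of \<open>Q n\<close> as seen from 0 and from \<open>n\<close>. Their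
    degree is below \<open>d\<close>, so the Newton coefficients of \<open>Q n\<close> from
    \<open>d\<close> on tend to 0 at both places.\<close>
  define LU LV where "LU z = (\<Sum>j<d. U j * lagr d j (of_nat z))"
    and "LV z = (\<Sum>j<d. V j * lagr d j (of_nat z))" for z :: nat
  have inf: "filterlim (of_nat :: nat \<Rightarrow> 'k) at_infinity sequentially"
    "filterlim (\<lambda>n. - of_nat n :: 'k) at_infinity sequentially"
    using tendsto_of_nat[where 'a = 'k] by (simp_all add: filterlim_at_infinity[OF order_refl])
  have LU: "(fwd_diff ^^ i) LU = (\<lambda>z. 0)" and LV: "(fwd_diff ^^ i) LV = (\<lambda>z. 0)" if "i \<ge> d" for i
  proof -
    have "(fwd_diff ^^ i) (\<lambda>z. lagr d j (of_nat z :: 'k)) = (\<lambda>z. 0)" if "j < d" for j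
      using fwd_diff_mono[OF fwd_diff_lagr[OF that] \<open>i \<ge> d\<close>] .
    then show "(fwd_diff ^^ i) LU = (\<lambda>z. 0)" "(fwd_diff ^^ i) LV = (\<lambda>z. 0)"
      unfolding LU_def LV_def fwd_diff_sum by simp_all
  qed
  have Q0: "(\<lambda>n. Q n z) \<longlonglongrightarrow> LU z" for z
  proof -
    have "(\<lambda>n. Q n z) \<longlonglongrightarrow> LU z + (\<Sum>j<d. V j * 0)"
      unfolding Q_def LU_def
      by (intro tendsto_add tendsto_sum tendsto_mult tendsto_const lagr2_tendsto inf)
        (use lagr2_tendsto_0[OF inf(2)] in auto)
    then show ?thesis by simp
  qed
  have Qn: "(\<lambda>n. Q n (n + z)) \<longlonglongrightarrow> LV z" for z
  proof -
    have "(\<lambda>n. (\<Sum>j<d. U j * lagr2 d j (of_nat n) (of_nat z + of_nat n))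
       + (\<Sum>j<d. V j * lagr2 d j (- of_nat n) (of_nat z))) \<longlonglongrightarrow> (\<Sum>j<d. U j * 0) + LV z"
      unfolding LV_def
      by (intro tendsto_add tendsto_sum tendsto_mult tendsto_const lagr2_tendsto lagr2_tendsto_0 inf)
        auto
    then show ?thesis by (simp add: Q_def add.commute)
  qed
  \<comment> \<open>For \<open>n \<ge> d\<close> the two blocks are disjoint, so no denominator
    vanishes.\<close>
  have node_ne: "of_nat j - of_nat n \<noteq> (of_nat k :: 'k)" "of_nat j - - of_nat n \<noteq> (of_nat k :: 'k)"
    if "n \<ge> d" "j < d" "k < d" for n j k
  proof -
    have "j \<noteq> n + k" "j + n \<noteq> k" using that by auto
    then have "of_nat j \<noteq> (of_nat (n + k) :: 'k)" "of_nat (j + n) \<noteq> (of_nat k :: 'k)"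
      unfolding of_nat_eq_iff by auto
    then show "of_nat j - of_nat n \<noteq> (of_nat k :: 'k)" "of_nat j - - of_nat n \<noteq> (of_nat k :: 'k)"
      by (auto simp: algebra_simps)
  qed
  have node1: "Q n h = U h" if "n \<ge> d" "h < d" for n h
  proof -
    have "Q n h = (\<Sum>j<d. U j * (if h = j then 1 else 0)) + (\<Sum>j<d. V j * 0)"
      unfolding Q_def using lagr2_node(1)[OF \<open>h < d\<close> _ node_ne(1)[OF \<open>n \<ge> d\<close>]] lagr2_node(2)[OF \<open>h < d\<close> _ node_ne(2)[OF \<open>n \<ge> d\<close>]]
      by (intro arg_cong2[where f="(+)"] sum.cong) auto
    then show ?thesis using that by (simp add: if_distrib cong: if_cong)
  qed
  have node2: "Q n (n + h) = V h" if "n \<ge> d" "h < d" for n h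
  proof -
    have "Q n (n + h) = (\<Sum>j<d. U j * 0) + (\<Sum>j<d. V j * (if h = j then 1 else 0))"
      unfolding Q_def using lagr2_node(2)[OF \<open>h < d\<close> _ node_ne(1)[OF \<open>n \<ge> d\<close>]] lagr2_node(1)[OF \<open>h < d\<close> _ node_ne(2)[OF \<open>n \<ge> d\<close>]]
      by (intro arg_cong2[where f="(+)"] sum.cong) (auto simp: add.commute)
    then show ?thesis using that by (simp add: if_distrib cong: if_cong)
  qed
  have deg: "(fwd_diff ^^ i) (Q n) = (\<lambda>z. 0)" if "i \<ge> 2 * d" for n i
  proof -
    have "(fwd_diff ^^ i) (\<lambda>z. lagr2 d j s (of_nat z - c :: 'k)) = (\<lambda>z. 0)" if "j < d" for j s c
      using fwd_diff_mono[OF fwd_diff_lagr2[OF that] \<open>i \<ge> 2 * d\<close>] .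
    note this[where c = 0, simplified] this
    then show ?thesis
      unfolding Q_def fwd_diff_add fwd_diff_sum by simp
  qed
  have shift: "(fwd_diff ^^ i) (Q n) (n + z) = (fwd_diff ^^ i) (\<lambda>z. Q n (n + z)) z" for i n z
  proof (induction i arbitrary: z)
    case (Suc i)
    show ?case using Suc.IH[of z] Suc.IH[of "Suc z"] by (simp add: fwd_diff_Suc del: funpow.simps)
  qed simp
  have "\<forall>\<^sub>F n in sequentially. \<forall>i\<in>{d..<2*d}.
      norm ((fwd_diff ^^ i) (Q n) 0) < \<delta> \<and> norm ((fwd_diff ^^ i) (Q n) n) < \<delta>"
  proof (rule eventually_ball_finite; (intro ballI)?)
    fix i assume "i \<in> {d..<2*d}"
    then have i: "i \<ge> d" by simp
    have "(\<lambda>n. (fwd_diff ^^ i) (Q n) 0) \<longlonglongrightarrow> 0"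
      using fwd_diff_tendsto[of Q LU i 0, OF Q0] LU[OF i] by simp
    moreover have "(\<lambda>n. (fwd_diff ^^ i) (Q n) n) \<longlonglongrightarrow> 0"
      using fwd_diff_tendsto[of "\<lambda>n z. Q n (n + z)" LV i 0, OF Qn] LV[OF i] shift[of i _ 0] by simp
    ultimately show "\<forall>\<^sub>F n in sequentially.
        norm ((fwd_diff ^^ i) (Q n) 0) < \<delta> \<and> norm ((fwd_diff ^^ i) (Q n) n) < \<delta>"
      using \<delta> by (intro eventually_conj) (auto dest: tendstoD simp: dist_norm)
  qed simp
  \<comment> \<open>One \<open>n\<close> serves all indices: only those in \<open>{d..<2*d}\<close>
    need an estimate, since from \<open>2 * d\<close> on the degree makes both sequences
    vanish.\<close>
  then obtain n where n: "n \<ge> d" and small: "\<And>i. i \<in> {d..<2*d} \<Longrightarrow>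
      norm ((fwd_diff ^^ i) (Q n) 0) < \<delta> \<and> norm ((fwd_diff ^^ i) (Q n) n) < \<delta>"
    unfolding eventually_sequentially by (meson le_cases order_refl)
  define q where "q i = (fwd_diff ^^ i) (Q n) 0" for i
  have Tq: "(shift_step ^^ n) q = (\<lambda>i. (fwd_diff ^^ i) (Q n) n)"
    unfolding q_def using shift_step_fwd_diff[of n "Q n" 0] by simp
  show thesis
  proof
    show "q i = u i" if "i < d" for i
      unfolding q_def U[symmetric] using that node1[OF n] by (intro fwd_diff_cong) simp
    show "q i = 0" if "i \<ge> 2 * d" for i
      unfolding q_def deg[OF that] ..
    show "norm (q i) < \<delta>" if "i \<ge> d" for i
      using small[of i] that deg[of i n] \<delta> by (cases "i < 2 * d") (auto simp: q_def)
    show "(shift_step ^^ n) q i = v i" if "i < d" for i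
    proof -
      have "(fwd_diff ^^ i) (\<lambda>z. Q n (n + z)) 0 = (fwd_diff ^^ i) V 0"
        using that node2[OF n] by (intro fwd_diff_cong) simp
      then show ?thesis unfolding Tq V[symmetric] using shift[of i n 0] by simp
    qed
    show "norm ((shift_step ^^ n) q i) < \<delta>" if "i \<ge> d" for i
      using small[of i] that deg[of i n] \<delta> by (cases "i < 2 * d") (auto simp: Tq)
  qed
qed

section \<open>Simultaneous universal vectors for a bilateral shift\<close>

definition bshift :: "(int \<Rightarrow> 'k::comm_ring_1) \<Rightarrow> (int \<Rightarrow> 'k) \<Rightarrow> int \<Rightarrow> 'k" where
  "bshift w a i = a i + w (i + 1) * a (i + 1)"

definition fshift :: "(int \<Rightarrow> 'k::comm_ring_1) \<Rightarrow> (int \<Rightarrow> 'k) \<Rightarrow> int \<Rightarrow> 'k" where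
  "fshift w a i = a i + w i * a (i - 1)"

text \<open>Reversing the integers exchanges the two shifts. The weight \<open>w i\<close> links the
  sites \<open>i - 1\<close> and \<open>i\<close>, so the reversal \<open>i \<mapsto> - i\<close> of
  sites acts as \<open>i \<mapsto> 1 - i\<close> on weights.\<close>

lemma fshift_reflect:
  "(fshift w ^^ n) a i = (bshift (\<lambda>i. w (1 - i)) ^^ n) (\<lambda>i. a (- i)) (- i)"
  by (induction n arbitrary: i) (auto simp: fshift_def bshift_def)

text \<open>The weights vanish outside the window, so the block decouples, and a diagonal change of
  basis turns it into the unweighted step on \<open>2 * D\<close> coordinates. The \<open>D\<close>
  sites added on the right carry the free coefficients of \<open>shift_step_hits\<close>.\<close>

lemma bshift_window_hits:
  fixes w x u :: "int \<Rightarrow> 'k::real_normed_field" and s :: "int \<Rightarrow> real"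
  assumes D: "hi = lo + int D - 1" "hi' = lo + 2 * int D - 1"
    and w: "\<And>i. lo < i \<Longrightarrow> i \<le> hi' \<Longrightarrow> w i \<noteq> 0" "\<And>i. \<not> (lo < i \<and> i \<le> hi') \<Longrightarrow> w i = 0"
    and x: "\<And>i. \<not> (lo \<le> i \<and> i \<le> hi) \<Longrightarrow> x i = 0"
    and u: "\<And>i. \<not> (lo \<le> i \<and> i \<le> hi) \<Longrightarrow> u i = 0"
    and s: "\<And>i. s i > 0" and \<delta>: "\<delta> > 0"
  obtains n x' where "\<And>i. i \<le> hi \<Longrightarrow> x' i = x i" "\<And>i. i > hi' \<Longrightarrow> x' i = 0"
    "\<And>i. i > hi \<Longrightarrow> norm (x' i) \<le> \<delta> * s i"
    "\<And>i. norm ((bshift w ^^ n) x' i - u i) \<le> \<delta> * s i"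
proof -
  \<comment> \<open>Rescaling the site \<open>lo + k\<close> by \<open>\<rho> k\<close> absorbs the
    weights.\<close>
  define \<rho> where "\<rho> k = (\<Prod>m\<in>{1..k}. w (lo + int m))" for k
  have \<rho>0: "\<rho> k \<noteq> 0" if "k < 2 * D" for k
    unfolding \<rho>_def using that w(1) D by auto
  have \<rho>Suc: "\<rho> (Suc k) = \<rho> k * w (lo + int k + 1)" for k
    unfolding \<rho>_def by (simp add: algebra_simps)
  \<comment> \<open>Entries below \<open>\<eta>\<close> are below \<open>\<delta> * s\<close> after
    division by \<open>\<rho>\<close>. The inserted 1 keeps the minimum defined when
    \<open>D = 0\<close>.\<close>
  define \<eta> where "\<eta> = Min (insert 1 ((\<lambda>k. norm (\<rho> k) * (\<delta> * s (lo + int k))) ` {..<2*D}))"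
  have \<eta>: "\<eta> > 0" "\<And>k. k < 2 * D \<Longrightarrow> \<eta> \<le> norm (\<rho> k) * (\<delta> * s (lo + int k))"
    unfolding \<eta>_def using \<rho>0 s \<delta> by (auto simp: Min_gr_iff)
  define xx uu where "xx k = (if k < D then \<rho> k * x (lo + int k) else 0)"
    and "uu k = (if k < D then \<rho> k * u (lo + int k) else 0)" for k
  obtain n q where q: "\<And>i. i < D \<Longrightarrow> q i = xx i" "\<And>i. i \<ge> 2 * D \<Longrightarrow> q i = 0"
    "\<And>i. i \<ge> D \<Longrightarrow> norm (q i) < \<eta>" "\<And>i. i < D \<Longrightarrow> (shift_step ^^ n) q i = uu i"
    "\<And>i. i \<ge> D \<Longrightarrow> norm ((shift_step ^^ n) q i) < \<eta>"
    by (rule shift_step_hits[of D xx uu \<eta>]) (auto simp: \<eta> xx_def uu_def)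
  define lift where "lift r i = (if lo \<le> i \<and> i \<le> hi' then r (nat (i - lo)) / \<rho> (nat (i - lo)) else 0)" for r i
  have qm: "(shift_step ^^ m) q i = 0" if "i \<ge> 2 * D" for m i
    using that by (induction m arbitrary: i) (auto simp: shift_step_def q)
  have lift: "(bshift w ^^ m) (lift q) = lift ((shift_step ^^ m) q)" for m
  proof (induction m)
    case (Suc m)
    let ?r = "(shift_step ^^ m) q"
    have "bshift w (lift ?r) i = lift (shift_step ?r) i" for i
    proof (cases "lo \<le> i \<and> i \<le> hi'")
      case True
      define k where "k = nat (i - lo)"
      have i: "i = lo + int k" and k: "k < 2 * D" using True D by (auto simp: k_def)
      show ?thesis
      proof (cases "k = 2 * D - 1")
        case k1: True
        then have "\<not> (i + 1 \<le> hi')" "Suc k \<ge> 2 * D" using i k D by auto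
        then show ?thesis
          using True qm[of "Suc k"] unfolding bshift_def lift_def
          by (simp add: i shift_step_def)
      next
        case False
        then have k1: "Suc k < 2 * D" using k by auto
        have "nat (i + 1 - lo) = Suc k" "i + 1 \<le> hi'" using i k1 D by auto
        moreover have "w (i + 1) \<noteq> 0" using w(1)[of "i+1"] \<open>i + 1 \<le> hi'\<close> True by simp
        ultimately show ?thesis
          using True \<rho>0[OF k] unfolding bshift_def lift_def k_def[symmetric]
          by (simp add: shift_step_def \<rho>Suc i[symmetric] add_divide_distrib)
      qed
    next
      case False
      \<comment> \<open>Just left of the window the only possible inflow is through
        \<open>w lo\<close>, which is 0.\<close>
      then have "w (i + 1) * lift ?r (i + 1) = 0"
        using w(2)[of "i + 1"] by (cases "i + 1 = lo") (auto simp: lift_def)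
      then show ?thesis using False by (auto simp: bshift_def lift_def)
    qed
    then show ?case by (simp add: Suc.IH fun_eq_iff)
  qed simp
  have est: "norm (r k / \<rho> k) \<le> \<delta> * s (lo + int k)" if "k < 2 * D" "norm (r k) < \<eta>" for r k
  proof -
    have "norm (r k) \<le> norm (\<rho> k) * (\<delta> * s (lo + int k))" using \<eta>(2)[OF that(1)] that(2) by linarith
    then show ?thesis using \<rho>0[OF that(1)] by (simp add: norm_divide divide_le_eq mult.commute)
  qed
  have pos: "\<delta> * s i \<ge> 0" for i using \<delta> s[of i] by simp
  have ind: "\<exists>k. i = lo + int k \<and> k < 2 * D" if "lo \<le> i" "i \<le> hi'" for i
    using that D by (intro exI[of _ "nat (i - lo)"]) auto
  show thesis
  proof
    show "lift q i = x i" if "i \<le> hi" for i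
    proof (cases "lo \<le> i")
      case True
      then have "nat (i - lo) < D" "i \<le> hi'" using that D by auto
      then show ?thesis using True \<rho>0[of "nat (i - lo)"] by (simp add: lift_def q xx_def)
    next
      case False
      then show ?thesis using x[of i] by (simp add: lift_def)
    qed
    show "lift q i = 0" if "i > hi'" for i using that by (simp add: lift_def)
    show "norm (lift q i) \<le> \<delta> * s i" if "i > hi" for i
    proof (cases "lo \<le> i \<and> i \<le> hi'")
      case True
      then obtain k where k: "i = lo + int k" "k < 2 * D" using ind by blast
      then have "k \<ge> D" using that D by simp
      then show ?thesis using est[where r = q and k = k, OF k(2) q(3)] True k by (simp add: lift_def)
    next
      case False
      then show ?thesis using pos by (auto simp: lift_def)
    qed
    show "norm ((bshift w ^^ n) (lift q) i - u i) \<le> \<delta> * s i" for i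
    proof (cases "lo \<le> i \<and> i \<le> hi'")
      case True
      then obtain k where k: "i = lo + int k" "k < 2 * D" using ind by blast
      show ?thesis
      proof (cases "k < D")
        case True
        then show ?thesis using q(4)[OF True] \<rho>0[OF k(2)] pos k D
          unfolding lift by (simp add: lift_def uu_def)
      next
        case False
        then have "u i = 0" using k D u by simp
        then show ?thesis using est[where r = "(shift_step ^^ n) q" and k = k, OF k(2) q(5)] False True k
          unfolding lift by (simp add: lift_def)
      qed
    next
      case False
      then show ?thesis using pos u[of i] D unfolding lift by (auto simp: lift_def)
    qed
  qed
qed

text \<open>The hypothesis \<open>b (i + 1) * s (i + 1) \<le> s i\<close> bounds each step by the
  factor 2 in the sup norm weighted by \<open>s\<close>; hence a fixed iterate is jointly continuous
  in weights and vector.\<close>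

lemma bshift_perturb:
  fixes w x :: "int \<Rightarrow> 'k::real_normed_field" and s b :: "int \<Rightarrow> real"
  assumes s: "\<And>i. s i \<ge> 0" and b: "\<And>i. b i \<ge> 0" "\<And>i. b (i + 1) * s (i + 1) \<le> s i"
    and w: "\<And>i. norm (w i) \<le> b i" and x: "\<And>i. norm (x i) \<le> s i" and "\<epsilon> > 0"
  obtains \<tau> where "\<tau> > 0" "\<And>w' x' i. (\<And>i. norm (w' i - w i) \<le> \<tau> * b i) \<Longrightarrow>
      (\<And>i. norm (x' i - x i) \<le> \<tau> * s i) \<Longrightarrow>
      norm ((bshift w' ^^ n) x' i - (bshift w ^^ n) x i) \<le> \<epsilon> * s i"
proof -
  have bd: "norm ((bshift w ^^ n) x i) \<le> 2 ^ n * s i" for n i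
  proof (induction n arbitrary: i)
    case (Suc n)
    have "norm ((bshift w ^^ Suc n) x i) \<le> norm ((bshift w ^^ n) x i) +
        norm (w (i + 1)) * norm ((bshift w ^^ n) x (i + 1))"
      by (simp add: bshift_def norm_mult[symmetric] norm_triangle_ineq)
    also have "\<dots> \<le> 2 ^ n * s i + b (i + 1) * (2 ^ n * s (i + 1))"
      by (intro add_mono mult_mono Suc.IH w b) auto
    also have "\<dots> \<le> 2 ^ n * s i + 2 ^ n * s i"
      using mult_left_mono[OF b(2)[of i], of "2 ^ n"] by (simp add: algebra_simps)
    finally show ?case by (simp add: mult_ac)
  qed (use x in simp)
  have "\<exists>\<tau>>0. \<forall>w' x'. (\<forall>i. norm (w' i - w i) \<le> \<tau> * b i) \<longrightarrow> (\<forall>i. norm (x' i - x i) \<le> \<tau> * s i) \<longrightarrow>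
      (\<forall>i. norm ((bshift w' ^^ n) x' i - (bshift w ^^ n) x i) \<le> \<epsilon> * s i)"
    using \<open>\<epsilon> > 0\<close>
  proof (induction n arbitrary: \<epsilon>)
    case 0
    then show ?case by auto
  next
    case (Suc n)
    then obtain \<tau> where \<tau>: "\<tau> > 0" and IH: "\<And>w' x' i. (\<And>i. norm (w' i - w i) \<le> \<tau> * b i) \<Longrightarrow>
      (\<And>i. norm (x' i - x i) \<le> \<tau> * s i) \<Longrightarrow>
      norm ((bshift w' ^^ n) x' i - (bshift w ^^ n) x i) \<le> (\<epsilon> / 4) * s i"
      using Suc.IH[of "\<epsilon> / 4"] by fastforce
    \<comment> \<open>The induction hypothesis costs \<open>\<epsilon> / 4\<close> directly and
      \<open>\<epsilon> / 2\<close> through a weight of size at most \<open>2 * b\<close>. The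
      change of weights acts on an iterate of size \<open>2 ^ n * s\<close> and must cost at most
      \<open>\<epsilon> / 4\<close>.\<close>
    define \<sigma> where "\<sigma> = min (min 1 \<tau>) (\<epsilon> / (4 * 2 ^ n))"
    have \<sigma>: "\<sigma> > 0" "\<sigma> \<le> 1" "\<sigma> \<le> \<tau>" and "\<sigma> \<le> \<epsilon> / (4 * 2 ^ n)"
      using \<tau> Suc.prems by (auto simp: \<sigma>_def)
    from this(4) have \<sigma>4: "\<sigma> * 2 ^ n \<le> \<epsilon> / 4"
      by (simp add: field_simps)
    show ?case
    proof (intro exI[of _ \<sigma>] conjI allI impI)
      fix w' x' i
      assume w': "\<forall>i. norm (w' i - w i) \<le> \<sigma> * b i" and x': "\<forall>i. norm (x' i - x i) \<le> \<sigma> * s i"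
      let ?a' = "(bshift w' ^^ n) x'" and ?a = "(bshift w ^^ n) x"
      have IH': "norm (?a' i - ?a i) \<le> (\<epsilon> / 4) * s i" for i
        by (rule IH) (meson w' x' \<sigma>(3) b(1) s mult_right_mono order_trans)+
      have w2: "norm (w' i) \<le> 2 * b i" for i
      proof -
        have "\<sigma> * b i \<le> 1 * b i" using \<sigma> b by (intro mult_right_mono) auto
        then show ?thesis
          using norm_triangle_ineq[of "w i" "w' i - w i"] w[of i] w'[rule_format, of i] by simp
      qed
      define A1 B1 C1 D1 where "A1 = norm (w' (i+1))" and "B1 = norm (?a' (i+1) - ?a (i+1))"
        and "C1 = norm (w' (i+1) - w (i+1))" and "D1 = norm (?a (i+1))"
      have "(bshift w' ^^ Suc n) x' i - (bshift w ^^ Suc n) x i = (?a' i - ?a i) +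
        (w' (i+1) * (?a' (i+1) - ?a (i+1)) + (w' (i+1) - w (i+1)) * ?a (i+1))"
        by (simp add: bshift_def algebra_simps)
      then have 1: "norm ((bshift w' ^^ Suc n) x' i - (bshift w ^^ Suc n) x i)
          \<le> norm (?a' i - ?a i) + (A1 * B1 + C1 * D1)"
        unfolding A1_def B1_def C1_def D1_def norm_mult[symmetric]
        by (simp only:) (meson add_left_mono norm_triangle_ineq order_trans)
      have 2: "A1 * B1 \<le> (2 * b (i+1)) * ((\<epsilon> / 4) * s (i+1))"
        unfolding A1_def B1_def using w2[of "i+1"] IH'[of "i+1"] b(1)[of "i+1"] by (simp only: mult_mono norm_ge_zero mult_nonneg_nonneg zero_le_numeral)
      have 3: "C1 * D1 \<le> (\<sigma> * b (i+1)) * (2 ^ n * s (i+1))"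
        unfolding C1_def D1_def using w'[rule_format, of "i+1"] bd[of n "i+1"] \<sigma>(1) b(1)[of "i+1"]
        by (simp only: mult_mono norm_ge_zero mult_nonneg_nonneg less_imp_le)
      have 4: "(2 * b (i+1)) * ((\<epsilon> / 4) * s (i+1)) + (\<sigma> * b (i+1)) * (2 ^ n * s (i+1))
          = (\<epsilon> / 2 + \<sigma> * 2 ^ n) * (b (i+1) * s (i+1))"
        by (simp add: algebra_simps)
      have 5: "(\<epsilon> / 2 + \<sigma> * 2 ^ n) * (b (i+1) * s (i+1)) \<le> (\<epsilon> / 2 + \<sigma> * 2 ^ n) * s i"
        using Suc.prems \<sigma>(1) by (intro mult_left_mono[OF b(2)[of i]]) simp
      have 6: "(\<epsilon> / 2 + \<sigma> * 2 ^ n) * s i \<le> (\<epsilon> / 2 + \<epsilon> / 4) * s i"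
        using \<sigma>4 s[of i] by (intro mult_right_mono) simp_all
      have 7: "(\<epsilon> / 4) * s i + (\<epsilon> / 2 + \<epsilon> / 4) * s i = \<epsilon> * s i"
        by (simp add: algebra_simps)
      show "norm ((bshift w' ^^ Suc n) x' i - (bshift w ^^ Suc n) x i) \<le> \<epsilon> * s i"
        using 1 2 3 4 5 6 7 IH'[of i] by linarith
    qed (use \<sigma> in simp)
  qed
  then show thesis using that by blast
qed

section \<open>Nested cylinders in place of the Baire category theorem\<close>

definition cylinder :: "('i \<Rightarrow> real) \<Rightarrow> 'i set \<Rightarrow> ('i \<Rightarrow> 'k::real_normed_vector) \<Rightarrow> real \<Rightarrow> ('i \<Rightarrow> 'k) set" where
  "cylinder b A z \<tau> = {z'. (\<forall>a\<in>A. z' a = z a) \<and> (\<forall>a. a \<notin> A \<longrightarrow> norm (z' a) \<le> \<tau> * b a)}"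

text \<open>A point of the intersection is read off coordinate by coordinate: a coordinate fixed at
  some stage never changes again, and one that is never fixed may be 0. The hypothesis
  \<open>center\<close> puts each centre into its own cylinder.\<close>

lemma nested_cylinders:
  fixes \<tau> :: real and b :: "'i \<Rightarrow> real" and z :: "'i \<Rightarrow> 'k::real_normed_vector"
  assumes b: "\<And>a. b a \<ge> 0" and init: "P A z" "\<tau> > 0"
    and center: "\<And>A z a. P A z \<Longrightarrow> a \<notin> A \<Longrightarrow> z a = 0"
    and step: "\<And>k A z \<tau>. P A z \<Longrightarrow> \<tau> > 0 \<Longrightarrow> \<exists>A' z' \<tau>'. P A' z' \<and> \<tau>' > 0 \<and>
        cylinder b A' z' \<tau>' \<subseteq> cylinder b A z \<tau> \<inter> G k"
  obtains z' where "z' \<in> cylinder b A z \<tau>" "\<And>k::nat. z' \<in> G k"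
proof -
  define Q where "Q = (\<lambda>(A, z, \<tau> :: real). P A z \<and> \<tau> > 0)"
  define B where "B = (\<lambda>(A, z :: 'i \<Rightarrow> 'k, \<tau>). cylinder b A z \<tau>)"
  have "\<exists>f. \<forall>n. (Q (f n) \<and> (n = 0 \<longrightarrow> f n = (A, z, \<tau>))) \<and> B (f (Suc n)) \<subseteq> B (f n) \<inter> G n"
  proof (rule dependent_nat_choice[of "\<lambda>n x. Q x \<and> (n = 0 \<longrightarrow> x = (A, z, \<tau>))" "\<lambda>n x y. B y \<subseteq> B x \<inter> G n"])
    show "\<exists>x. Q x \<and> (0 = (0::nat) \<longrightarrow> x = (A, z, \<tau>))" using init by (auto simp: Q_def)
    show "\<exists>y. (Q y \<and> (Suc n = 0 \<longrightarrow> y = (A, z, \<tau>))) \<and> B y \<subseteq> B x \<inter> G n"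
      if "Q x \<and> (n = 0 \<longrightarrow> x = (A, z, \<tau>))" for x n
    proof -
      obtain A1 z1 \<tau>1 where x: "x = (A1, z1, \<tau>1)" by (cases x)
      then obtain A' z' \<tau>' where "P A' z'" "\<tau>' > 0" "cylinder b A' z' \<tau>' \<subseteq> cylinder b A1 z1 \<tau>1 \<inter> G n"
        using step[of A1 z1 \<tau>1 n] \<open>Q x \<and> _\<close> unfolding Q_def by auto
      then show ?thesis
        by (intro exI[of _ "(A', z', \<tau>')"]) (simp add: Q_def B_def x)
    qed
  qed
  then obtain f where f: "\<And>n. Q (f n)" "f 0 = (A, z, \<tau>)" "\<And>n. B (f (Suc n)) \<subseteq> B (f n) \<inter> G n"
    by blast
  define An zn tn where "An n = fst (f n)" and "zn n = fst (snd (f n))" and "tn n = snd (snd (f n))" for n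
  have fn: "f n = (An n, zn n, tn n)" for n by (simp add: An_def zn_def tn_def)
  have P: "P (An n) (zn n)" and tn: "tn n > 0" for n using f(1)[of n] by (auto simp: fn Q_def)
  have mono: "B (f m) \<subseteq> B (f n)" if "n \<le> m" for n m
    using that f(3) by (induction rule: dec_induct) auto
  have zB: "zn n \<in> B (f n)" for n
    unfolding fn B_def cylinder_def using center[OF P] tn[of n] b by auto
  have zin: "zn m \<in> cylinder b (An n) (zn n) (tn n)" if "n \<le> m" for n m
    using mono[OF that] zB[of m] by (auto simp: fn B_def)
  \<comment> \<open>All stages that fix \<open>a\<close> agree on its value, because later centres
    lie in the earlier cylinders; the least stage is merely a definite choice.\<close>
  define y where "y a = (if \<exists>n. a \<in> An n then zn (LEAST n. a \<in> An n) a else 0)" for a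
  have y: "y \<in> B (f n)" for n
  proof -
    have "(a \<in> An n \<longrightarrow> y a = zn n a) \<and> (a \<notin> An n \<longrightarrow> norm (y a) \<le> tn n * b a)" for a
    proof (cases "\<exists>n. a \<in> An n")
      case True
      define K where "K = (LEAST n. a \<in> An n)"
      have K: "a \<in> An K" unfolding K_def using True by (rule LeastI_ex)
      have "y a = zn K a" using True by (simp add: y_def K_def)
      also have "\<dots> = zn (max K n) a" using zin[of K "max K n"] K by (simp add: cylinder_def)
      finally show ?thesis using zin[of n "max K n"] by (simp add: cylinder_def)
    next
      case False
      then show ?thesis using tn[of n] b[of a] by (auto simp: y_def)
    qed
    then show ?thesis by (auto simp: fn B_def cylinder_def)
  qed
  show thesis
  proof
    show "y \<in> cylinder b A z \<tau>" using y[of 0] by (simp add: f(2) B_def)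
    show "y \<in> G k" for k using y[of "Suc k"] f(3)[of k] by auto
  qed
qed

text \<open>A triple \<open>(w, x, y)\<close> of weights and two vectors is coded as a single family indexed by sites,
  so that the Baire-type argument of \<open>nested_cylinders\<close> applies. Nonvanishing of the weights inside
  the window makes the truncated shift a single Jordan block.\<close>
datatype site = Wt int | Fst int | Snd int

text \<open>The bound at \<open>Wt i\<close> lets \<open>w i\<close> carry a coordinate of order
  \<open>1 / t i\<close> into a coefficient of order \<open>s (i - 1)\<close>, and by symmetry one
  of order \<open>1 / s (i - 1)\<close> into \<open>t i\<close>.\<close>

fun site_bound :: "(int \<Rightarrow> real) \<Rightarrow> (int \<Rightarrow> real) \<Rightarrow> site \<Rightarrow> real" where
  "site_bound s t (Wt i) = s (i - 1) * t i"
| "site_bound s t (Fst i) = s i"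
| "site_bound s t (Snd i) = t i"

text \<open>The weight \<open>Wt lo\<close> stays outside, since it links the window to the site
  \<open>lo - 1\<close>.\<close>

definition window :: "int \<Rightarrow> int \<Rightarrow> site set" where
  "window lo hi = Wt ` {lo<..hi} \<union> Fst ` {lo..hi} \<union> Snd ` {lo..hi}"

lemma in_window [simp]:
  "Wt i \<in> window lo hi \<longleftrightarrow> lo < i \<and> i \<le> hi"
  "Fst i \<in> window lo hi \<longleftrightarrow> lo \<le> i \<and> i \<le> hi"
  "Snd i \<in> window lo hi \<longleftrightarrow> lo \<le> i \<and> i \<le> hi"
  by (auto simp: window_def)

definition window_data ::
    "(int \<Rightarrow> real) \<Rightarrow> (int \<Rightarrow> real) \<Rightarrow> site set \<Rightarrow> (site \<Rightarrow> 'k::real_normed_field) \<Rightarrow> bool" where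
  "window_data s t A z \<longleftrightarrow> (\<exists>lo hi. A = window lo hi \<and> lo \<le> hi \<and>
     (\<forall>a. a \<notin> A \<longrightarrow> z a = 0) \<and> (\<forall>i. lo < i \<and> i \<le> hi \<longrightarrow> z (Wt i) \<noteq> 0) \<and>
     (\<forall>a. norm (z a) \<le> site_bound s t a))"

definition hits_fst :: "(int \<Rightarrow> real) \<Rightarrow> (int \<Rightarrow> 'k) \<Rightarrow> real \<Rightarrow> (site \<Rightarrow> 'k::real_normed_field) set" where
  "hits_fst s u \<epsilon> =
     {z. \<exists>n. \<forall>i. norm ((bshift (z \<circ> Wt) ^^ n) (z \<circ> Fst) i - u i) \<le> \<epsilon> * s i}"

definition hits_snd :: "(int \<Rightarrow> real) \<Rightarrow> (int \<Rightarrow> 'k) \<Rightarrow> real \<Rightarrow> (site \<Rightarrow> 'k::real_normed_field) set" where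
  "hits_snd t u \<epsilon> =
     {z. \<exists>n. \<forall>i. norm ((fshift (z \<circ> Wt) ^^ n) (z \<circ> Snd) i - u i) \<le> \<epsilon> * t i}"

text \<open>The window is widened to contain the support of \<open>u\<close> and then doubled to the
  right. The new centre hits the target within \<open>\<epsilon> / 2\<close>, and
  \<open>bshift_perturb\<close> provides a whole cylinder that hits it within
  \<open>\<epsilon>\<close>.\<close>

lemma refine_fst:
  fixes z :: "site \<Rightarrow> 'k::real_normed_field"
  assumes s: "\<And>i. s i > 0" "\<And>i. s i \<le> 1" and t: "\<And>i. t i > 0" "\<And>i. t i \<le> 1"
    and z: "window_data s t A z" and "\<tau> > 0" "\<epsilon> > 0" and u: "finite {i. u i \<noteq> 0}"
  shows "\<exists>A' z' \<tau>'. window_data s t A' z' \<and> \<tau>' > 0 \<and>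
    cylinder (site_bound s t) A' z' \<tau>' \<subseteq> cylinder (site_bound s t) A z \<tau> \<inter> hits_fst s u \<epsilon>"
proof -
  let ?b = "site_bound s t"
  obtain lo hi where A: "A = window lo hi" and "lo \<le> hi" and z0: "\<And>a. a \<notin> A \<Longrightarrow> z a = 0"
    and zW: "\<And>i. lo < i \<Longrightarrow> i \<le> hi \<Longrightarrow> z (Wt i) \<noteq> 0" and zb: "\<And>a. norm (z a) \<le> ?b a"
    using z unfolding window_data_def by blast
  have b: "?b a > 0" for a using s t by (cases a) auto
  define lo1 hi1 where "lo1 = Min (insert lo {i. u i \<noteq> 0})" and "hi1 = Max (insert hi {i. u i \<noteq> 0})"
  have lo1: "lo1 \<le> lo" and hi1: "hi \<le> hi1" and usupp: "\<And>i. u i \<noteq> 0 \<Longrightarrow> lo1 \<le> i \<and> i \<le> hi1"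
    using u by (auto simp: lo1_def hi1_def)
  define D where "D = nat (hi1 - lo1 + 1)"
  define hi' where "hi' = lo1 + 2 * int D - 1"
  have D: "hi1 = lo1 + int D - 1" and hi': "hi1 \<le> hi'"
    using lo1 hi1 \<open>lo \<le> hi\<close> by (auto simp: D_def hi'_def)
  \<comment> \<open>The size of all new entries: at most \<open>\<tau>\<close> to stay in the old
    cylinder, at most 1 for \<open>site_bound\<close>, at most \<open>\<epsilon> / 2\<close> to
    leave half of the error to the perturbation.\<close>
  define \<sigma> where "\<sigma> = min (min \<tau> 1) (\<epsilon> / 2)"
  have \<sigma>: "\<sigma> > 0" "\<sigma> \<le> \<tau>" "\<sigma> \<le> 1" "\<sigma> \<le> \<epsilon> / 2" using \<open>\<tau> > 0\<close> \<open>\<epsilon> > 0\<close> by (auto simp: \<sigma>_def)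
  \<comment> \<open>Old weights are kept; each new one is nonzero, as the Jordan block requires, and
    small enough for the old cylinder.\<close>
  define w where "w i = (if lo < i \<and> i \<le> hi then z (Wt i)
      else if lo1 < i \<and> i \<le> hi' then of_real (\<sigma> * ?b (Wt i)) else 0)" for i
  have w_nz: "w i \<noteq> 0" if "lo1 < i" "i \<le> hi'" for i
    using that zW[of i] \<sigma>(1) b[of "Wt i"] by (auto simp: w_def)
  have w_z: "w i = 0" if "\<not> (lo1 < i \<and> i \<le> hi')" for i
    using that lo1 hi1 hi' by (auto simp: w_def)
  have xz: "(z \<circ> Fst) i = 0" if "\<not> (lo1 \<le> i \<and> i \<le> hi1)" for i
    using z0[of "Fst i"] that lo1 hi1 by (auto simp: A)
  have uz: "u i = 0" if "\<not> (lo1 \<le> i \<and> i \<le> hi1)" for i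
    using usupp that by blast
  obtain n x' where x': "\<And>i. i \<le> hi1 \<Longrightarrow> x' i = (z \<circ> Fst) i" "\<And>i. i > hi' \<Longrightarrow> x' i = 0"
    "\<And>i. i > hi1 \<Longrightarrow> norm (x' i) \<le> \<sigma> * s i"
    "\<And>i. norm ((bshift w ^^ n) x' i - u i) \<le> \<sigma> * s i"
    by (rule bshift_window_hits[of hi1 lo1 D hi' w "z \<circ> Fst" u s \<sigma>])
      (use D hi'_def w_nz w_z xz uz s(1) \<sigma>(1) in auto)
  define z' where "z' a = (case a of Wt i \<Rightarrow> w i | Fst i \<Rightarrow> x' i | Snd i \<Rightarrow> z (Snd i))" for a
  have z'A: "z' a = z a" if "a \<in> A" for a
    using that x'(1) hi1 by (cases a) (auto simp: z'_def A w_def)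
  have z'new: "norm (z' a) \<le> \<sigma> * ?b a" if "a \<notin> A" for a
  proof (cases a)
    case (Wt i)
    then show ?thesis using that \<sigma>(1) b[of a] by (auto simp: z'_def A w_def norm_mult)
  next
    case (Fst i)
    show ?thesis
    proof (cases "i \<le> hi1")
      case True
      then show ?thesis using x'(1)[OF True] z0[OF that] \<sigma>(1) b[of a] by (simp add: z'_def Fst)
    next
      case False
      then show ?thesis using x'(3)[of i] by (simp add: z'_def Fst)
    qed
  next
    case (Snd i)
    then show ?thesis using z0[OF that] \<sigma>(1) b[of a] by (simp add: z'_def)
  qed
  have le: "r * ?b a \<le> r' * ?b a" if "r \<le> r'" for r r' a
    using that b[of a] by (simp add: mult_right_mono)
  have z'b: "norm (z' a) \<le> ?b a" for a
  proof (cases "a \<in> A")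
    case True
    then show ?thesis using zb[of a] z'A by simp
  next
    case False
    show ?thesis using z'new[OF False] le[OF \<sigma>(3), of a] by simp
  qed
  let ?A' = "window lo1 hi'"
  have z'0: "z' a = 0" if "a \<notin> ?A'" for a
  proof (cases a)
    case (Fst i)
    with that have i: "i < lo1 \<or> i > hi'" by auto
    show ?thesis
    proof (cases "i > hi'")
      case True
      then show ?thesis using x'(2) by (simp add: z'_def Fst)
    next
      case False
      then have "i < lo1" "i \<le> hi1" using i lo1 hi1 \<open>lo \<le> hi\<close> by auto
      then show ?thesis using x'(1)[of i] xz[of i] by (simp add: z'_def Fst)
    qed
  next
    case (Snd i)
    then show ?thesis using that z0[of a] lo1 hi1 hi' by (auto simp: z'_def A)
  qed (use that w_z in \<open>auto simp: z'_def\<close>)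
  have good: "window_data s t ?A' z'"
    unfolding window_data_def
  proof (intro exI conjI allI impI)
    show "lo1 \<le> hi'" using lo1 hi1 hi' \<open>lo \<le> hi\<close> by linarith
  qed (use z'0 w_nz z'b in \<open>auto simp: z'_def\<close>)
  \<comment> \<open>As \<open>s\<close> and \<open>t\<close> are at most 1, the product bound on the
    weights meets the hypothesis of \<open>bshift_perturb\<close>.\<close>
  have bs: "?b (Wt (i + 1)) * s (i + 1) \<le> s i" for i
  proof -
    have "(s i * t (i + 1)) * s (i + 1) \<le> (s i * 1) * 1"
      using s[of i] t[of "i+1"] s[of "i+1"] by (intro mult_mono) (auto intro: less_imp_le)
    then show ?thesis by simp
  qed
  obtain \<tau>1 where \<tau>1: "\<tau>1 > 0" "\<And>w' y i. (\<And>i. norm (w' i - w i) \<le> \<tau>1 * ?b (Wt i)) \<Longrightarrow>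
      (\<And>i. norm (y i - x' i) \<le> \<tau>1 * s i) \<Longrightarrow>
      norm ((bshift w' ^^ n) y i - (bshift w ^^ n) x' i) \<le> (\<epsilon> / 2) * s i"
  proof (rule bshift_perturb[of s "\<lambda>i. ?b (Wt i)" w x' "\<epsilon> / 2" n])
    show "norm (w i) \<le> ?b (Wt i)" for i using z'b[of "Wt i"] by (simp add: z'_def)
    show "norm (x' i) \<le> s i" for i using z'b[of "Fst i"] by (simp add: z'_def)
    show "s i \<ge> 0" for i using s(1)[of i] by simp
    show "?b (Wt i) \<ge> 0" for i using b[of "Wt i"] by linarith
  qed (use bs \<open>\<epsilon> > 0\<close> in auto)
  define \<tau>' where "\<tau>' = min \<tau>1 \<sigma>"
  have \<tau>': "\<tau>' > 0" "\<tau>' \<le> \<tau>1" "\<tau>' \<le> \<tau>" using \<tau>1 \<sigma> by (auto simp: \<tau>'_def)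
  have "y \<in> cylinder ?b A z \<tau> \<inter> hits_fst s u \<epsilon>" if y: "y \<in> cylinder ?b ?A' z' \<tau>'" for y
  proof -
    have AA': "A \<subseteq> ?A'" using lo1 hi1 hi' by (auto simp: A window_def)
    have y1: "norm (y a - z' a) \<le> \<tau>1 * ?b a" for a
      using y z'0[of a] le[OF \<tau>'(2), of a] \<tau>1(1) b[of a]
      by (cases "a \<in> ?A'") (auto simp: cylinder_def intro: order_trans)
    have "y \<in> cylinder ?b A z \<tau>"
      unfolding cylinder_def
    proof (intro CollectI conjI ballI allI impI)
      show "y a = z a" if "a \<in> A" for a using y AA' z'A that by (auto simp: cylinder_def)
      show "norm (y a) \<le> \<tau> * ?b a" if "a \<notin> A" for a
        using y z'new[OF that] le[OF \<tau>'(3), of a] le[OF \<sigma>(2), of a]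
        by (cases "a \<in> ?A'") (auto simp: cylinder_def intro: order_trans)
    qed
    moreover have "norm ((bshift (y \<circ> Wt) ^^ n) (y \<circ> Fst) i - u i) \<le> \<epsilon> * s i" for i
    proof -
      have "norm ((bshift (y \<circ> Wt) ^^ n) (y \<circ> Fst) i - (bshift w ^^ n) x' i) \<le> (\<epsilon> / 2) * s i"
        using y1[of "Wt _"] y1[of "Fst _"] by (intro \<tau>1(2)) (auto simp: z'_def)
      moreover have "\<sigma> * s i \<le> (\<epsilon> / 2) * s i" using le[OF \<sigma>(4), of "Fst i"] by simp
      ultimately show ?thesis
        using x'(4)[of i] norm_triangle_ineq[of "(bshift (y \<circ> Wt) ^^ n) (y \<circ> Fst) i - (bshift w ^^ n) x' i"
            "(bshift w ^^ n) x' i - u i"] by simp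
    qed
    ultimately show ?thesis by (auto simp: hits_fst_def)
  qed
  then show ?thesis using good \<tau>'(1) by blast
qed

text \<open>Reverses the integers and exchanges the two vectors, hence the roles of
  \<open>bshift\<close> and \<open>fshift\<close>; weights are reversed as in
  \<open>fshift_reflect\<close>.\<close>

fun reflect :: "site \<Rightarrow> site" where
  "reflect (Wt i) = Wt (1 - i)"
| "reflect (Fst i) = Snd (- i)"
| "reflect (Snd i) = Fst (- i)"

lemma reflect_reflect [simp]: "reflect (reflect a) = a"
  by (cases a) auto

lemma reflect_window: "reflect a \<in> window lo hi \<longleftrightarrow> a \<in> window (- hi) (- lo)"
  by (cases a) auto

lemma site_bound_reflect:
  "site_bound (\<lambda>i. t (- i)) (\<lambda>i. s (- i)) a = site_bound s t (reflect a)"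
  by (cases a) (auto simp: mult.commute)

lemma window_data_reflect:
  assumes "window_data s t A z"
  shows "window_data (\<lambda>i. t (- i)) (\<lambda>i. s (- i)) {a. reflect a \<in> A} (z \<circ> reflect)"
proof -
  obtain lo hi where *: "A = window lo hi" "lo \<le> hi" "\<forall>a. a \<notin> A \<longrightarrow> z a = 0"
     "\<forall>i. lo < i \<and> i \<le> hi \<longrightarrow> z (Wt i) \<noteq> 0" "\<forall>a. norm (z a) \<le> site_bound s t a"
    using assms unfolding window_data_def by blast
  then show ?thesis
    unfolding window_data_def
    by (intro exI[of _ "- hi"] exI[of _ "- lo"]) (auto simp: reflect_window site_bound_reflect)
qed

text \<open>Transported from \<open>refine_fst\<close> by \<open>reflect\<close>, with
  \<open>s\<close> and \<open>t\<close> exchanged; doubling to the right becomes doubling to the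
  left.\<close>

lemma refine_snd:
  fixes z :: "site \<Rightarrow> 'k::real_normed_field"
  assumes s: "\<And>i. s i > 0" "\<And>i. s i \<le> 1" and t: "\<And>i. t i > 0" "\<And>i. t i \<le> 1"
    and z: "window_data s t A z" and "\<tau> > 0" "\<epsilon> > 0" and u: "finite {i. u i \<noteq> 0}"
  shows "\<exists>A' z' \<tau>'. window_data s t A' z' \<and> \<tau>' > 0 \<and>
    cylinder (site_bound s t) A' z' \<tau>' \<subseteq> cylinder (site_bound s t) A z \<tau> \<inter> hits_snd t u \<epsilon>"
proof -
  let ?s = "\<lambda>i. s (- i)" and ?t = "\<lambda>i. t (- i)"
  have "finite {i. u (- i) \<noteq> 0}"
    using finite_imageI[OF u, of uminus] by (rule finite_subset[rotated]) force
  then obtain A' z' \<tau>' where 1: "window_data ?t ?s A' z'" "\<tau>' > 0"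
    "cylinder (site_bound ?t ?s) A' z' \<tau>' \<subseteq>
       cylinder (site_bound ?t ?s) {a. reflect a \<in> A} (z \<circ> reflect) \<tau> \<inter> hits_fst ?t (\<lambda>i. u (- i)) \<epsilon>"
    using refine_fst[OF t s window_data_reflect[OF z] \<open>\<tau> > 0\<close> \<open>\<epsilon> > 0\<close>, of "\<lambda>i. u (- i)"] by blast
  have "y \<in> cylinder (site_bound s t) A z \<tau> \<inter> hits_snd t u \<epsilon>"
    if y: "y \<in> cylinder (site_bound s t) {a. reflect a \<in> A'} (z' \<circ> reflect) \<tau>'" for y
  proof -
    have "y \<circ> reflect \<in> cylinder (site_bound ?t ?s) A' z' \<tau>'"
      unfolding cylinder_def
    proof (intro CollectI conjI ballI allI impI)
      show "(y \<circ> reflect) a = z' a" if "a \<in> A'" for a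
        using y that unfolding cylinder_def by simp
      show "norm ((y \<circ> reflect) a) \<le> \<tau>' * site_bound ?t ?s a" if "a \<notin> A'" for a
        using y that unfolding cylinder_def by (simp add: site_bound_reflect)
    qed
    with 1(3) have 2: "y \<circ> reflect \<in> cylinder (site_bound ?t ?s) {a. reflect a \<in> A} (z \<circ> reflect) \<tau>"
      and 3: "y \<circ> reflect \<in> hits_fst ?t (\<lambda>i. u (- i)) \<epsilon>" by auto
    have "y \<in> cylinder (site_bound s t) A z \<tau>"
      unfolding cylinder_def
    proof (intro CollectI conjI ballI allI impI)
      show "y a = z a" if "a \<in> A" for a
        using conjunct1[OF 2[unfolded cylinder_def mem_Collect_eq], rule_format, of "reflect a"] that by simp
      show "norm (y a) \<le> \<tau> * site_bound s t a" if "a \<notin> A" for a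
        using conjunct2[OF 2[unfolded cylinder_def mem_Collect_eq], rule_format, of "reflect a"] that
        by (simp add: site_bound_reflect)
    qed
    moreover have "y \<in> hits_snd t u \<epsilon>"
    proof -
      obtain n where n: "\<And>i. norm ((bshift (y \<circ> reflect \<circ> Wt) ^^ n) (y \<circ> reflect \<circ> Fst) i - u (- i)) \<le> \<epsilon> * t (- i)"
        using 3 unfolding hits_fst_def by blast
      have eq: "y \<circ> reflect \<circ> Wt = (\<lambda>i. (y \<circ> Wt) (1 - i))" "y \<circ> reflect \<circ> Fst = (\<lambda>i. (y \<circ> Snd) (- i))"
        by auto
      have "norm ((fshift (y \<circ> Wt) ^^ n) (y \<circ> Snd) i - u i) \<le> \<epsilon> * t i" for i
        using n[of "- i"] unfolding eq fshift_reflect by simp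
      then show ?thesis unfolding hits_snd_def by blast
    qed
    ultimately show ?thesis by blast
  qed
  moreover have "window_data s t {a. reflect a \<in> A'} (z' \<circ> reflect)"
    using window_data_reflect[OF 1(1)] by simp
  ultimately show ?thesis using 1(2) by blast
qed

text \<open>Every stage enters both hitting sets in turn, so that a single weight sequence carries
  both universal vectors.\<close>

theorem simultaneous_universal_vectors:
  fixes s t :: "int \<Rightarrow> real" and u :: "nat \<Rightarrow> int \<Rightarrow> 'k::real_normed_field"
  assumes s: "\<And>i. s i > 0" "\<And>i. s i \<le> 1" and t: "\<And>i. t i > 0" "\<And>i. t i \<le> 1"
    and u: "\<And>k. finite {i. u k i \<noteq> 0}" and \<epsilon>: "\<And>k. \<epsilon> k > 0"
  obtains w x y where
    "\<And>i. norm (w i) \<le> s (i - 1) * t i" "\<And>i. norm (x i) \<le> s i" "\<And>i. norm (y i) \<le> t i"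
    "\<And>k. \<exists>n. \<forall>i. norm ((bshift w ^^ n) x i - u k i) \<le> \<epsilon> k * s i"
    "\<And>k. \<exists>n. \<forall>i. norm ((fshift w ^^ n) y i - u k i) \<le> \<epsilon> k * t i"
proof -
  let ?b = "site_bound s t"
  have b: "?b a > 0" for a using s t by (cases a) auto
  \<comment> \<open>The window \<open>0 0\<close> contains no weight, so the zero family can start
    although weights inside a window must be nonzero.\<close>
  have init: "window_data s t (window 0 0) (\<lambda>a. 0 :: 'k)"
    unfolding window_data_def by (intro exI[of _ 0]) (use b in \<open>auto intro: less_imp_le\<close>)
  obtain z where z: "z \<in> cylinder ?b (window 0 0) (\<lambda>a. 0 :: 'k) 1"
    "\<And>k. z \<in> hits_fst s (u k) (\<epsilon> k) \<inter> hits_snd t (u k) (\<epsilon> k)"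
  proof (rule nested_cylinders[of ?b "window_data s t" "window 0 0" "\<lambda>a. 0 :: 'k" 1
        "\<lambda>k. hits_fst s (u k) (\<epsilon> k) \<inter> hits_snd t (u k) (\<epsilon> k)"])
    show "z a = 0" if "window_data s t A z" "a \<notin> A" for A and z :: "site \<Rightarrow> 'k" and a
      using that unfolding window_data_def by blast
    show "\<exists>A' z' \<tau>'. window_data s t A' z' \<and> \<tau>' > 0 \<and>
        cylinder ?b A' z' \<tau>' \<subseteq> cylinder ?b A z \<tau> \<inter> (hits_fst s (u k) (\<epsilon> k) \<inter> hits_snd t (u k) (\<epsilon> k))"
      if z: "window_data s t A z" "\<tau> > 0" for k A and z :: "site \<Rightarrow> 'k" and \<tau>
    proof -
      obtain A1 z1 \<tau>1 where 1: "window_data s t A1 z1" "\<tau>1 > 0"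
        "cylinder ?b A1 z1 \<tau>1 \<subseteq> cylinder ?b A z \<tau> \<inter> hits_fst s (u k) (\<epsilon> k)"
        using refine_fst[OF s t z \<epsilon> u] by blast
      obtain A2 z2 \<tau>2 where 2: "window_data s t A2 z2" "\<tau>2 > 0"
        "cylinder ?b A2 z2 \<tau>2 \<subseteq> cylinder ?b A1 z1 \<tau>1 \<inter> hits_snd t (u k) (\<epsilon> k)"
        using refine_snd[OF s t 1(1,2) \<epsilon> u] by blast
      show ?thesis using 1(3) 2 by blast
    qed
  qed (use b init in \<open>auto intro: less_imp_le\<close>)
  have zb: "norm (z a) \<le> ?b a" for a
    using z(1) b[of a] by (cases "a \<in> window 0 0") (auto simp: cylinder_def)
  show thesis
  proof
    show "norm ((z \<circ> Wt) i) \<le> s (i - 1) * t i" "norm ((z \<circ> Fst) i) \<le> s i"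
      "norm ((z \<circ> Snd) i) \<le> t i" for i
      using zb[of "Wt i"] zb[of "Fst i"] zb[of "Snd i"] by simp_all
    show "\<exists>n. \<forall>i. norm ((bshift (z \<circ> Wt) ^^ n) (z \<circ> Fst) i - u k i) \<le> \<epsilon> k * s i"
      "\<exists>n. \<forall>i. norm ((fshift (z \<circ> Wt) ^^ n) (z \<circ> Snd) i - u k i) \<le> \<epsilon> k * t i" for k
      using z(2)[of k] unfolding hits_fst_def hits_snd_def by blast+
  qed
qed

section \<open>Scalars and sublinear functionals\<close>

text \<open>Common coordinates for both scalar fields, with \<open>j = 0\<close> in the real case.
  Otherwise norm z times the norm of its conjugate is a^2 + b^2, the conjugate has norm at most |a|
  + |b|, and (|a| + |b|)^2 <= 2 (a^2 + b^2); this is the origin of the factor 2.\<close>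

lemma scalar_decomposition:
  "\<exists>j::'k::real_or_complex. \<forall>z. \<exists>a b. z = of_real a + of_real b * j \<and> \<bar>a\<bar> + \<bar>b\<bar> \<le> 2 * norm z"
  using real_or_complex[where 'a = 'k]
proof
  assume *: "\<forall>x::'k. \<exists>a. x = a *\<^sub>R 1"
  have "\<exists>a b. z = of_real a + of_real b * 0 \<and> \<bar>a\<bar> + \<bar>b\<bar> \<le> 2 * norm z" for z :: 'k
  proof -
    obtain a where "z = of_real a" using * by (auto simp: of_real_def)
    then show ?thesis by (intro exI[of _ a] exI[of _ 0]) simp
  qed
  then show ?thesis by blast
next
  assume "\<exists>i::'k. i * i = - 1 \<and> (\<forall>x. \<exists>a b. x = a *\<^sub>R 1 + b *\<^sub>R i)"
  then obtain i :: 'k where i: "i * i = - 1" and *: "\<forall>x. \<exists>a b. x = a *\<^sub>R 1 + b *\<^sub>R i" by blast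
  have "norm i * norm i = 1" unfolding norm_mult[symmetric] i by simp
  then have ni: "norm i = 1"
    by (metis norm_ge_zero power2_eq_square real_sqrt_abs abs_of_nonneg real_sqrt_one)
  have "\<exists>a b. z = of_real a + of_real b * i \<and> \<bar>a\<bar> + \<bar>b\<bar> \<le> 2 * norm z" for z :: 'k
  proof -
    obtain a b where z: "z = of_real a + of_real b * i"
      using *[rule_format, of z] by (auto simp: scaleR_conv_of_real)
    let ?z' = "of_real a - of_real b * i"
    have "z * ?z' = of_real a * of_real a - of_real b * of_real b * (i * i)"
      unfolding z by (simp add: algebra_simps)
    also have "\<dots> = of_real (a * a + b * b)" by (simp add: i)
    finally have "norm z * norm ?z' = \<bar>a * a + b * b\<bar>"
      by (metis norm_mult norm_of_real)
    then have eq: "norm z * norm ?z' = a * a + b * b"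
      by simp
    have "norm ?z' \<le> norm (of_real a :: 'k) + norm (of_real b * i)" by (rule norm_triangle_ineq4)
    then have "norm ?z' \<le> \<bar>a\<bar> + \<bar>b\<bar>" by (simp add: norm_mult ni)
    then have 1: "a * a + b * b \<le> norm z * (\<bar>a\<bar> + \<bar>b\<bar>)"
      unfolding eq[symmetric] by (rule mult_left_mono) simp
    have "0 \<le> (\<bar>a\<bar> - \<bar>b\<bar>) * (\<bar>a\<bar> - \<bar>b\<bar>)" by simp
    then have "(\<bar>a\<bar> + \<bar>b\<bar>) * (\<bar>a\<bar> + \<bar>b\<bar>) \<le> 2 * (a * a + b * b)"
      by (simp add: algebra_simps)
    with 1 have *: "(\<bar>a\<bar> + \<bar>b\<bar>) * (\<bar>a\<bar> + \<bar>b\<bar>) \<le> (2 * norm z) * (\<bar>a\<bar> + \<bar>b\<bar>)" by simp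
    then have "\<bar>a\<bar> + \<bar>b\<bar> \<le> 2 * norm z"
    proof (cases "\<bar>a\<bar> + \<bar>b\<bar> > 0")
      case True
      then show ?thesis using mult_right_le_imp_le[OF *] by simp
    next
      case False
      then show ?thesis using norm_ge_zero[of z] by linarith
    qed
    with z show ?thesis by blast
  qed
  then show ?thesis by blast
qed

text \<open>By the coordinate bound the ball lies in the continuous image of a compact square.
  Completeness of the scalars and the compact discs of the Mackey case rest on this.\<close>

lemma compact_scalar_cball: "compact (cball (0::'k::real_or_complex) r)"
proof -
  obtain j :: 'k where j: "\<And>z. \<exists>a b. z = of_real a + of_real b * j \<and> \<bar>a\<bar> + \<bar>b\<bar> \<le> 2 * norm z"
    using scalar_decomposition by blast
  let ?h = "\<lambda>(a, b). of_real a + of_real b * j" and ?I = "{- 2 * r..2 * r} \<times> {- 2 * r..2 * r}"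
  have "compact (?h ` ?I)"
    unfolding case_prod_beta by (intro compact_continuous_image compact_Times continuous_intros compact_Icc)
  moreover have "cball 0 r \<subseteq> ?h ` ?I"
  proof
    fix z :: 'k assume "z \<in> cball 0 r"
    moreover obtain a b where "z = of_real a + of_real b * j" "\<bar>a\<bar> + \<bar>b\<bar> \<le> 2 * norm z"
      using j by blast
    ultimately show "z \<in> ?h ` ?I" by (intro image_eqI[of _ _ "(a, b)"]) auto
  qed
  ultimately show ?thesis
    using compact_Int_closed[OF _ closed_cball, of "?h ` ?I" 0 r] by (simp add: Int_absorb1)
qed

instance real_or_complex \<subseteq> heine_borel
proof
  fix f :: "nat \<Rightarrow> 'a" assume "bounded (range f)"
  then obtain r where "\<And>n. norm (f n) \<le> r" unfolding bounded_iff by blast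
  then have "\<forall>n. f n \<in> cball 0 r" by simp
  then show "\<exists>l r. strict_mono (r::nat \<Rightarrow> nat) \<and> (f \<circ> r) \<longlonglongrightarrow> l"
    using compact_scalar_cball[of r] unfolding compact_def by blast
qed

instance real_or_complex \<subseteq> banach ..

lemma countable_dense_scalars:
  "\<exists>D::'k::real_or_complex set. countable D \<and> 0 \<in> D \<and> (\<forall>z. \<forall>\<epsilon>>0. \<exists>d\<in>D. norm (z - d) < \<epsilon>)"
proof -
  obtain j :: 'k where j: "\<And>z. \<exists>a b. z = of_real a + of_real b * j"
    using scalar_decomposition by metis
  define D where "D = (\<lambda>(a, b). of_real a + of_real b * j) ` (\<rat> \<times> \<rat>)"
  have "countable D" unfolding D_def by (intro countable_image countable_SIGMA countable_rat)
  moreover have "\<exists>d\<in>D. norm (z - d) < \<epsilon>" if "\<epsilon> > 0" for z \<epsilon>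
  proof -
    obtain a b where z: "z = of_real a + of_real b * j" using j by blast
    define \<delta> where "\<delta> = (\<epsilon> / 2) / (1 + norm j)"
    have d: "\<delta> > 0" using that by (simp add: \<delta>_def add_pos_nonneg)
    obtain p q where pq: "p \<in> \<rat>" "\<bar>p - a\<bar> < \<delta>" "q \<in> \<rat>" "\<bar>q - b\<bar> < \<delta>"
      using Rats_dense_in_real[of a "a + \<delta>"] Rats_dense_in_real[of b "b + \<delta>"] d by force
    have "z - (of_real p + of_real q * j) = of_real (a - p) + of_real (b - q) * j"
      unfolding z by (simp add: algebra_simps)
    also have "norm \<dots> \<le> \<bar>a - p\<bar> + \<bar>b - q\<bar> * norm j"
      by (rule norm_triangle_le) (simp add: norm_mult norm_of_real flip: of_real_diff)
    also have "\<dots> \<le> \<delta> + \<delta> * norm j"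
      using pq by (intro add_mono mult_right_mono) auto
    also have "\<delta> + \<delta> * norm j = \<delta> * (1 + norm j)"
      by (simp add: distrib_left)
    also have "\<dots> = \<epsilon> / 2"
    proof -
      have "1 + norm j \<noteq> 0" using norm_ge_zero[of j] by linarith
      moreover have "b / c * c = b" if "c \<noteq> 0" for b c :: real using that by simp
      ultimately show ?thesis unfolding \<delta>_def by blast
    qed
    finally show ?thesis using that pq unfolding D_def by force
  qed
  moreover have "0 \<in> D" unfolding D_def by (rule image_eqI[of _ _ "(0, 0)"]) auto
  ultimately show ?thesis by blast
qed

section \<open>Sublinear functionals and the Hahn-Banach theorem\<close>

definition sublinear :: "(real \<Rightarrow> 'a::ab_group_add \<Rightarrow> 'a) \<Rightarrow> ('a \<Rightarrow> real) \<Rightarrow> bool" where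
  "sublinear sc q \<longleftrightarrow> (\<forall>x y. q (x + y) \<le> q x + q y) \<and> (\<forall>r x. 0 \<le> r \<longrightarrow> q (sc r x) \<le> r * q x)"

locale real_space = vector_space sc for sc :: "real \<Rightarrow> 'a::ab_group_add \<Rightarrow> 'a"
begin

lemma sublinear_zero: "sublinear sc q \<Longrightarrow> q 0 = 0"
proof -
  assume q: "sublinear sc q"
  have "q 0 \<le> 0" using q[unfolded sublinear_def, THEN conjunct2, rule_format, of 0 0] by simp
  moreover have "q (0 + 0) \<le> q 0 + q 0" using q unfolding sublinear_def by blast
  ultimately show "q 0 = 0" by simp
qed

lemma sublinear_minus: "sublinear sc q \<Longrightarrow> - q (- x) \<le> q x"
proof -
  assume q: "sublinear sc q"
  then have "q (x + - x) \<le> q x + q (- x)" unfolding sublinear_def by blast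
  then show ?thesis using sublinear_zero[OF q] by simp
qed

text \<open>A minorant of \<open>q\<close> pressed down along the ray of \<open>a\<close>: taking
  \<open>t = 1\<close>, its value at \<open>- a\<close> is at most \<open>- q a\<close>, as
  linearity in the direction of \<open>a\<close> demands.\<close>

definition lower :: "('a \<Rightarrow> real) \<Rightarrow> 'a \<Rightarrow> 'a \<Rightarrow> real" where
  "lower q a x = (INF t\<in>{0..}. q (x + sc t a) - t * q a)"

lemma lower_le:
  assumes q: "sublinear sc q" and "t \<ge> 0"
  shows "lower q a x \<le> q (x + sc t a) - t * q a"
  unfolding lower_def
proof (rule cINF_lower)
  have "- q (- x) \<le> q (x + sc t a) - t * q a" if "t \<ge> 0" for t
  proof -
    \<comment> \<open>\<open>sublinear\<close> states one half of homogeneity; the other half is the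
      same inequality for \<open>1 / t\<close>.\<close>
    have "q (sc t a) = t * q a"
    proof (cases "t = 0")
      case False
      have "q a \<le> (1/t) * q (sc t a)" "q (sc t a) \<le> t * q a"
        using conjunct2[OF q[unfolded sublinear_def], rule_format, of "1/t" "sc t a"]
          conjunct2[OF q[unfolded sublinear_def], rule_format, of t a] that False by simp_all
      then show ?thesis using False that by (simp add: field_simps)
    qed (simp add: sublinear_zero[OF q])
    moreover have "q (- x + (x + sc t a)) \<le> q (- x) + q (x + sc t a)"
      using q unfolding sublinear_def by blast
    ultimately show ?thesis by (simp add: algebra_simps)
  qed
  then show "bdd_below ((\<lambda>t. q (x + sc t a) - t * q a) ` {0..})"
    by (intro bdd_belowI[of _ "- q (- x)"]) auto
qed (use assms in simp)

lemma lower_greatest: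
  "(\<And>t. t \<ge> 0 \<Longrightarrow> c \<le> q (x + sc t a) - t * q a) \<Longrightarrow> c \<le> lower q a x"
  unfolding lower_def by (intro cINF_greatest) auto

lemma lower_sublinear:
  assumes q: "sublinear sc q"
  shows "sublinear sc (lower q a)"
proof -
  have add: "q (x + y) \<le> q x + q y" and hom: "0 \<le> r \<Longrightarrow> q (sc r x) \<le> r * q x" for x y r
    using q unfolding sublinear_def by auto
  have "lower q a (x + y) \<le> lower q a x + lower q a y" for x y
  proof -
    have "lower q a (x + y) - (q (x + sc s a) - s * q a) \<le> lower q a y" if s: "s \<ge> 0" for s
    proof (rule lower_greatest)
      fix t :: real assume t: "t \<ge> 0"
      have "lower q a (x + y) \<le> q ((x + y) + sc (s + t) a) - (s + t) * q a"
        using s t by (intro lower_le q) simp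
      also have "(x + y) + sc (s + t) a = (x + sc s a) + (y + sc t a)"
        by (simp add: scale_left_distrib)
      also have "q \<dots> \<le> q (x + sc s a) + q (y + sc t a)" by (rule add)
      finally show "lower q a (x + y) - (q (x + sc s a) - s * q a) \<le> q (y + sc t a) - t * q a"
        by (simp add: algebra_simps)
    qed
    then have "lower q a (x + y) - lower q a y \<le> lower q a x"
      by (intro lower_greatest) (simp add: algebra_simps)
    then show ?thesis by simp
  qed
  moreover have "lower q a (sc r x) \<le> r * lower q a x" if "0 \<le> r" for r x
  proof (cases "r = 0")
    case True
    then show ?thesis using lower_le[OF q order_refl, of a 0] sublinear_zero[OF q] by simp
  next
    case False
    with that have r: "r > 0" by simp
    have "lower q a (sc r x) / r \<le> lower q a x"
    proof (rule lower_greatest)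
      fix t :: real assume t: "t \<ge> 0"
      have "lower q a (sc r x) \<le> q (sc r x + sc (r * t) a) - (r * t) * q a"
        using r t by (intro lower_le q) simp
      also have "sc r x + sc (r * t) a = sc r (x + sc t a)"
        by (simp add: scale_right_distrib)
      also have "q \<dots> \<le> r * q (x + sc t a)" using r by (intro hom) simp
      finally have "lower q a (sc r x) \<le> r * (q (x + sc t a) - t * q a)" by (simp add: algebra_simps)
      then show "lower q a (sc r x) / r \<le> q (x + sc t a) - t * q a"
        using r by (simp add: divide_le_eq mult.commute)
    qed
    then show ?thesis using r by (simp add: divide_le_eq mult.commute)
  qed
  ultimately show ?thesis unfolding sublinear_def by blast
qed

text \<open>Zorn's lemma for the reversed pointwise order. The infimum of a chain is finite because
  \<open>- p (- x)\<close> bounds every sublinear minorant of \<open>p\<close> from below.\<close>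

lemma minimal_sublinear:
  assumes p: "sublinear sc p"
  obtains q where "sublinear sc q" "q \<le> p" "\<And>q'. sublinear sc q' \<Longrightarrow> q' \<le> q \<Longrightarrow> q' = q"
proof -
  define A where "A = {q. sublinear sc q \<and> q \<le> p}"
  have "\<exists>m\<in>A. \<forall>a\<in>A. a \<le> m \<longrightarrow> a = m"
  proof (rule predicate_Zorn)
    show "partial_order_on A (relation_of (\<lambda>q r. r \<le> q) A)"
      by (rule partial_order_on_relation_ofI) auto
    fix C assume C: "C \<in> Chains (relation_of (\<lambda>q r. r \<le> q) A)"
    then have CA: "\<And>q. q \<in> C \<Longrightarrow> sublinear sc q \<and> q \<le> p"
      and lin: "\<And>q r. q \<in> C \<Longrightarrow> r \<in> C \<Longrightarrow> q \<le> r \<or> r \<le> q"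
      by (auto simp: Chains_def relation_of_def A_def)
    show "\<exists>u\<in>A. \<forall>a\<in>C. u \<le> a"
    proof (cases "C = {}")
      case True
      then show ?thesis using p by (auto simp: A_def)
    next
      case False
      define m where "m x = (INF q\<in>C. q x)" for x
      have low: "- p (- x) \<le> q x" if "q \<in> C" for q x
        using sublinear_minus[of q x] CA[OF that] le_funD[of q p "- x"] by fastforce
      have m_le: "m x \<le> q x" if "q \<in> C" for q x
        unfolding m_def using low that by (intro cINF_lower bdd_belowI[of _ "- p (- x)"]) auto
      have m_ge: "c \<le> m x" if "\<And>q. q \<in> C \<Longrightarrow> c \<le> q x" for c x
        unfolding m_def using False that by (intro cINF_greatest) auto
      have "m (x + y) \<le> m x + m y" for x y
      proof -
        have "m (x + y) \<le> q x + r y" if qr: "q \<in> C" "r \<in> C" for q r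
        proof -
          \<comment> \<open>The chain property is what makes the infimum subadditive: the smaller of
            \<open>q\<close> and \<open>r\<close> estimates both summands at once.\<close>
          obtain k where k: "k \<in> C" "k \<le> q" "k \<le> r" using lin[OF qr] qr by blast
          have "m (x + y) \<le> k (x + y)" by (rule m_le[OF k(1)])
          also have "\<dots> \<le> k x + k y" using CA[OF k(1)] unfolding sublinear_def by blast
          also have "\<dots> \<le> q x + r y" by (rule add_mono[OF le_funD[OF k(2)] le_funD[OF k(3)]])
          finally show ?thesis .
        qed
        then have "m (x + y) - r y \<le> m x" if "r \<in> C" for r
          using that by (intro m_ge) (simp add: algebra_simps)
        then have "m (x + y) - m x \<le> m y" by (intro m_ge) (simp add: algebra_simps)
        then show ?thesis by simp
      qed
      moreover have "m (sc r x) \<le> r * m x" if r: "0 \<le> r" for r x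
      proof (cases "r = 0")
        case True
        obtain q where "q \<in> C" using False by blast
        then show ?thesis using m_le[of q 0] sublinear_zero[of q] CA[of q] True by simp
      next
        case False
        with r have r: "r > 0" by simp
        have "m (sc r x) / r \<le> m x"
        proof (rule m_ge)
          fix q assume q: "q \<in> C"
          have "m (sc r x) \<le> r * q x"
            using m_le[OF q, of "sc r x"] r
              conjunct2[OF conjunct1[OF CA[OF q], unfolded sublinear_def], rule_format, of r x] by simp
          then show "m (sc r x) / r \<le> q x" using r by (simp add: divide_le_eq mult.commute)
        qed
        then show ?thesis using r by (simp add: divide_le_eq mult.commute)
      qed
      ultimately have "sublinear sc m" unfolding sublinear_def by blast
      moreover have "m \<le> p"
      proof (rule le_funI)
        fix x
        obtain q where q: "q \<in> C" using False by blast
        show "m x \<le> p x" using m_le[OF q, of x] CA[OF q] le_funD[of q p x] by fastforce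
      qed
      ultimately show ?thesis using m_le by (auto simp: A_def le_fun_def)
    qed
  qed
  then obtain m where "m \<in> A" "\<And>a. a \<in> A \<Longrightarrow> a \<le> m \<Longrightarrow> a = m" by blast
  then show thesis using that[of m] by (auto simp: A_def intro: order_trans)
qed

text \<open>This proves Hahn--Banach without extending functionals from subspaces: a minimal sublinear
  functional coincides with each of its sublinear minorants \<open>lower q y\<close>, hence is additive.\<close>
lemma minimal_sublinear_additive:
  assumes q: "sublinear sc q" and min: "\<And>q'. sublinear sc q' \<Longrightarrow> q' \<le> q \<Longrightarrow> q' = q"
  shows "q (x + y) = q x + q y"
proof -
  have "lower q y = q"
    using lower_le[OF q order_refl, of y] by (intro min lower_sublinear q le_funI) simp
  then have "q x \<le> q (x + y) - q y"
    using lower_le[OF q, of 1 y x] by simp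
  moreover have "q (x + y) \<le> q x + q y" using q unfolding sublinear_def by blast
  ultimately show ?thesis by simp
qed

text \<open>Minimising below \<open>lower p v\<close> instead of \<open>p\<close> forces
  \<open>u (- v) \<le> - p v\<close>, hence equality at the prescribed vector.\<close>

lemma hahn_banach_functional:
  assumes p: "sublinear sc p"
  obtains u where "\<And>x y. u (x + y) = u x + u y" "\<And>r x. u (sc r x) = r * u x"
    "\<And>x. u x \<le> p x" "u v = p v"
proof -
  obtain u where u: "sublinear sc u" and le: "u \<le> lower p v"
    and min: "\<And>q'. sublinear sc q' \<Longrightarrow> q' \<le> u \<Longrightarrow> q' = u"
    using minimal_sublinear[OF lower_sublinear[OF p]] by metis
  have add: "u (x + y) = u x + u y" for x y
    by (rule minimal_sublinear_additive[OF u min])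
  have neg: "u (- x) = - u x" for x
    using add[of x "- x"] sublinear_zero[OF u] by simp
  have up: "u x \<le> p x" for x
    using le_funD[OF le, of x] lower_le[OF p order_refl, of v x] by simp
  have pos: "u (sc r x) = r * u x" if "r \<ge> 0" for r x
  proof -
    have 1: "u (sc r x) \<le> r * u x" for x using u that unfolding sublinear_def by blast
    from 1[of x] 1[of "- x"] show ?thesis by (simp add: neg)
  qed
  have hom: "u (sc r x) = r * u x" for r x
    using pos[of r x] pos[of "- r" x] neg[of "sc r x"] by (cases "r \<ge> 0") auto
  have "u (- v) \<le> - p v"
    using le_funD[OF le, of "- v"] lower_le[OF p, of 1 v "- v"] sublinear_zero[OF p] by simp
  then have "u v = p v" using neg[of v] up[of v] by simp
  then show thesis using that add hom up by blast
qed

end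

section \<open>Seminorm topologies and \<open>\<ell>\<^sub>1\<close>-sequences\<close>

text \<open>Everything is relative to \<open>topspace Z\<close>, since the dual is only a subspace
  of its function type.\<close>

definition continuous_seminorm ::
    "('k::real_or_complex \<Rightarrow> 'v::ab_group_add \<Rightarrow> 'v) \<Rightarrow> 'v topology \<Rightarrow> ('v \<Rightarrow> real) \<Rightarrow> bool" where
  "continuous_seminorm smul Z p \<longleftrightarrow>
     (\<forall>u\<in>topspace Z. 0 \<le> p u) \<and>
     (\<forall>u\<in>topspace Z. \<forall>v\<in>topspace Z. p (u + v) \<le> p u + p v) \<and>
     (\<forall>c. \<forall>u\<in>topspace Z. p (smul c u) \<le> norm c * p u) \<and>
     (\<forall>u\<in>topspace Z. \<forall>\<epsilon>>0. openin Z {v \<in> topspace Z. p (v - u) < \<epsilon>})"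

text \<open>Common ground for \<open>X\<close> and its strong dual, so that each argument about
  series is made once for both.\<close>

locale seminorm_topology = vector_space smul
  for smul :: "'k::real_or_complex \<Rightarrow> 'v::ab_group_add \<Rightarrow> 'v" +
  fixes Z :: "'v topology"
  assumes subspace_carrier: "subspace (topspace Z)"
    and seminorm_base: "\<And>U u. openin Z U \<Longrightarrow> u \<in> U \<Longrightarrow>
      \<exists>p. continuous_seminorm smul Z p \<and> (\<forall>v\<in>topspace Z. p (v - u) < 1 \<longrightarrow> v \<in> U)"
    and seminorms_separate: "\<And>u. u \<in> topspace Z \<Longrightarrow>
      (\<And>p. continuous_seminorm smul Z p \<Longrightarrow> p u = 0) \<Longrightarrow> u = 0"
begin

abbreviation "S \<equiv> topspace Z"
abbreviation "cs \<equiv> continuous_seminorm smul Z"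

lemma carrier_zero: "0 \<in> S"
  and carrier_add: "u \<in> S \<Longrightarrow> v \<in> S \<Longrightarrow> u + v \<in> S"
  and carrier_scale: "u \<in> S \<Longrightarrow> smul c u \<in> S"
  and carrier_diff: "u \<in> S \<Longrightarrow> v \<in> S \<Longrightarrow> u - v \<in> S"
  and carrier_sum: "(\<And>i. i \<in> A \<Longrightarrow> f i \<in> S) \<Longrightarrow> sum f A \<in> S"
  using subspace_carrier
  by (auto intro: subspace_0 subspace_add subspace_scale subspace_diff subspace_sum)

lemma cs_nonneg: "cs p \<Longrightarrow> u \<in> S \<Longrightarrow> 0 \<le> p u"
  and cs_add: "cs p \<Longrightarrow> u \<in> S \<Longrightarrow> v \<in> S \<Longrightarrow> p (u + v) \<le> p u + p v"
  and cs_scale: "cs p \<Longrightarrow> u \<in> S \<Longrightarrow> p (smul c u) \<le> norm c * p u"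
  and cs_open: "cs p \<Longrightarrow> u \<in> S \<Longrightarrow> \<epsilon> > 0 \<Longrightarrow> openin Z {v \<in> S. p (v - u) < \<epsilon>}"
  unfolding continuous_seminorm_def by blast+

lemma cs_zero: assumes "cs p" shows "p 0 = 0"
  using cs_scale[OF assms carrier_zero, of 0] cs_nonneg[OF assms carrier_zero] by simp

lemma cs_minus_commute: assumes "cs p" "u \<in> S" "v \<in> S" shows "p (u - v) = p (v - u)"
proof -
  have "p (- w) \<le> p w" if "w \<in> S" for w
    using cs_scale[OF assms(1) that, of "- 1"] by simp
  from this[of "u - v"] this[of "v - u"] show ?thesis
    using carrier_diff assms by simp
qed

lemma cs_triangle: "cs p \<Longrightarrow> u \<in> S \<Longrightarrow> v \<in> S \<Longrightarrow> w \<in> S \<Longrightarrow> p (u - w) \<le> p (u - v) + p (v - w)"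
  using cs_add[of p "u - v" "v - w"] by (simp add: carrier_diff)

lemma cs_sum:
  assumes "cs p" "\<And>i. i \<in> A \<Longrightarrow> f i \<in> S"
  shows "p (sum f A) \<le> (\<Sum>i\<in>A. p (f i))"
  using assms(2)
proof (induction A rule: infinite_finite_induct)
  case (insert i A)
  have "p (f i + sum f A) \<le> p (f i) + p (sum f A)"
    using insert.prems by (intro cs_add assms(1) carrier_sum) auto
  moreover have "p (sum f A) \<le> (\<Sum>i\<in>A. p (f i))" using insert.prems by (intro insert.IH) auto
  ultimately show ?case using insert.hyps by simp
qed (simp_all add: cs_zero[OF assms(1)])

lemma cs_linear_combination:
  assumes p: "cs p" and y: "\<And>k. y k \<in> S" "\<And>k. p (y k) \<le> C"
  shows "p (\<Sum>k\<in>A. smul (c k) (y k)) \<le> C * (\<Sum>k\<in>A. norm (c k))"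
proof -
  have "p (\<Sum>k\<in>A. smul (c k) (y k)) \<le> (\<Sum>k\<in>A. p (smul (c k) (y k)))"
    by (intro cs_sum p carrier_scale y)
  also have "\<dots> \<le> (\<Sum>k\<in>A. norm (c k) * C)"
    by (intro sum_mono order_trans[OF cs_scale[OF p y(1)]] mult_left_mono y) simp
  finally show ?thesis by (simp add: sum_distrib_left mult.commute)
qed

lemma limitin_cs:
  assumes x: "\<And>n. x n \<in> S"
  shows "limitin Z x l sequentially \<longleftrightarrow> l \<in> S \<and> (\<forall>p. cs p \<longrightarrow> (\<lambda>n. p (x n - l)) \<longlonglongrightarrow> 0)"
proof (intro iffI conjI allI impI)
  assume lim: "limitin Z x l sequentially"
  then show l: "l \<in> S" by (rule limitin_topspace)
  fix p assume p: "cs p"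
  show "(\<lambda>n. p (x n - l)) \<longlonglongrightarrow> 0"
  proof (rule tendstoI)
    fix \<epsilon> :: real assume "\<epsilon> > 0"
    then have "\<forall>\<^sub>F n in sequentially. x n \<in> {v \<in> S. p (v - l) < \<epsilon>}"
      using conjunct2[OF lim[unfolded limitin_def], rule_format, of "{v \<in> S. p (v - l) < \<epsilon>}"]
        cs_open[OF p l, of \<epsilon>] cs_zero[OF p] l by simp
    then show "\<forall>\<^sub>F n in sequentially. dist (p (x n - l)) 0 < \<epsilon>"
      by eventually_elim (use cs_nonneg[OF p carrier_diff[OF x l]] in \<open>auto simp: dist_real_def\<close>)
  qed
next
  assume *: "l \<in> S \<and> (\<forall>p. cs p \<longrightarrow> (\<lambda>n. p (x n - l)) \<longlonglongrightarrow> 0)"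
  show "limitin Z x l sequentially"
    unfolding limitin_def
  proof (intro conjI allI impI)
    fix U assume U: "openin Z U \<and> l \<in> U"
    obtain p where p: "cs p" "\<forall>v\<in>S. p (v - l) < 1 \<longrightarrow> v \<in> U"
      using seminorm_base[OF conjunct1[OF U] conjunct2[OF U]] by metis
    have "\<forall>\<^sub>F n in sequentially. dist (p (x n - l)) 0 < 1"
      using * p(1) by (intro tendstoD) auto
    then show "\<forall>\<^sub>F n in sequentially. x n \<in> U"
      by eventually_elim (use p(2) x in \<open>auto simp: dist_real_def\<close>)
  qed (use * in blast)
qed

lemma limit_bound:
  assumes x: "\<And>n. x n \<in> S" and lim: "limitin Z x l sequentially" and p: "cs p" and v: "v \<in> S"
    and ev: "\<forall>\<^sub>F n in sequentially. p (x n - v) \<le> c"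
  shows "p (l - v) \<le> c"
proof -
  have l: "l \<in> S" and *: "(\<lambda>n. p (x n - l)) \<longlonglongrightarrow> 0"
    using lim p unfolding limitin_cs[OF x] by auto
  have "(\<lambda>n. p (x n - l) + c) \<longlonglongrightarrow> 0 + c" by (intro tendsto_intros *)
  moreover have "\<forall>\<^sub>F n in sequentially. p (l - v) \<le> p (x n - l) + c"
    using ev
  proof eventually_elim
    case (elim n)
    then show ?case using cs_triangle[OF p l x v, of n] cs_minus_commute[OF p l x, of n] by simp
  qed
  ultimately show ?thesis
    using tendsto_lowerbound[of "\<lambda>n. p (x n - l) + c" "0 + c" sequentially "p (l - v)"] by simp
qed

lemma limit_unique:
  assumes x: "\<And>n. x n \<in> S" and "limitin Z x l sequentially" "limitin Z x l' sequentially"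
  shows "l = l'"
proof -
  have l: "l \<in> S" "l' \<in> S" by (rule limitin_topspace, fact)+
  have "p (l - l') = 0" if p: "cs p" for p
  proof -
    have lim: "(\<lambda>n. p (x n - l)) \<longlonglongrightarrow> 0" "(\<lambda>n. p (x n - l')) \<longlonglongrightarrow> 0"
      using assms(2,3) p unfolding limitin_cs[OF x] by auto
    have "p (l - l') \<le> p (x n - l) + p (x n - l')" for n
      using cs_triangle[OF p l(1) x l(2)] cs_minus_commute[OF p l(1) x] by simp
    then have "p (l - l') \<le> 0 + 0"
      by (intro LIMSEQ_le_const[OF tendsto_add[OF lim]]) auto
    then show ?thesis using cs_nonneg[OF p carrier_diff[OF l]] by simp
  qed
  then have "l - l' = 0" using seminorms_separate[OF carrier_diff[OF l]] by blast
  then show ?thesis by simp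
qed

section \<open>Series of finite combinations of an ell1-sequence\<close>

lemma ell1_carrier: "ell1_sequence smul Z x \<Longrightarrow> x n \<in> S"
  unfolding ell1_sequence_def by auto

lemma ell1_bounded:
  assumes x: "ell1_sequence smul Z x" and p: "cs p"
  obtains C where "C > 0" "\<And>n. p (x n) \<le> C"
proof -
  have "limitin Z x 0 sequentially" using x unfolding ell1_sequence_def by blast
  then have "(\<lambda>n. p (x n - 0)) \<longlonglongrightarrow> 0"
    using p unfolding limitin_cs[OF ell1_carrier[OF x]] by blast
  then have "Bseq (\<lambda>n. p (x n))" by (intro convergent_imp_Bseq) (auto simp: convergent_def)
  then obtain C where "C > 0" "\<And>n. norm (p (x n)) \<le> C" by (auto elim: BseqE)
  then show thesis using that[of C] by (simp add: abs_le_iff)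
qed

text \<open>The series \<open>\<Sum> a\<^sub>n e\<^sub>n\<close> is rearranged into an \<open>\<ell>\<^sub>1\<close>-combination of the \<open>x\<^sub>k\<close>, which
  supplies the limit although \<open>Z\<close> need not be complete.\<close>
lemma series_of_combinations:
  assumes x: "ell1_sequence smul Z x"
    and e: "\<And>n. e n = (\<Sum>k<K n. smul (\<alpha> n k) (x k))"
    and s: "\<And>n. s n * (\<Sum>k<K n. norm (\<alpha> n k)) \<le> (1/2) ^ n"
    and a: "\<And>n. norm (a n) \<le> M * s n" and M: "M \<ge> 0"
  shows "\<exists>l. limitin Z (\<lambda>N. \<Sum>n<N. smul (a n) (e n)) l sequentially \<and>
    (\<forall>p C. cs p \<longrightarrow> (\<forall>k. p (x k) \<le> C) \<longrightarrow> p l \<le> C * (2 * M))"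
proof -
  have xS: "x k \<in> S" for k by (rule ell1_carrier[OF x])
  \<comment> \<open>\<open>\<beta> n k\<close> is the contribution of \<open>a n\<close> to the
    coefficient of \<open>x k\<close>; its sums over \<open>k\<close> are dominated by a geometric
    sequence in \<open>n\<close>.\<close>
  define \<beta> where "\<beta> n k = (if k < K n then a n * \<alpha> n k else 0)" for n k
  have \<beta>sum: "(\<Sum>k<L. norm (\<beta> n k)) \<le> M * (1/2) ^ n" for n L
  proof -
    have "(\<Sum>k<L. norm (\<beta> n k)) \<le> (\<Sum>k<max L (K n). norm (\<beta> n k))"
      by (intro sum_mono2) auto
    also have "\<dots> = (\<Sum>k<K n. norm (\<beta> n k))"
      by (intro sum.mono_neutral_right) (auto simp: \<beta>_def)
    also have "\<dots> = norm (a n) * (\<Sum>k<K n. norm (\<alpha> n k))"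
      by (simp add: \<beta>_def norm_mult sum_distrib_left)
    also have "\<dots> \<le> (M * s n) * (\<Sum>k<K n. norm (\<alpha> n k))"
      by (intro mult_right_mono a sum_nonneg) auto
    also have "\<dots> \<le> M * (1/2) ^ n"
      using mult_left_mono[OF s[of n] M] by (simp add: mult.assoc)
    finally show ?thesis .
  qed
  have \<beta>le: "norm (\<beta> n k) \<le> M * (1/2) ^ n" for n k
    using \<beta>sum[of n "Suc k"] sum_nonneg[of "{..<k}" "\<lambda>k. norm (\<beta> n k)"] by simp
  have geo: "summable (\<lambda>n. M * (1/2) ^ n)" by (intro summable_mult summable_geometric) simp
  have geo_sum: "(\<Sum>n\<in>{N..<N'}. M * (1/2) ^ n) \<le> 2 * M * (1/2) ^ N" for N N' :: nat
  proof (cases "N \<le> N'")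
    case True
    then have "(\<Sum>n\<in>{N..<N'}. M * (1/2) ^ n) = 2 * M * (1/2) ^ N - 2 * M * (1/2) ^ N'"
      by (induction rule: dec_induct) auto
    then show ?thesis using M by simp
  qed (use M in auto)
  have \<beta>_summable: "summable (\<lambda>n. \<beta> n k)" for k
    by (rule summable_norm_cancel, rule summable_comparison_test'[OF geo, of 0]) (use \<beta>le in auto)
  define b where "b k = (\<Sum>n. \<beta> n k)" for k
  define B where "B N k = (\<Sum>n<N. \<beta> n k)" for N k
  have B_lim: "(\<lambda>N. B N k) \<longlonglongrightarrow> b k" for k
    unfolding B_def b_def by (rule summable_LIMSEQ[OF \<beta>_summable])
  \<comment> \<open>Only finite sums are interchanged; the upper end \<open>N'\<close> then tends to
    infinity. The bound is independent of \<open>L\<close>, which yields summability over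
    \<open>k\<close>.\<close>
  have tail: "(\<Sum>k<L. norm (b k - B N k)) \<le> 2 * M * (1/2) ^ N" for L N
  proof (rule LIMSEQ_le_const2)
    show "(\<lambda>N'. \<Sum>k<L. norm (B N' k - B N k)) \<longlonglongrightarrow> (\<Sum>k<L. norm (b k - B N k))"
      by (intro tendsto_intros B_lim)
    show "\<exists>N0. \<forall>N'\<ge>N0. (\<Sum>k<L. norm (B N' k - B N k)) \<le> 2 * M * (1/2) ^ N"
    proof (intro exI allI impI)
      fix N' assume N': "N \<le> N'"
      have "B N' k - B N k = (\<Sum>n\<in>{N..<N'}. \<beta> n k)" for k
        unfolding B_def using sum_diff_nat_ivl[of 0 N N' "\<lambda>n. \<beta> n k"] N'
        by (simp add: atLeast0LessThan)
      then have "(\<Sum>k<L. norm (B N' k - B N k)) \<le> (\<Sum>k<L. \<Sum>n\<in>{N..<N'}. norm (\<beta> n k))"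
        by (intro sum_mono) (simp add: norm_sum)
      also have "\<dots> = (\<Sum>n\<in>{N..<N'}. \<Sum>k<L. norm (\<beta> n k))" by (rule sum.swap)
      also have "\<dots> \<le> (\<Sum>n\<in>{N..<N'}. M * (1/2) ^ n)" by (intro sum_mono \<beta>sum)
      also have "\<dots> \<le> 2 * M * (1/2) ^ N" by (rule geo_sum)
      finally show "(\<Sum>k<L. norm (B N' k - B N k)) \<le> 2 * M * (1/2) ^ N" .
    qed
  qed
  have b_le: "(\<Sum>k<L. norm (b k)) \<le> 2 * M" for L
    using tail[where N = 0 and L = L] by (simp add: B_def)
  then have "summable (\<lambda>k. norm (b k))" by (intro summableI_nonneg_bounded) auto
  then obtain l where l: "limitin Z (\<lambda>L. \<Sum>k<L. smul (b k) (x k)) l sequentially"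
    using x unfolding ell1_sequence_def by blast
  have PS: "(\<Sum>k<L. smul (c k) (x k)) \<in> S" for L c by (intro carrier_sum carrier_scale xS)
  have eS: "e n \<in> S" for n unfolding e by (rule PS)
  have ES: "(\<Sum>n<N. smul (a n) (e n)) \<in> S" for N by (intro carrier_sum carrier_scale eS)
  have E: "(\<Sum>n<N. smul (a n) (e n)) = (\<Sum>k<L. smul (B N k) (x k))" if L: "\<And>n. n < N \<Longrightarrow> K n \<le> L" for N L
  proof -
    have "smul (a n) (e n) = (\<Sum>k<L. smul (\<beta> n k) (x k))" if "n < N" for n
    proof -
      have "(\<Sum>k<L. smul (\<beta> n k) (x k)) = (\<Sum>k<K n. smul (\<beta> n k) (x k))"
        using L[OF that] by (intro sum.mono_neutral_right) (auto simp: \<beta>_def)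
      then show ?thesis by (simp add: \<beta>_def e scale_sum_right)
    qed
    then have "(\<Sum>n<N. smul (a n) (e n)) = (\<Sum>n<N. \<Sum>k<L. smul (\<beta> n k) (x k))" by simp
    also have "\<dots> = (\<Sum>k<L. \<Sum>n<N. smul (\<beta> n k) (x k))" by (rule sum.swap)
    also have "\<dots> = (\<Sum>k<L. smul (B N k) (x k))" by (simp add: B_def scale_sum_left)
    finally show ?thesis .
  qed
  have dist: "p (l - (\<Sum>n<N. smul (a n) (e n))) \<le> C * (2 * M * (1/2) ^ N)"
    if p: "cs p" and C: "\<And>k. p (x k) \<le> C" for p C N
  proof (rule limit_bound[OF PS l p ES])
    \<comment> \<open>From \<open>L0\<close> on, the partial sum in the \<open>x k\<close> contains
      every term of the first \<open>N\<close> vectors \<open>e n\<close>; the sum of the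
      \<open>K n\<close> stands in for their maximum.\<close>
    define L0 where "L0 = (\<Sum>n<N. K n)"
    have C0: "C \<ge> 0" using cs_nonneg[OF p xS, of 0] C[of 0] by linarith
    have "p ((\<Sum>k<L. smul (b k) (x k)) - (\<Sum>n<N. smul (a n) (e n))) \<le> C * (2 * M * (1/2) ^ N)"
      if "L \<ge> L0" for L
    proof -
      have "K n \<le> L" if "n < N" for n
        using member_le_sum[of n "{..<N}" K] that \<open>L \<ge> L0\<close> unfolding L0_def by simp
      then have "(\<Sum>k<L. smul (b k) (x k)) - (\<Sum>n<N. smul (a n) (e n)) = (\<Sum>k<L. smul (b k - B N k) (x k))"
        by (simp add: E[of N L] scale_left_diff_distrib sum_subtractf)
      then have "p ((\<Sum>k<L. smul (b k) (x k)) - (\<Sum>n<N. smul (a n) (e n))) \<le> C * (\<Sum>k<L. norm (b k - B N k))"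
        by (simp add: cs_linear_combination[OF p xS C])
      also have "\<dots> \<le> C * (2 * M * (1/2) ^ N)" by (intro mult_left_mono tail C0)
      finally show ?thesis .
    qed
    then show "\<forall>\<^sub>F L in sequentially.
        p ((\<Sum>k<L. smul (b k) (x k)) - (\<Sum>n<N. smul (a n) (e n))) \<le> C * (2 * M * (1/2) ^ N)"
      unfolding eventually_sequentially by blast
  qed
  have lS: "l \<in> S" using l by (rule limitin_topspace)
  show ?thesis
  proof (intro exI[of _ l] conjI allI impI)
    show "limitin Z (\<lambda>N. \<Sum>n<N. smul (a n) (e n)) l sequentially"
      unfolding limitin_cs[OF ES]
    proof (intro conjI allI impI lS)
      fix p assume p: "cs p"
      obtain C where C: "\<And>k. p (x k) \<le> C" using ell1_bounded[OF x p] by blast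
      show "(\<lambda>N. p ((\<Sum>n<N. smul (a n) (e n)) - l)) \<longlonglongrightarrow> 0"
      proof (rule tendsto_sandwich[OF always_eventually always_eventually tendsto_const])
        show "\<forall>N. 0 \<le> p ((\<Sum>n<N. smul (a n) (e n)) - l)"
          by (intro allI cs_nonneg p carrier_diff ES lS)
        show "\<forall>N. p ((\<Sum>n<N. smul (a n) (e n)) - l) \<le> C * (2 * M * (1/2) ^ N)"
          using dist[OF p C] cs_minus_commute[OF p ES lS] by simp
        have "(\<lambda>N. C * (2 * M * (1/2) ^ N)) \<longlonglongrightarrow> C * (2 * M * 0)"
          by (intro tendsto_mult tendsto_const LIMSEQ_power_zero) simp
        then show "(\<lambda>N. C * (2 * M * (1/2) ^ N)) \<longlonglongrightarrow> 0" by simp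
      qed
    qed
    show "p l \<le> C * (2 * M)" if "cs p" "\<forall>k. p (x k) \<le> C" for p C
      using dist[OF that(1) that(2)[rule_format], of 0] by simp
  qed
qed

lemma span_range_finite_sum:
  fixes e :: "nat \<Rightarrow> 'v"
  assumes "h \<in> span (range e)"
  obtains c N where "h = (\<Sum>n<N. smul (c n) (e n))" "\<And>n. n \<ge> N \<Longrightarrow> c n = 0"
proof -
  have "\<exists>c N. h = (\<Sum>n<N. smul (c n) (e n)) \<and> (\<forall>n\<ge>N. c n = 0)"
    using assms
  proof (induction rule: span_induct_alt)
    case base
    show ?case by (intro exI[of _ "\<lambda>_. 0"] exI[of _ 0]) simp
  next
    case (step r x y)
    then obtain c N m where c: "y = (\<Sum>n<N. smul (c n) (e n))" "\<forall>n\<ge>N. c n = 0" and x: "x = e m"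
      by blast
    let ?N = "max N (Suc m)" and ?c = "\<lambda>n. (if n = m then r else 0) + c n"
    have "(\<Sum>n<?N. smul (c n) (e n)) = y"
      unfolding c(1) using c(2) by (intro sum.mono_neutral_right) auto
    moreover have "(\<Sum>n<?N. smul (if n = m then r else 0) (e n)) = smul r x"
      by (subst sum.mono_neutral_right[of _ "{m}"]) (auto simp: x)
    ultimately have "smul r x + y = (\<Sum>n<?N. smul (?c n) (e n))"
      by (simp add: scale_left_distrib sum.distrib)
    moreover have "\<forall>n\<ge>?N. ?c n = 0" using c(2) by auto
    ultimately show ?case by (intro exI[of _ ?c] exI[of _ ?N] conjI)
  qed
  then show thesis using that by blast
qed

end

section \<open>Locally convex spaces\<close>

lemma linear_functional_iff:
  assumes "vector_space smul"
  shows "Vector_Spaces.linear smul ((*) :: 'k::field \<Rightarrow> _) f \<longleftrightarrow>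
    (\<forall>x y. f (x + y) = f x + f y) \<and> (\<forall>c x. f (smul c x) = c * f x)"
proof -
  have "vector_space ((*) :: 'k \<Rightarrow> 'k \<Rightarrow> 'k)" by standard (auto simp: algebra_simps)
  then show ?thesis unfolding Vector_Spaces.linear_iff using assms by blast
qed

context locally_convex_space
begin

lemma continuous_affine: "continuous_map X X (\<lambda>v. smul c (v + w))"
proof -
  have 1: "continuous_map X (prod_topology X X) (\<lambda>v. (v, w))"
    by (intro continuous_map_pairedI) (auto simp: topspace_UNIV)
  have "continuous_map X X (\<lambda>v. v + w)"
    using continuous_map_compose[OF 1 continuous_add] by (simp add: comp_def)
  then have "continuous_map X (prod_topology euclidean X) (\<lambda>v. (c, v + w))"
    by (intro continuous_map_pairedI) auto
  from continuous_map_compose[OF this continuous_scale] show ?thesis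
    by (simp add: comp_def)
qed

lemma continuous_scalar_line: "continuous_map euclidean X (\<lambda>c. smul c v)"
proof -
  have "continuous_map euclidean (prod_topology euclidean X) (\<lambda>c. (c, v))"
    by (intro continuous_map_pairedI) (auto simp: topspace_UNIV)
  from continuous_map_compose[OF this continuous_scale] show ?thesis
    by (simp add: comp_def)
qed

lemma openin_affine_vimage: "openin X U \<Longrightarrow> openin X {v. smul c (v + w) \<in> U}"
  using openin_continuous_map_preimage[OF continuous_affine, of U c w] by (simp add: topspace_UNIV)

section \<open>Minkowski gauges of convex neighbourhoods\<close>

definition balanced_core :: "'a set \<Rightarrow> 'a set" where
  "balanced_core V = {x. \<forall>c. norm c \<le> 1 \<longrightarrow> smul c x \<in> V}"

definition core_gauge :: "'a set \<Rightarrow> 'a \<Rightarrow> real" where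
  "core_gauge V x = Inf {t. t > 0 \<and> smul (of_real (1 / t)) x \<in> balanced_core V}"

text \<open>Continuity of scaling at the origin gives a disc of radius \<open>\<delta>\<close> and a
  neighbourhood whose product lands in \<open>V\<close>; rescaling by \<open>\<delta> / 2\<close>
  turns that disc into one containing the unit disc.\<close>

lemma balanced_core_neighbourhood:
  assumes V: "openin X V" "0 \<in> V"
  obtains W where "openin X W" "0 \<in> W" "W \<subseteq> balanced_core V"
proof -
  let ?P = "{z \<in> topspace (prod_topology euclidean X). (\<lambda>(c, x). smul c x) z \<in> V}"
  have "openin (prod_topology euclidean X) ?P"
    by (rule openin_continuous_map_preimage[OF continuous_scale V(1)])
  moreover have "(0, 0) \<in> ?P" using V by (simp add: topspace_UNIV)
  ultimately have "\<exists>A B. openin euclidean A \<and> openin X B \<and> (0::'k) \<in> A \<and> 0 \<in> B \<and> A \<times> B \<subseteq> ?P"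
    by (rule openin_prod_topology_alt[THEN iffD1, rule_format])
  then obtain A B where AB: "open A" "openin X B" "(0::'k) \<in> A" "0 \<in> B" "A \<times> B \<subseteq> ?P"
    by auto
  then obtain \<delta> where \<delta>: "\<delta> > 0" "ball 0 \<delta> \<subseteq> A" by (meson open_contains_ball)
  let ?r = "of_real (\<delta> / 2) :: 'k"
  have r: "?r \<noteq> 0" using \<delta> by simp
  define W where "W = {v. smul (1 / ?r) (v + 0) \<in> B}"
  have "W \<subseteq> balanced_core V"
  proof
    fix v assume v: "v \<in> W"
    have "smul c v \<in> V" if "norm c \<le> 1" for c
    proof -
      have "norm c * (\<delta> / 2) \<le> 1 * (\<delta> / 2)" using that \<delta>(1) by (intro mult_right_mono) auto
      then have "norm (c * ?r) < \<delta>" using \<delta>(1) unfolding norm_mult norm_of_real by simp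
      then have "c * ?r \<in> A" using \<delta>(2) by auto
      then have "smul (c * ?r) (smul (1 / ?r) v) \<in> V" using AB(5) v by (auto simp: W_def)
      then show ?thesis using r by simp
    qed
    then show "v \<in> balanced_core V" by (simp add: balanced_core_def)
  qed
  moreover have "openin X W" unfolding W_def by (rule openin_affine_vimage[OF AB(2)])
  moreover have "0 \<in> W" using AB(4) by (simp add: W_def)
  ultimately show thesis using that by blast
qed

text \<open>Local convexity supplies convex sets that need not be balanced. The balanced core stays
  convex and makes the gauge homogeneous for all scalars instead of the positive ones only.\<close>

lemma core_gauge:
  assumes V: "openin X V" "0 \<in> V" "convex_over smul V"
  shows "continuous_seminorm smul X (core_gauge V)"
    and "core_gauge V x < 1 \<Longrightarrow> x \<in> V"
proof -
  let ?W = "balanced_core V" and ?p = "core_gauge V"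
  obtain W where W: "openin X W" "0 \<in> W" "W \<subseteq> ?W"
    using balanced_core_neighbourhood[OF V(1,2)] by blast
  have bal: "smul c x \<in> ?W" if "x \<in> ?W" "norm c \<le> 1" for c x
    unfolding balanced_core_def
  proof (intro CollectI allI impI)
    fix d :: 'k assume "norm d \<le> 1"
    then have "norm (d * c) \<le> 1" using that(2) by (simp add: norm_mult mult_le_one)
    then show "smul d (smul c x) \<in> V" using that(1) by (simp add: balanced_core_def)
  qed
  have conv: "smul (of_real (1 - u)) x + smul (of_real u) y \<in> ?W"
    if "x \<in> ?W" "y \<in> ?W" "0 \<le> u" "u \<le> 1" for x y u
    unfolding balanced_core_def
  proof (intro CollectI allI impI)
    fix c :: 'k assume "norm c \<le> 1"
    then have "smul c x \<in> V" "smul c y \<in> V" using that by (auto simp: balanced_core_def)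
    then have "smul (of_real (1 - u)) (smul c x) + smul (of_real u) (smul c y) \<in> V"
      using V(3)[unfolded convex_over_def, rule_format, of "smul c x" "smul c y" u] that by simp
    then show "smul c (smul (of_real (1 - u)) x + smul (of_real u) y) \<in> V"
      by (simp add: scale_right_distrib mult.commute[of c])
  qed
  define T where "T x = {t. t > 0 \<and> smul (of_real (1 / t)) x \<in> ?W}" for x
  have p_def: "?p x = Inf (T x)" for x by (simp add: core_gauge_def T_def)
  have T_le: "?p x \<le> t" if "t > 0" "smul (of_real (1 / t)) x \<in> ?W" for t x
    unfolding p_def using that by (intro cInf_lower bdd_belowI[of _ 0]) (auto simp: T_def)
  have T_ne: "T x \<noteq> {}" for x
  proof -
    let ?O = "{c :: 'k \<in> topspace euclidean. smul c x \<in> W}"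
    have "open ?O"
      using openin_continuous_map_preimage[OF continuous_scalar_line W(1), of x] by simp
    moreover have "0 \<in> ?O" using W(2) by simp
    ultimately obtain \<delta> where \<delta>: "\<delta> > 0" "ball 0 \<delta> \<subseteq> ?O" by (meson open_contains_ball)
    from \<delta>(1) have "norm (of_real (\<delta> / 2) :: 'k) < \<delta>" unfolding norm_of_real by simp
    then have "of_real (\<delta> / 2) \<in> ?O" by (intro subsetD[OF \<delta>(2)]) (simp only: mem_ball dist_0_norm)
    then have "2 / \<delta> \<in> T x" using \<delta>(1) W(3) by (auto simp: T_def)
    then show ?thesis by blast
  qed
  have T_ge: "c \<le> ?p x" if "\<And>t. t \<in> T x \<Longrightarrow> c \<le> t" for c x
    unfolding p_def using T_ne that by (intro cInf_greatest) auto
  have p0: "0 \<le> ?p x" for x by (rule T_ge) (simp add: T_def)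
  have sub: "?p (x + y) \<le> ?p x + ?p y" for x y
  proof -
    have st: "?p (x + y) \<le> s + t" if s: "s \<in> T x" and t: "t \<in> T y" for s t
    proof (rule T_le)
      have pos: "s > 0" "t > 0" using s t by (auto simp: T_def)
      \<comment> \<open>(x + y)/(s + t) is the convex combination of x/s and y/t with weight t/(s +
        t) on the second.\<close>
      have "smul (of_real (1 - t / (s + t))) (smul (of_real (1 / s)) x)
          + smul (of_real (t / (s + t))) (smul (of_real (1 / t)) y) \<in> ?W"
        using s t by (intro conv) (auto simp: T_def)
      moreover have "(1 - t / (s + t)) * (1 / s) = 1 / (s + t)" "t / (s + t) * (1 / t) = 1 / (s + t)"
        using pos by (auto simp: field_simps)
      ultimately show "smul (of_real (1 / (s + t))) (x + y) \<in> ?W"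
        by (simp only: scale_scale of_real_mult[symmetric] scale_right_distrib)
    qed (use s t in \<open>auto simp: T_def\<close>)
    have "?p (x + y) - t \<le> ?p x" if "t \<in> T y" for t
      using st[OF _ that] by (intro T_ge) (simp add: algebra_simps)
    then have "?p (x + y) - ?p x \<le> ?p y" by (intro T_ge) (simp add: algebra_simps)
    then show ?thesis by simp
  qed
  have hom: "?p (smul c x) \<le> norm c * ?p x" for c x
  proof (cases "c = 0")
    case True
    have "0 \<in> ?W" using W by blast
    then have "?p 0 \<le> \<epsilon>" if "\<epsilon> > 0" for \<epsilon> using that by (intro T_le) auto
    then have "?p 0 \<le> 0" by (rule field_le_epsilon) auto
    then show ?thesis using True by simp
  next
    case False
    have "?p (smul c x) / norm c \<le> ?p x"
    proof (rule T_ge)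
      fix t assume t: "t \<in> T x"
      \<comment> \<open>The phase of \<open>c\<close> is absorbed by the balanced set; its modulus
        rescales \<open>t\<close>.\<close>
      have "smul (c / of_real (norm c)) (smul (of_real (1 / t)) x) \<in> ?W"
        by (rule bal) (use t False in \<open>auto simp: T_def norm_divide\<close>)
      moreover have "c / of_real (norm c) * of_real (1 / t) = of_real (1 / (norm c * t)) * c"
        by (simp add: divide_simps)
      ultimately have "smul (of_real (1 / (norm c * t))) (smul c x) \<in> ?W" by simp
      then have "?p (smul c x) \<le> norm c * t" using t False by (intro T_le) (auto simp: T_def)
      then show "?p (smul c x) / norm c \<le> t" using False by (simp add: divide_le_eq mult.commute)
    qed
    then show ?thesis using False by (simp add: divide_le_eq mult.commute)
  qed
  have opn: "openin X {v. ?p (v - u) < \<epsilon>}" for u \<epsilon>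
  proof (subst openin_subopen, intro ballI)
    fix v0 assume "v0 \<in> {v. ?p (v - u) < \<epsilon>}"
    then have "?p (v0 - u) < \<epsilon>" by simp
    then obtain r where r: "r > 0" "?p (v0 - u) + r < \<epsilon>"
      using dense[of 0 "\<epsilon> - ?p (v0 - u)"] by (auto simp: algebra_simps)
    let ?O = "{v. smul (of_real (1 / r)) (v + (- v0)) \<in> W}"
    have "?O \<subseteq> {v. ?p (v - u) < \<epsilon>}"
    proof
      fix v assume "v \<in> ?O"
      then have "?p (v - v0) \<le> r" using W(3) r(1) by (intro T_le) auto
      then show "v \<in> {v. ?p (v - u) < \<epsilon>}" using sub[of "v - v0" "v0 - u"] r(2) by simp
    qed
    moreover have "openin X ?O" by (rule openin_affine_vimage[OF W(1)])
    moreover have "v0 \<in> ?O" using W(2) by simp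
    ultimately show "\<exists>T. openin X T \<and> v0 \<in> T \<and> T \<subseteq> {v. ?p (v - u) < \<epsilon>}" by blast
  qed
  show "continuous_seminorm smul X ?p"
    unfolding continuous_seminorm_def using p0 sub hom opn by (simp add: topspace_UNIV)
  show "x \<in> V" if less: "?p x < 1"
  proof -
    obtain t where t: "t \<in> T x" "t < 1"
      using less T_ge[where c = 1 and x = x] by (meson not_le)
    have "smul (of_real t) (smul (of_real (1 / t)) x) \<in> ?W"
      by (rule bal) (use t in \<open>auto simp: T_def\<close>)
    moreover have "smul (of_real t) (smul (of_real (1 / t)) x) = x"
      using t by (simp add: T_def flip: of_real_mult)
    ultimately have "x \<in> ?W" by (simp only:)
    then have "\<forall>c. norm c \<le> 1 \<longrightarrow> smul c x \<in> V" by (simp add: balanced_core_def)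
    from this[rule_format, of 1] show ?thesis by simp
  qed
qed

lemma seminorm_at_zero:
  assumes "openin X U" "0 \<in> U"
  obtains p where "continuous_seminorm smul X p" "\<And>x. p x < 1 \<Longrightarrow> x \<in> U"
proof -
  obtain V where "openin X V" "0 \<in> V" "V \<subseteq> U" "convex_over smul V"
    using locally_convex[OF assms] by auto
  then show thesis using that[of "core_gauge V"] core_gauge[of V] by auto
qed

sublocale seminorm_topology smul X
proof
  show "subspace (topspace X)" by (simp add: topspace_UNIV)
  show "\<exists>p. continuous_seminorm smul X p \<and> (\<forall>v\<in>topspace X. p (v - u) < 1 \<longrightarrow> v \<in> U)"
    if U: "openin X U" "u \<in> U" for U u
  proof -
    have "openin X {v. smul 1 (v + u) \<in> U}" by (rule openin_affine_vimage[OF U(1)])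
    moreover have "0 \<in> {v. smul 1 (v + u) \<in> U}" using U(2) by simp
    ultimately obtain p where p: "continuous_seminorm smul X p" "\<And>x. p x < 1 \<Longrightarrow> x \<in> {v. smul 1 (v + u) \<in> U}"
      using seminorm_at_zero by blast
    have "v \<in> U" if "p (v - u) < 1" for v using p(2)[OF that] by simp
    then show ?thesis using p(1) by blast
  qed
  show "u = 0" if "\<And>p. continuous_seminorm smul X p \<Longrightarrow> p u = 0" for u
  proof (rule ccontr)
    assume "u \<noteq> 0"
    then obtain U where U: "openin X U" "0 \<in> U" "u \<notin> U"
      using Hausdorff unfolding Hausdorff_space_def disjnt_def topspace_UNIV
      by (metis UNIV_I disjoint_iff)
    then obtain p where "continuous_seminorm smul X p" "\<And>x. p x < 1 \<Longrightarrow> x \<in> U"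
      using seminorm_at_zero by blast
    then show False using that[of p] U(3) by force
  qed
qed

lemma continuous_dual_iff:
  "\<phi> \<in> continuous_dual smul X \<longleftrightarrow> (\<forall>x y. \<phi> (x + y) = \<phi> x + \<phi> y) \<and> (\<forall>c x. \<phi> (smul c x) = c * \<phi> x) \<and>
     continuous_map X euclidean \<phi>"
  unfolding continuous_dual_def using linear_functional_iff[OF vector_space_axioms] by blast

lemma bounded_functional_continuous:
  fixes \<phi> :: "'a \<Rightarrow> 'k"
  assumes add: "\<And>x y. \<phi> (x + y) = \<phi> x + \<phi> y" and p: "continuous_seminorm smul X p"
    and C: "\<And>x. norm (\<phi> x) \<le> C * p x" "C > 0"
  shows "continuous_map X euclidean \<phi>"
  unfolding continuous_map_def
proof (intro conjI allI impI)
  fix G :: "'k set" assume "openin euclidean G"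
  then have G: "open G" by simp
  show "openin X {x \<in> topspace X. \<phi> x \<in> G}"
  proof (subst openin_subopen, intro ballI)
    fix x0 assume "x0 \<in> {x \<in> topspace X. \<phi> x \<in> G}"
    then obtain \<epsilon> where \<epsilon>: "\<epsilon> > 0" "ball (\<phi> x0) \<epsilon> \<subseteq> G" using G by (auto simp: open_contains_ball)
    have diff: "\<phi> (x - x0) = \<phi> x - \<phi> x0" for x using add[of "x - x0" x0] by simp
    let ?O = "{v \<in> topspace X. p (v - x0) < \<epsilon> / C}"
    have "openin X ?O" using \<epsilon>(1) C(2) by (intro cs_open p) (auto simp: topspace_UNIV)
    moreover have "x0 \<in> ?O" using cs_zero[OF p] \<epsilon>(1) C(2) by (simp add: topspace_UNIV)
    moreover have "?O \<subseteq> {x \<in> topspace X. \<phi> x \<in> G}"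
    proof
      fix v assume v: "v \<in> ?O"
      then have "C * p (v - x0) < \<epsilon>" using C(2) by (simp add: pos_less_divide_eq mult.commute)
      then have "norm (\<phi> v - \<phi> x0) < \<epsilon>" using C(1)[of "v - x0"] diff by simp
      then have "\<phi> v \<in> ball (\<phi> x0) \<epsilon>" by (simp add: dist_norm norm_minus_commute)
      then show "v \<in> {x \<in> topspace X. \<phi> x \<in> G}" using \<epsilon>(2) v by blast
    qed
    ultimately show "\<exists>T. openin X T \<and> x0 \<in> T \<and> T \<subseteq> {x \<in> topspace X. \<phi> x \<in> G}" by blast
  qed
qed simp

text \<open>Hahn-Banach over the reals gives a real-linear \<open>u\<close> dominated by a seminorm
  and nonzero at \<open>v\<close>; a square root of -1, if present, completes it to a scalar-linear
  functional.\<close>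

lemma dual_separates_points:
  assumes "v \<noteq> 0"
  obtains \<phi> where "\<phi> \<in> continuous_dual smul X" "\<phi> v \<noteq> 0"
proof -
  obtain p where p: "continuous_seminorm smul X p" "p v \<noteq> 0"
    using seminorms_separate[of v] assms by (auto simp: topspace_UNIV)
  have p_add: "p (x + y) \<le> p x + p y" and p_hom: "p (smul c x) \<le> norm c * p x" for x y c
    using cs_add[OF p(1)] cs_scale[OF p(1)] by (simp_all add: topspace_UNIV)
  interpret R: real_space "\<lambda>r. smul (of_real r)"
    by unfold_locales (simp_all add: scale_right_distrib scale_left_distrib)
  have "p (smul (of_real r) x) \<le> r * p x" if "0 \<le> r" for r x
    using p_hom[of "of_real r" x] that by simp
  then have "sublinear (\<lambda>r. smul (of_real r)) p"
    unfolding sublinear_def using p_add by blast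
  then obtain u where u_add: "\<And>x y. u (x + y) = u x + u y"
    and u_hom: "\<And>r x. u (smul (of_real r) x) = r * u x"
    and u_le: "\<And>x. u x \<le> p x" and uv: "u v = p v"
    using R.hahn_banach_functional by blast
  have u_abs: "\<bar>u x\<bar> \<le> p x" for x
    using u_le[of x] u_le[of "- x"] u_hom[of "-1" x] p_hom[of "-1" x] by simp
  from real_or_complex[where 'a = 'k] show thesis
  proof
    assume *: "\<forall>x::'k. \<exists>a. x = a *\<^sub>R 1"
    define \<phi> :: "'a \<Rightarrow> 'k" where "\<phi> x = of_real (u x)" for x
    have add: "\<phi> (x + y) = \<phi> x + \<phi> y" for x y by (simp add: \<phi>_def u_add)
    have "\<phi> (smul c x) = c * \<phi> x" for c x
    proof -
      obtain r where "c = of_real r" using * by (auto simp: of_real_def)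
      then show ?thesis by (simp add: \<phi>_def u_hom)
    qed
    moreover have "continuous_map X euclidean \<phi>"
      by (rule bounded_functional_continuous[OF add p(1), of 1]) (simp_all add: \<phi>_def u_abs)
    ultimately have "\<phi> \<in> continuous_dual smul X" using add unfolding continuous_dual_iff by blast
    then show thesis using that[of \<phi>] uv p(2) by (simp add: \<phi>_def)
  next
    assume "\<exists>i::'k. i * i = - 1 \<and> (\<forall>x. \<exists>a b. x = a *\<^sub>R 1 + b *\<^sub>R i)"
    then obtain i :: 'k where i: "i * i = - 1" and *: "\<And>x. \<exists>a b. x = of_real a + of_real b * i"
      by (auto simp: scaleR_conv_of_real)
    \<comment> \<open>The usual complexification: the scalar-linear functional with real part
      \<open>u\<close>.\<close>
    define \<phi> where "\<phi> x = of_real (u x) - i * of_real (u (smul i x))" for x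
    have add: "\<phi> (x + y) = \<phi> x + \<phi> y" for x y
      by (simp add: \<phi>_def u_add scale_right_distrib algebra_simps)
    have real: "\<phi> (smul (of_real r) x) = of_real r * \<phi> x" for r x
    proof -
      have "smul i (smul (of_real r) x) = smul (of_real r) (smul i x)" by (simp add: mult.commute)
      then show ?thesis by (simp only: \<phi>_def u_hom) (simp add: algebra_simps)
    qed
    have imag: "\<phi> (smul i x) = i * \<phi> x" for x
    proof -
      have "u (smul i (smul i x)) = - u x" using u_hom[of "-1" x] i by simp
      then have "\<phi> (smul i x) = of_real (u (smul i x)) + i * of_real (u x)"
        by (simp add: \<phi>_def)
      also have "\<dots> = i * of_real (u x) - (i * i) * of_real (u (smul i x))" by (simp add: i)
      also have "\<dots> = i * \<phi> x" unfolding \<phi>_def by (simp only: right_diff_distrib mult.assoc)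
      finally show ?thesis .
    qed
    have "\<phi> (smul c x) = c * \<phi> x" for c x
    proof -
      obtain a b where c: "c = of_real a + of_real b * i" using * by blast
      have "smul c x = smul (of_real a) x + smul (of_real b) (smul i x)"
        unfolding c by (simp add: scale_left_distrib)
      then show ?thesis by (simp only: add real imag) (simp add: c algebra_simps)
    qed
    moreover have "continuous_map X euclidean \<phi>"
    proof (rule bounded_functional_continuous[OF add p(1), of "1 + norm i * norm i"])
      fix x
      have "norm (\<phi> x) \<le> norm (of_real (u x) :: 'k) + norm (i * of_real (u (smul i x)))"
        unfolding \<phi>_def by (rule norm_triangle_ineq4)
      also have "\<dots> = \<bar>u x\<bar> + norm i * \<bar>u (smul i x)\<bar>" by (simp add: norm_mult)
      \<comment> \<open>One factor \<open>norm i\<close> comes from the product, the other from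
        \<open>p (smul i x)\<close>.\<close>
      also have "\<dots> \<le> p x + norm i * (norm i * p x)"
        by (intro add_mono u_abs mult_left_mono order_trans[OF u_abs p_hom]) simp
      finally show "norm (\<phi> x) \<le> (1 + norm i * norm i) * p x" by (simp add: algebra_simps)
    qed (simp add: add_pos_nonneg)
    ultimately have mem: "\<phi> \<in> continuous_dual smul X" using add unfolding continuous_dual_iff by blast
    have "\<phi> v \<noteq> 0"
    proof
      assume "\<phi> v = 0"
      then have "of_real (u v) = i * of_real (u (smul i v))" by (simp add: \<phi>_def)
      \<comment> \<open>Squaring replaces \<open>i\<close> by -1, so that a sum of two real squares
        vanishes.\<close>
      then have "of_real (u v) * of_real (u v) = (i * i) * (of_real (u (smul i v)) * of_real (u (smul i v)))"
        by (simp add: algebra_simps)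
      then have "of_real (u v * u v + u (smul i v) * u (smul i v)) = (0::'k)" by (simp add: i)
      then have "u v * u v + u (smul i v) * u (smul i v) = 0" by (simp only: of_real_eq_0_iff)
      then show False using uv p(2) by (simp add: sum_squares_eq_zero_iff)
    qed
    then show thesis using that mem by blast
  qed
qed

end

section \<open>The strong dual\<close>

lemma closure_of_meets:
  assumes "v \<in> Z closure_of A" "openin Z U" "v \<in> U"
  obtains w where "w \<in> A" "w \<in> U"
  using assms by (force simp: in_closure_of)

context locally_convex_space
begin

abbreviation "dual \<equiv> continuous_dual smul X"
abbreviation "sdual \<equiv> strong_dual smul X"

lemma topspace_strong_dual: "topspace sdual = dual"
  unfolding strong_dual_def by (rule topspace_uniform_convergence_topology)

lemma dual_add: "\<phi> \<in> dual \<Longrightarrow> \<phi> (x + y) = \<phi> x + \<phi> y"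
  and dual_scale: "\<phi> \<in> dual \<Longrightarrow> \<phi> (smul c x) = c * \<phi> x"
  and dual_continuous: "\<phi> \<in> dual \<Longrightarrow> continuous_map X euclidean \<phi>"
  unfolding continuous_dual_iff by blast+

lemma dual_zero: "\<phi> \<in> dual \<Longrightarrow> \<phi> 0 = 0"
  using dual_scale[of \<phi> 0 0] by simp

lemma dual_diff: "\<phi> \<in> dual \<Longrightarrow> \<phi> (x - y) = \<phi> x - \<phi> y"
  using dual_add[of \<phi> "x - y" y] by simp

lemma dual_sum: "\<phi> \<in> dual \<Longrightarrow> \<phi> (sum h A) = (\<Sum>i\<in>A. \<phi> (h i))"
  by (induction A rule: infinite_finite_induct) (auto simp: dual_zero dual_add)

lemma zero_in_dual: "(\<lambda>x. 0) \<in> dual"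
  unfolding continuous_dual_iff by simp

lemma dual_tendsto:
  assumes \<phi>: "\<phi> \<in> dual" and lim: "limitin X y l sequentially"
  shows "(\<lambda>n. \<phi> (y n)) \<longlonglongrightarrow> \<phi> l"
  using continuous_map_limit[OF dual_continuous[OF \<phi>] lim] by (simp add: comp_def)

lemma topspace_weak_topology: "topspace (weak_topology smul X) = UNIV"
  unfolding weak_topology_def using zero_in_dual by (intro topspace_initial_topology) auto

lemma openin_weak_vimage:
  assumes "\<phi> \<in> dual" "open G"
  shows "openin (weak_topology smul X) {v. \<phi> v \<in> G}"
  unfolding weak_topology_def initial_topology_def
  using assms by (intro topology_generated_by_Basis) auto

lemma continuous_map_into_weak:
  assumes "\<And>\<phi>. \<phi> \<in> dual \<Longrightarrow> continuous_map Y euclidean (\<lambda>y. \<phi> (h y))"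
  shows "continuous_map Y (weak_topology smul X) h"
  unfolding weak_topology_def initial_topology_def
proof (rule continuous_on_generated_topo)
  fix U assume "U \<in> {{v \<in> UNIV. \<phi> v \<in> U} |\<phi> U. \<phi> \<in> dual \<and> open U}"
  then obtain \<phi> G where U: "U = {v. \<phi> v \<in> G}" "\<phi> \<in> dual" "open G" by auto
  have "openin Y {y \<in> topspace Y. \<phi> (h y) \<in> G}"
    using openin_continuous_map_preimage[OF assms[OF U(2)], of G] U(3) by simp
  moreover have "{y \<in> topspace Y. \<phi> (h y) \<in> G} = h -` U \<inter> topspace Y" using U(1) by auto
  ultimately show "openin Y (h -` U \<inter> topspace Y)" by simp
next
  have "{v \<in> UNIV. (\<lambda>x. 0::'k) v \<in> UNIV} \<in> {{v \<in> UNIV. \<phi> v \<in> U} |\<phi> U. \<phi> \<in> dual \<and> open U}"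
    using zero_in_dual open_UNIV by blast
  then show "h ` topspace Y \<subseteq> \<Union> {{v \<in> UNIV. \<phi> v \<in> U} |\<phi> U. \<phi> \<in> dual \<and> open U}"
    by auto
qed

lemma singleton_bounded: "bounded_in smul (weak_topology smul X) {v}"
  unfolding bounded_in_def
proof (intro conjI allI impI)
  fix U assume U: "openin (weak_topology smul X) U \<and> 0 \<in> U"
  have "continuous_map euclidean (weak_topology smul X) (\<lambda>c. smul c v)"
    by (intro continuous_map_into_weak)
       (simp add: dual_scale continuous_map_iff_continuous2 continuous_intros)
  then have "openin euclidean {c :: 'k \<in> topspace euclidean. smul c v \<in> U}"
    using U by (intro openin_continuous_map_preimage) auto
  then have "open {c :: 'k. smul c v \<in> U}" by simp
  moreover have "0 \<in> {c :: 'k. smul c v \<in> U}" using U by simp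
  ultimately obtain \<delta> where \<delta>: "\<delta> > 0" "ball 0 \<delta> \<subseteq> {c :: 'k. smul c v \<in> U}"
    by (meson open_contains_ball)
  show "\<exists>s>0. \<forall>t>s. {v} \<subseteq> smul (of_real t) ` U"
  proof (intro exI[of _ "1 / \<delta>"] conjI allI impI)
    fix t assume t: "t > 1 / \<delta>"
    then have "t > 0" using \<delta>(1) by (meson less_trans zero_less_divide_1_iff)
    then have "norm (of_real (1 / t) :: 'k) < \<delta>"
      using t \<delta>(1) unfolding norm_of_real by (simp add: field_simps)
    then have "of_real (1 / t) \<in> ball (0 :: 'k) \<delta>" by (simp only: mem_ball dist_0_norm)
    then have "smul (of_real (1 / t)) v \<in> U" using \<delta>(2) by blast
    moreover have "v = smul (of_real t) (smul (of_real (1 / t)) v)" using \<open>t > 0\<close> by simp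
    ultimately show "{v} \<subseteq> smul (of_real t) ` U" by blast
  qed (use \<delta> in simp)
qed (simp add: topspace_weak_topology)

text \<open>The set where \<open>\<phi>\<close> has norm below 1 is weakly open and therefore
  absorbs \<open>B\<close>. This makes the suprema defining the strong seminorms finite.\<close>

lemma dual_bounded_on:
  assumes \<phi>: "\<phi> \<in> dual" and B: "bounded_in smul (weak_topology smul X) B"
  shows "\<exists>C. \<forall>w\<in>B. norm (\<phi> w) \<le> C"
proof -
  let ?U = "{v. \<phi> v \<in> ball 0 1}"
  have "openin (weak_topology smul X) ?U \<and> 0 \<in> ?U"
    using openin_weak_vimage[OF \<phi>, of "ball 0 1"] dual_zero[OF \<phi>] by simp
  then obtain s where s: "s > 0" "\<forall>t>s. B \<subseteq> smul (of_real t) ` ?U"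
    using B unfolding bounded_in_def by blast
  have "norm (\<phi> w) \<le> s + 1" if "w \<in> B" for w
  proof -
    have "w \<in> smul (of_real (s + 1)) ` ?U"
      using subsetD[OF s(2)[rule_format, of "s + 1"] that] by simp
    then obtain u where u: "w = smul (of_real (s + 1)) u" "\<phi> u \<in> ball 0 1"
      by (elim imageE CollectE)
    have "norm (\<phi> w) = norm (of_real (s + 1) :: 'k) * norm (\<phi> u)"
      unfolding u(1) dual_scale[OF \<phi>] norm_mult ..
    also have "\<dots> \<le> (s + 1) * 1"
      using u(2) s(1) unfolding norm_of_real by (intro mult_mono) auto
    finally show ?thesis by simp
  qed
  then show ?thesis by (intro exI[of _ "s + 1"] ballI)
qed

text \<open>The inserted 0 settles the empty family.\<close>

definition sup_seminorm :: "'a set set \<Rightarrow> ('a \<Rightarrow> 'k) \<Rightarrow> real" where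
  "sup_seminorm F \<phi> = Sup (insert 0 ((\<lambda>w. norm (\<phi> w)) ` \<Union>F))"

text \<open>The factor \<open>r\<close> is there because \<open>seminorm_base\<close> asks for unit
  balls: a basic neighbourhood of radius \<open>\<epsilon>\<close> contains the unit ball for
  \<open>r = 1 / \<epsilon>\<close>.\<close>

lemma sup_seminorm:
  assumes F: "finite F" "F \<subseteq> {B. bounded_in smul (weak_topology smul X) B}" and "r > 0"
  shows "continuous_seminorm fun_smul sdual (\<lambda>\<phi>. r * sup_seminorm F \<phi>)"
    and sup_seminorm_upper: "\<phi> \<in> dual \<Longrightarrow> w \<in> \<Union>F \<Longrightarrow> norm (\<phi> w) \<le> sup_seminorm F \<phi>"
proof -
  interpret F: vector_space "fun_smul :: 'k \<Rightarrow> ('a \<Rightarrow> 'k) \<Rightarrow> _" by (rule vector_space_fun_smul)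
  have bdd: "bdd_above (insert 0 ((\<lambda>w. norm (\<phi> w)) ` \<Union>F))" if \<phi>: "\<phi> \<in> dual" for \<phi>
  proof -
    have "\<forall>B\<in>F. \<exists>C. \<forall>w\<in>B. norm (\<phi> w) \<le> C" using dual_bounded_on[OF \<phi>] subsetD[OF F(2)] by simp
    then have "\<forall>B\<in>F. bdd_above ((\<lambda>w. norm (\<phi> w)) ` B)" by (auto simp: bdd_above_def)
    then have "bdd_above (\<Union>B\<in>F. (\<lambda>w. norm (\<phi> w)) ` B)" using F(1) by simp
    then show ?thesis by (simp add: image_Union)
  qed
  have up: "norm (\<phi> w) \<le> sup_seminorm F \<phi>" if "\<phi> \<in> dual" "w \<in> \<Union>F" for \<phi> w
    unfolding sup_seminorm_def using that by (intro cSup_upper bdd) auto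
  then show "\<phi> \<in> dual \<Longrightarrow> w \<in> \<Union>F \<Longrightarrow> norm (\<phi> w) \<le> sup_seminorm F \<phi>" .
  have nonneg: "0 \<le> sup_seminorm F \<phi>" if "\<phi> \<in> dual" for \<phi>
    unfolding sup_seminorm_def using that by (intro cSup_upper bdd) auto
  have least: "sup_seminorm F \<phi> \<le> c" if "0 \<le> c" "\<And>w. w \<in> \<Union>F \<Longrightarrow> norm (\<phi> w) \<le> c" for \<phi> c
    unfolding sup_seminorm_def using that by (intro cSup_least) auto
  have sub: "\<phi> + \<psi> \<in> dual" "\<phi> - \<psi> \<in> dual" if "\<phi> \<in> dual" "\<psi> \<in> dual" for \<phi> \<psi>
    using that unfolding continuous_dual_iff
    by (auto simp: algebra_simps plus_fun_def fun_diff_def intro: continuous_map_add continuous_map_diff)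
  have add: "sup_seminorm F (\<phi> + \<psi>) \<le> sup_seminorm F \<phi> + sup_seminorm F \<psi>"
    if "\<phi> \<in> dual" "\<psi> \<in> dual" for \<phi> \<psi>
  proof (rule least)
    fix w assume "w \<in> \<Union>F"
    then show "norm ((\<phi> + \<psi>) w) \<le> sup_seminorm F \<phi> + sup_seminorm F \<psi>"
      using norm_triangle_ineq[of "\<phi> w" "\<psi> w"] up[OF that(1)] up[OF that(2)] by fastforce
  qed (simp add: nonneg that)
  have hom: "sup_seminorm F (fun_smul c \<phi>) \<le> norm c * sup_seminorm F \<phi>" if "\<phi> \<in> dual" for c \<phi>
    using up[OF that] nonneg[OF that]
    by (intro least) (simp_all add: fun_smul_def norm_mult mult_left_mono)
  have opn: "openin sdual {\<psi> \<in> dual. r * sup_seminorm F (\<psi> - \<phi>) < \<epsilon>}" if \<phi>: "\<phi> \<in> dual" "\<epsilon> > 0" for \<phi> \<epsilon>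
    unfolding strong_dual_def openin_uniform_convergence_topology
  proof (intro conjI ballI)
    fix \<psi>0 assume \<psi>0: "\<psi>0 \<in> {\<psi> \<in> dual. r * sup_seminorm F (\<psi> - \<phi>) < \<epsilon>}"
    \<comment> \<open>Half of the remaining gap, divided by \<open>r\<close>, keeps the triangle
      inequality strictly below \<open>\<epsilon>\<close>.\<close>
    define \<delta> where "\<delta> = (\<epsilon> - r * sup_seminorm F (\<psi>0 - \<phi>)) / (2 * r)"
    have \<delta>: "\<delta> > 0" using \<psi>0 \<open>r > 0\<close> by (simp add: \<delta>_def)
    have "{v \<in> dual. \<forall>w\<in>\<Union>F. norm (v w - \<psi>0 w) < \<delta>} \<subseteq> {\<psi> \<in> dual. r * sup_seminorm F (\<psi> - \<phi>) < \<epsilon>}"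
    proof safe
      fix \<psi> assume \<psi>: "\<psi> \<in> dual" "\<forall>w\<in>\<Union>F. norm (\<psi> w - \<psi>0 w) < \<delta>"
      have "sup_seminorm F (\<psi> - \<psi>0) \<le> \<delta>" using \<psi>(2) \<delta> by (intro least) (auto intro: less_imp_le)
      moreover have "sup_seminorm F ((\<psi> - \<psi>0) + (\<psi>0 - \<phi>)) \<le> sup_seminorm F (\<psi> - \<psi>0) + sup_seminorm F (\<psi>0 - \<phi>)"
        using \<psi>(1) \<psi>0 \<phi>(1) by (intro add sub) auto
      ultimately have "sup_seminorm F (\<psi> - \<phi>) \<le> \<delta> + sup_seminorm F (\<psi>0 - \<phi>)" by simp
      then have "r * sup_seminorm F (\<psi> - \<phi>) \<le> r * (\<delta> + sup_seminorm F (\<psi>0 - \<phi>))"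
        using \<open>r > 0\<close> by simp
      moreover have "2 * (r * \<delta>) = \<epsilon> - r * sup_seminorm F (\<psi>0 - \<phi>)"
        using \<open>r > 0\<close> by (simp add: \<delta>_def)
      moreover have "r * \<delta> > 0" using \<open>r > 0\<close> \<delta> by simp
      ultimately show "r * sup_seminorm F (\<psi> - \<phi>) < \<epsilon>" by (simp add: distrib_left)
    qed
    then show "\<exists>\<F> \<epsilon>'. finite \<F> \<and> \<F> \<subseteq> {B. bounded_in smul (weak_topology smul X) B} \<and> \<epsilon>' > 0 \<and>
        {v \<in> dual. \<forall>w\<in>\<Union>\<F>. norm (v w - \<psi>0 w) < \<epsilon>'} \<subseteq> {\<psi> \<in> dual. r * sup_seminorm F (\<psi> - \<phi>) < \<epsilon>}"
      using F \<delta> by blast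
  qed blast
  show "continuous_seminorm fun_smul sdual (\<lambda>\<phi>. r * sup_seminorm F \<phi>)"
    unfolding continuous_seminorm_def topspace_strong_dual
  proof (intro conjI ballI allI impI)
    show "r * sup_seminorm F (\<phi> + \<psi>) \<le> r * sup_seminorm F \<phi> + r * sup_seminorm F \<psi>"
      if "\<phi> \<in> dual" "\<psi> \<in> dual" for \<phi> \<psi>
      using add[OF that] \<open>r > 0\<close> by (simp flip: distrib_left)
    show "r * sup_seminorm F (fun_smul c \<phi>) \<le> norm c * (r * sup_seminorm F \<phi>)" if "\<phi> \<in> dual" for c \<phi>
      using mult_left_mono[OF hom[OF that], of r c] \<open>r > 0\<close> by (simp add: mult_ac)
  qed (use nonneg \<open>r > 0\<close> opn in auto)
qed

text \<open>Singletons are weakly bounded, so strong convergence implies pointwise convergence;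
  strong limits and strong density are evaluated at vectors through this.\<close>

lemma evaluation_seminorm:
  "\<exists>p. continuous_seminorm fun_smul sdual p \<and> (\<forall>\<phi>\<in>dual. norm (\<phi> v) \<le> p \<phi>)"
proof (intro exI conjI ballI)
  show "continuous_seminorm fun_smul sdual (\<lambda>\<phi>. 1 * sup_seminorm {{v}} \<phi>)"
    using singleton_bounded by (intro sup_seminorm) auto
  show "norm (\<phi> v) \<le> 1 * sup_seminorm {{v}} \<phi>" if "\<phi> \<in> dual" for \<phi>
    using sup_seminorm_upper[of "{{v}}" 1 \<phi> v] that singleton_bounded by simp
qed

lemma strong_dual_seminorm_topology: "seminorm_topology fun_smul sdual"
proof -
  interpret F: vector_space "fun_smul :: 'k \<Rightarrow> ('a \<Rightarrow> 'k) \<Rightarrow> _" by (rule vector_space_fun_smul)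
  show ?thesis
  proof
    show "F.subspace (topspace sdual)"
      unfolding F.subspace_def topspace_strong_dual
    proof (intro conjI ballI allI)
      show "0 \<in> dual" using zero_in_dual by (simp add: zero_fun_def)
      show "\<phi> + \<psi> \<in> dual" if "\<phi> \<in> dual" "\<psi> \<in> dual" for \<phi> \<psi>
        using that unfolding continuous_dual_iff
        by (auto simp: algebra_simps plus_fun_def intro: continuous_map_add)
      show "fun_smul c \<phi> \<in> dual" if "\<phi> \<in> dual" for c \<phi>
      proof -
        have "continuous_map euclidean euclidean (\<lambda>y. c * y)"
          by (simp add: continuous_map_iff_continuous2 continuous_intros)
        from continuous_map_compose[OF dual_continuous[OF that] this]
        show ?thesis
          using that unfolding continuous_dual_iff fun_smul_def by (auto simp: algebra_simps comp_def)
      qed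
    qed
    show "\<exists>p. continuous_seminorm fun_smul sdual p \<and> (\<forall>v\<in>topspace sdual. p (v - u) < 1 \<longrightarrow> v \<in> U)"
      if U: "openin sdual U" "u \<in> U" for U u
    proof -
      obtain F \<epsilon> where F: "finite F" "F \<subseteq> {B. bounded_in smul (weak_topology smul X) B}" "\<epsilon> > 0"
        "{v \<in> dual. \<forall>w\<in>\<Union>F. norm (v w - u w) < \<epsilon>} \<subseteq> U" and UD: "U \<subseteq> dual"
        using U unfolding strong_dual_def openin_uniform_convergence_topology by meson
      have r: "1 / \<epsilon> > 0" using F(3) by simp
      have "v \<in> U" if v: "v \<in> dual" "1 / \<epsilon> * sup_seminorm F (v - u) < 1" for v
      proof -
        have "v - u \<in> dual"
          using v(1) subsetD[OF UD U(2)] unfolding continuous_dual_iff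
          by (auto simp: algebra_simps fun_diff_def intro!: continuous_map_diff)
        then have "norm (v w - u w) \<le> sup_seminorm F (v - u)" if "w \<in> \<Union>F" for w
          using sup_seminorm_upper[OF F(1,2) r _ that, of "v - u"] by simp
        moreover have "sup_seminorm F (v - u) < \<epsilon>" using v(2) F(3) by (simp add: field_simps)
        ultimately have "\<forall>w\<in>\<Union>F. norm (v w - u w) < \<epsilon>" by (meson le_less_trans)
        then show ?thesis using F(4) v(1) by blast
      qed
      then show ?thesis using sup_seminorm[OF F(1,2) r] unfolding topspace_strong_dual by blast
    qed
    show "u = 0" if u: "u \<in> topspace sdual" "\<And>p. continuous_seminorm fun_smul sdual p \<Longrightarrow> p u = 0" for u
    proof
      fix v
      obtain p where "continuous_seminorm fun_smul sdual p" "\<And>\<phi>. \<phi> \<in> dual \<Longrightarrow> norm (\<phi> v) \<le> p \<phi>"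
        using evaluation_seminorm[of v] by blast
      with u show "u v = 0 v" unfolding topspace_strong_dual by force
    qed
  qed
qed

sublocale D: seminorm_topology fun_smul sdual
  by (rule strong_dual_seminorm_topology)

section \<open>Strong limits and density tested at points\<close>

lemma strong_limit_pointwise:
  assumes F: "\<And>n. F n \<in> dual" and lim: "limitin sdual F l sequentially"
  shows "(\<lambda>n. F n v) \<longlonglongrightarrow> l v"
proof -
  obtain p where p: "continuous_seminorm fun_smul sdual p" "\<And>\<phi>. \<phi> \<in> dual \<Longrightarrow> norm (\<phi> v) \<le> p \<phi>"
    using evaluation_seminorm[of v] by blast
  have F': "F n \<in> topspace sdual" for n using F by (simp add: topspace_strong_dual)
  have l: "l \<in> topspace sdual" and lim': "(\<lambda>n. p (F n - l)) \<longlonglongrightarrow> 0"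
    using lim p(1) unfolding D.limitin_cs[OF F'] by auto
  have "norm (F n v - l v) \<le> p (F n - l)" for n
    using p(2)[of "F n - l"] D.carrier_diff[OF F' l] by (simp add: topspace_strong_dual)
  then have "(\<lambda>n. F n v - l v) \<longlonglongrightarrow> 0"
    by (intro Lim_null_comparison[OF always_eventually lim']) simp
  then show ?thesis by (simp add: LIM_zero_iff)
qed

lemma fun_sum_apply: "(\<Sum>i\<in>A. fun_smul (c i) (F i)) v = (\<Sum>i\<in>A. c i * F i v)"
  by (induction A rule: infinite_finite_induct) (auto simp: fun_smul_def)

lemma dual_vanishing_on_dense:
  assumes x: "has_dense_span smul X x" and \<phi>: "\<phi> \<in> dual" and 0: "\<And>n. \<phi> (x n) = 0"
  shows "\<phi> v = 0"
proof (rule ccontr)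
  assume "\<phi> v \<noteq> 0"
  let ?U = "{w \<in> topspace X. \<phi> w \<in> - {0}}"
  have U: "openin X ?U"
    by (intro openin_continuous_map_preimage[OF dual_continuous[OF \<phi>]])
      (simp add: open_Compl[OF closed_singleton])
  have vU: "v \<in> ?U" and v: "v \<in> X closure_of (span (range x))"
    using \<open>\<phi> v \<noteq> 0\<close> x unfolding has_dense_span_def by (auto simp: topspace_UNIV)
  obtain w where w: "w \<in> span (range x)" "w \<in> ?U"
    by (rule closure_of_meets[OF v U vU])
  obtain c N where "w = (\<Sum>n<N. smul (c n) (x n))" by (rule span_range_finite_sum[OF w(1)])
  then show False using w(2) 0 by (simp add: dual_sum[OF \<phi>] dual_scale[OF \<phi>])
qed

text \<open>Otherwise Hahn-Banach gives a functional nonzero at \<open>v\<close>, which strong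
  density approximates at \<open>v\<close> by combinations of the \<open>f n\<close>, all of them
  vanishing there.\<close>

lemma separated_by_dense:
  assumes f: "has_dense_span fun_smul sdual f" and 0: "\<And>n. f n v = 0"
  shows "v = 0"
proof (rule ccontr)
  assume "v \<noteq> 0"
  then obtain \<phi> where \<phi>: "\<phi> \<in> dual" "\<phi> v \<noteq> 0" by (rule dual_separates_points)
  obtain p where p: "continuous_seminorm fun_smul sdual p" "\<And>\<phi>. \<phi> \<in> dual \<Longrightarrow> norm (\<phi> v) \<le> p \<phi>"
    using evaluation_seminorm[of v] by blast
  let ?U = "{\<psi> \<in> topspace sdual. p (\<psi> - \<phi>) < norm (\<phi> v)}"
  have "\<phi> \<in> topspace sdual" using \<phi> by (simp add: topspace_strong_dual)
  then have U: "openin sdual ?U" "\<phi> \<in> ?U" and cl: "\<phi> \<in> sdual closure_of (D.span (range f))"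
    using D.cs_open[OF p(1)] D.cs_zero[OF p(1)] \<phi>(2) f unfolding has_dense_span_def by auto
  obtain \<psi> where \<psi>: "\<psi> \<in> D.span (range f)" "\<psi> \<in> ?U"
    by (rule closure_of_meets[OF cl U])
  obtain c N where "\<psi> = (\<Sum>n<N. fun_smul (c n) (f n))" by (rule D.span_range_finite_sum[OF \<psi>(1)])
  then have "\<psi> v = 0" using 0 by (simp add: fun_sum_apply)
  moreover have "norm ((\<psi> - \<phi>) v) \<le> p (\<psi> - \<phi>)"
    using p(2) D.carrier_diff[of \<psi> \<phi>] \<psi>(2) \<open>\<phi> \<in> topspace sdual\<close> unfolding topspace_strong_dual by blast
  ultimately show False using \<psi>(2) by simp
qed

text \<open>The weak* closed convex hull of the null sequence \<open>2\<^sup>-\<^sup>k f\<^sub>k\<close> is contained in the continuous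
  image \<open>{\<Sum> a\<^sub>k f\<^sub>k | |a\<^sub>k| \<le> 2\<^sup>-\<^sup>k}\<close> of a product of compact discs.\<close>
lemma mackey_equicontinuous:
  assumes f: "ell1_sequence fun_smul sdual f" and X: "X = mackey_topology smul X"
  shows "uniformly_equicontinuous X (range (\<lambda>k. fun_smul ((1/2) ^ k) (f k)))"
proof -
  have fD: "f k \<in> dual" for k using D.ell1_carrier[OF f] by (simp add: topspace_strong_dual)
  define Q where "Q = {a :: nat \<Rightarrow> 'k. \<forall>k. norm (a k) \<le> (1/2) ^ k}"
  have geo: "summable (\<lambda>k. (1/2 :: real) ^ k)" by (rule summable_geometric) simp
  have "\<exists>l. limitin sdual (\<lambda>N. \<Sum>k<N. fun_smul (a k) (f k)) l sequentially" if "a \<in> Q" for a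
  proof -
    have "summable (\<lambda>k. norm (a k))"
      by (rule summable_comparison_test'[OF geo, of 0]) (use that in \<open>simp add: Q_def\<close>)
    then show ?thesis using f unfolding ell1_sequence_def by blast
  qed
  \<comment> \<open>Members of \<open>Q\<close> are absolutely summable, so the ell1-property
    supplies the limits.\<close>
  then obtain \<Phi> where \<Phi>: "\<And>a. a \<in> Q \<Longrightarrow> limitin sdual (\<lambda>N. \<Sum>k<N. fun_smul (a k) (f k)) (\<Phi> a) sequentially"
    by metis
  have \<Phi>D: "\<Phi> a \<in> dual" if "a \<in> Q" for a
    using limitin_topspace[OF \<Phi>[OF that]] by (simp add: topspace_strong_dual)
  have \<Phi>v: "(\<lambda>k. a k * f k v) sums \<Phi> a v" if "a \<in> Q" for a v
  proof -
    have "(\<Sum>k<N. fun_smul (a k) (f k)) \<in> dual" for N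
      using D.carrier_sum[OF D.carrier_scale[OF D.ell1_carrier[OF f]]] by (simp add: topspace_strong_dual)
    from strong_limit_pointwise[OF this \<Phi>[OF that]] show ?thesis
      unfolding sums_def fun_sum_apply .
  qed
  have cont: "continuous_on Q (\<lambda>a. \<Phi> a v)" for v
  proof -
    obtain p where p: "continuous_seminorm fun_smul sdual p" "\<And>\<phi>. \<phi> \<in> dual \<Longrightarrow> norm (\<phi> v) \<le> p \<phi>"
      using evaluation_seminorm[of v] by blast
    obtain C where C: "C > 0" "\<And>k. p (f k) \<le> C" using D.ell1_bounded[OF f p(1)] by blast
    have le: "norm (a k * f k v) \<le> (1/2) ^ k * C" if "a \<in> Q" for a k
      unfolding norm_mult using that p(2)[OF fD, of k] C(2)[of k] by (intro mult_mono) (auto simp: Q_def)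
    \<comment> \<open>The M-test applies uniformly on \<open>Q\<close>, since one strong seminorm
      bounds all \<open>f k v\<close> by \<open>C\<close>.\<close>
    have ul: "uniform_limit Q (\<lambda>N a. \<Sum>k<N. a k * f k v) (\<lambda>a. \<Sum>k. a k * f k v) sequentially"
      by (rule Weierstrass_m_test[OF le summable_mult2[OF geo]])
    have "continuous_on Q (\<lambda>a. \<Sum>k<N. a k * f k v)" for N
      by (intro continuous_on_sum continuous_on_mult_right
          continuous_on_subset[OF continuous_on_product_coordinates subset_UNIV])
    then have "continuous_on Q (\<lambda>a. \<Sum>k. a k * f k v)"
      by (intro uniform_limit_theorem[OF always_eventually ul] allI) simp_all
    then show ?thesis
      by (rule continuous_on_eq) (simp add: sums_unique[OF \<Phi>v])
  qed
  define K where "K = \<Phi> ` Q"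
  \<comment> \<open>A product of compact discs, by Tychonoff; the topology is that of coordinatewise
    convergence, for which \<open>cont\<close> holds.\<close>
  have "compact Q"
  proof -
    have "compactin (product_topology (\<lambda>k. euclidean) UNIV) (PiE UNIV (\<lambda>k. cball (0::'k) ((1/2) ^ k)))"
      unfolding compactin_PiE by (simp add: compact_scalar_cball)
    moreover have "PiE UNIV (\<lambda>k. cball (0::'k) ((1/2) ^ k)) = Q" by (auto simp: Q_def PiE_def)
    ultimately show ?thesis by (simp add: euclidean_product_topology)
  qed
  have "continuous_map (top_of_set Q) (weak_star_topology smul X) \<Phi>"
    unfolding weak_star_topology_def initial_topology_def
  proof (rule continuous_on_generated_topo)
    let ?S = "{{\<phi> \<in> dual. e \<phi> \<in> U} |e U. e \<in> range (\<lambda>x f. f x) \<and> open U}"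
    fix U assume "U \<in> {{\<phi> \<in> dual. e \<phi> \<in> U} |e U. e \<in> range (\<lambda>x (f::'a \<Rightarrow> 'k). f x) \<and> open U}"
    then obtain v G where U: "U = {\<phi> \<in> dual. \<phi> v \<in> G}" "open G" by auto
    have "openin (top_of_set Q) (Q \<inter> (\<lambda>a. \<Phi> a v) -` G)"
      by (rule continuous_openin_preimage_gen[OF cont U(2)])
    moreover have "Q \<inter> (\<lambda>a. \<Phi> a v) -` G = \<Phi> -` U \<inter> topspace (top_of_set Q)"
      using \<Phi>D U by auto
    ultimately show "openin (top_of_set Q) (\<Phi> -` U \<inter> topspace (top_of_set Q))" by simp
  next
    have "{\<phi> \<in> dual. (\<lambda>f. f (0::'a)) \<phi> \<in> (UNIV::'k set)} \<in>
        {{\<phi> \<in> dual. e \<phi> \<in> U} |e U. e \<in> range (\<lambda>x (f::'a \<Rightarrow> 'k). f x) \<and> open U}"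
      using open_UNIV by blast
    then show "\<Phi> ` topspace (top_of_set Q) \<subseteq>
        \<Union> {{\<phi> \<in> dual. e \<phi> \<in> U} |e U. e \<in> range (\<lambda>x (f::'a \<Rightarrow> 'k). f x) \<and> open U}"
      using \<Phi>D by (intro image_subsetI UnionI) auto
  qed
  moreover have "compactin (top_of_set Q) Q"
    using \<open>compact Q\<close> by (simp add: compactin_subtopology)
  ultimately have K: "compactin (weak_star_topology smul X) K"
    unfolding K_def by (rule image_compactin[rotated])
  have "convex_over fun_smul K"
    unfolding convex_over_def K_def
  proof safe
    fix a b :: "nat \<Rightarrow> 'k" and u :: real assume ab: "a \<in> Q" "b \<in> Q" and u: "u \<in> {0..1}"
    define d where "d k = of_real (1 - u) * a k + of_real u * b k" for k
    have "norm (d k) \<le> (1/2) ^ k" for k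
    proof -
      have "norm (d k) \<le> norm (of_real (1 - u) :: 'k) * norm (a k) + norm (of_real u :: 'k) * norm (b k)"
        unfolding d_def by (rule norm_triangle_le) (simp only: norm_mult order_refl)
      also have "\<dots> \<le> (1 - u) * (1/2) ^ k + u * (1/2) ^ k"
        unfolding norm_of_real using u ab by (intro add_mono mult_mono) (auto simp: Q_def)
      finally show ?thesis by (simp add: algebra_simps)
    qed
    then have d: "d \<in> Q" by (simp add: Q_def)
    have "fun_smul (of_real (1 - u)) (\<Phi> a) + fun_smul (of_real u) (\<Phi> b) = \<Phi> d"
    proof
      fix v
      have "(\<lambda>k. of_real (1 - u) * (a k * f k v) + of_real u * (b k * f k v)) sums
          (of_real (1 - u) * \<Phi> a v + of_real u * \<Phi> b v)"
        by (intro sums_add sums_mult \<Phi>v ab)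
      moreover have "(\<lambda>k. of_real (1 - u) * (a k * f k v) + of_real u * (b k * f k v)) = (\<lambda>k. d k * f k v)"
        by (rule ext) (simp add: d_def algebra_simps)
      ultimately show "(fun_smul (of_real (1 - u)) (\<Phi> a) + fun_smul (of_real u) (\<Phi> b)) v = \<Phi> d v"
        using \<Phi>v[OF d, of v] by (simp add: fun_smul_def sums_unique2)
    qed
    then show "fun_smul (of_real (1 - u)) (\<Phi> a) + fun_smul (of_real u) (\<Phi> b) \<in> \<Phi> ` Q"
      using d by auto
  qed
  with K have Kin: "K \<in> {K. compactin (weak_star_topology smul X) K \<and> convex_over fun_smul K}" by blast
  \<comment> \<open>A uniform bound strictly below 1 leaves room for perturbation and makes
    \<open>U\<close> open; the polar of \<open>K\<close> itself need not be open.\<close>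
  define U where "U = {x. \<exists>r<1. \<forall>\<phi>\<in>K. norm (\<phi> x) \<le> r}"
  have "openin (mackey_topology smul X) U"
    unfolding mackey_topology_def openin_uniform_convergence_topology
  proof (intro conjI ballI)
    fix x assume "x \<in> U"
    then obtain r where r: "r < 1" "\<And>\<phi>. \<phi> \<in> K \<Longrightarrow> norm (\<phi> x) \<le> r" by (auto simp: U_def)
    have "{v \<in> UNIV. \<forall>\<phi>\<in>\<Union>{K}. norm (\<phi> v - \<phi> x) < (1 - r) / 2} \<subseteq> U"
    proof
      fix v assume v: "v \<in> {v \<in> UNIV. \<forall>\<phi>\<in>\<Union>{K}. norm (\<phi> v - \<phi> x) < (1 - r) / 2}"
      have "norm (\<phi> v) \<le> (1 + r) / 2" if "\<phi> \<in> K" for \<phi>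
        using v that r(2)[OF that] norm_triangle_ineq[of "\<phi> v - \<phi> x" "\<phi> x"] by force
      moreover have "(1 + r) / 2 < 1" using r by simp
      ultimately show "v \<in> U" unfolding U_def by blast
    qed
    moreover have "(1 - r) / 2 > 0" using r by simp
    ultimately show "\<exists>\<F> \<epsilon>. finite \<F> \<and> \<F> \<subseteq> {K. compactin (weak_star_topology smul X) K \<and> convex_over fun_smul K} \<and>
        \<epsilon> > 0 \<and> {v \<in> UNIV. \<forall>\<phi>\<in>\<Union>\<F>. norm (\<phi> v - \<phi> x) < \<epsilon>} \<subseteq> U"
      using Kin by (intro exI[of _ "{K}"] exI[of _ "(1 - r) / 2"]) auto
  qed simp
  moreover have "0 \<in> U"
    unfolding U_def K_def using dual_zero[OF \<Phi>D] by (intro CollectI exI[of _ 0]) auto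
  moreover have "norm (fun_smul ((1/2) ^ k) (f k) x) \<le> 1" if "x \<in> U" for x k
  proof -
    \<comment> \<open>Concentrated at \<open>k\<close> with its largest permitted entry, so that
      \<open>\<Phi> a\<close> is \<open>(1/2) ^ k\<close> times \<open>f k\<close>.\<close>
    define a where "a j = (if j = k then (1/2) ^ k else (0::'k))" for j
    have a: "a \<in> Q" by (auto simp: Q_def a_def norm_power norm_divide)
    have "(\<lambda>j. a j * f j x) = (\<lambda>j. if j = k then a j * f j x else 0)"
      by (auto simp: a_def)
    then have "(\<lambda>j. a j * f j x) sums (a k * f k x)"
      using sums_single[of k "\<lambda>j. a j * f j x"] by (simp only:)
    then have "\<Phi> a x = (1/2) ^ k * f k x"
      using \<Phi>v[OF a, of x] by (metis (full_types) a_def sums_unique2)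
    moreover have "\<exists>r<1. norm (\<Phi> a x) \<le> r" using that a unfolding U_def K_def by blast
    ultimately show ?thesis by (auto simp: fun_smul_def)
  qed
  ultimately show ?thesis unfolding uniformly_equicontinuous_def X[symmetric] by blast
qed

end

section \<open>Weighted series and transfer of hypercyclicity\<close>

text \<open>Forgets the combinations behind \<open>e\<close>: coefficients dominated by
  \<open>s\<close> can be summed, with a seminorm bound linear in the domination constant. Summation
  is thus continuous for the weighted sup norm.\<close>

locale weighted_series = seminorm_topology smul Z
  for smul :: "'k::real_or_complex \<Rightarrow> 'v::ab_group_add \<Rightarrow> 'v" and Z :: "'v topology" +
  fixes e :: "nat \<Rightarrow> 'v" and s :: "nat \<Rightarrow> real"
  assumes e_carrier: "e n \<in> S"
    and s_pos: "s n > 0"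
    and series_converges: "(\<And>n. norm (a n) \<le> M * s n) \<Longrightarrow>
      \<exists>l. limitin Z (\<lambda>N. \<Sum>n<N. smul (a n) (e n)) l sequentially"
    and series_bounded: "cs p \<Longrightarrow> \<exists>C. \<forall>a M l. (\<forall>n. norm (a n) \<le> M * s n) \<longrightarrow>
      limitin Z (\<lambda>N. \<Sum>n<N. smul (a n) (e n)) l sequentially \<longrightarrow> p l \<le> C * M"
begin

definition admissible :: "(nat \<Rightarrow> 'k) \<Rightarrow> bool" where
  "admissible a \<longleftrightarrow> (\<exists>M. \<forall>n. norm (a n) \<le> M * s n)"

definition series :: "(nat \<Rightarrow> 'k) \<Rightarrow> 'v" where
  "series a = (SOME l. limitin Z (\<lambda>N. \<Sum>n<N. smul (a n) (e n)) l sequentially)"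

lemma admissibleI: "(\<And>n. norm (a n) \<le> M * s n) \<Longrightarrow> admissible a"
  unfolding admissible_def by blast

lemma partial_sum_carrier: "(\<Sum>n<N. smul (a n) (e n)) \<in> S"
  by (intro carrier_sum carrier_scale e_carrier)

lemma series_limit:
  "admissible a \<Longrightarrow> limitin Z (\<lambda>N. \<Sum>n<N. smul (a n) (e n)) (series a) sequentially"
  unfolding admissible_def series_def by (blast intro: someI_ex[OF series_converges])

lemma series_carrier: "admissible a \<Longrightarrow> series a \<in> S"
  using series_limit by (rule limitin_topspace)

lemma series_eqI:
  "admissible a \<Longrightarrow> limitin Z (\<lambda>N. \<Sum>n<N. smul (a n) (e n)) l sequentially \<Longrightarrow> series a = l"
  using limit_unique[OF partial_sum_carrier series_limit] by blast

lemma series_bound: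
  assumes "cs p"
  obtains C where "C \<ge> 0" "\<And>a M. (\<And>n. norm (a n) \<le> M * s n) \<Longrightarrow> p (series a) \<le> C * M"
proof -
  obtain C where C: "\<And>a M l. (\<forall>n. norm (a n) \<le> M * s n) \<Longrightarrow>
      limitin Z (\<lambda>N. \<Sum>n<N. smul (a n) (e n)) l sequentially \<Longrightarrow> p l \<le> C * M"
    using series_bounded[OF assms] by blast
  have "p (series a) \<le> \<bar>C\<bar> * M" if a: "\<And>n. norm (a n) \<le> M * s n" for a M
  proof -
    have "p (series a) \<le> C * M" by (rule C[OF allI[OF a] series_limit[OF admissibleI[OF a]]])
    moreover have "M \<ge> 0"
      using order_trans[OF norm_ge_zero a[of 0]] s_pos[of 0] by (simp add: zero_le_mult_iff)
    then have "C * M \<le> \<bar>C\<bar> * M" by (intro mult_right_mono) auto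
    ultimately show ?thesis by linarith
  qed
  then show thesis using that[of "\<bar>C\<bar>"] by auto
qed

lemma admissible_add: "admissible a \<Longrightarrow> admissible b \<Longrightarrow> admissible (\<lambda>n. a n + b n)"
proof -
  assume "admissible a" "admissible b"
  then obtain M M' where *: "\<And>n. norm (a n) \<le> M * s n" "\<And>n. norm (b n) \<le> M' * s n"
    unfolding admissible_def by blast
  show ?thesis
  proof (rule admissibleI)
    show "norm (a n + b n) \<le> (M + M') * s n" for n
      using norm_triangle_ineq[of "a n" "b n"] *[of n] by (simp add: distrib_right)
  qed
qed

lemma admissible_scale: "admissible a \<Longrightarrow> admissible (\<lambda>n. c * a n)"
proof -
  assume "admissible a"
  then obtain M where *: "\<And>n. norm (a n) \<le> M * s n" unfolding admissible_def by blast
  show ?thesis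
    by (rule admissibleI[of _ "norm c * M"]) (simp add: norm_mult mult.assoc mult_left_mono *)
qed

lemma limitin_combine:
  assumes "\<And>n. y n \<in> S" "\<And>n. z n \<in> S"
    and "limitin Z y l sequentially" "limitin Z z l' sequentially"
  shows "limitin Z (\<lambda>n. y n + smul c (z n)) (l + smul c l') sequentially"
proof -
  have l: "l \<in> S" "l' \<in> S" by (rule limitin_topspace, fact)+
  have yz: "y n + smul c (z n) \<in> S" for n by (intro carrier_add carrier_scale assms)
  show ?thesis
    unfolding limitin_cs[OF yz]
  proof (intro conjI allI impI carrier_add carrier_scale l)
    fix p assume p: "cs p"
    have lim: "(\<lambda>n. p (y n - l)) \<longlonglongrightarrow> 0" "(\<lambda>n. p (z n - l')) \<longlonglongrightarrow> 0"
      using assms(3,4) p unfolding limitin_cs[OF assms(1)] limitin_cs[OF assms(2)] by auto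
    have "p ((y n + smul c (z n)) - (l + smul c l')) \<le> p (y n - l) + norm c * p (z n - l')" for n
    proof -
      have "(y n + smul c (z n)) - (l + smul c l') = (y n - l) + smul c (z n - l')"
        by (simp add: scale_right_diff_distrib algebra_simps)
      also have "p \<dots> \<le> p (y n - l) + p (smul c (z n - l'))"
        by (intro cs_add p carrier_diff carrier_scale assms l)
      also have "\<dots> \<le> p (y n - l) + norm c * p (z n - l')"
        by (intro add_left_mono cs_scale p carrier_diff assms l)
      finally show ?thesis .
    qed
    then have le: "\<forall>n. p ((y n + smul c (z n)) - (l + smul c l')) \<le> p (y n - l) + norm c * p (z n - l')"
      by blast
    have "(\<lambda>n. p (y n - l) + norm c * p (z n - l')) \<longlonglongrightarrow> 0 + norm c * 0"
      by (intro tendsto_intros lim)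
    then have to0: "(\<lambda>n. p (y n - l) + norm c * p (z n - l')) \<longlonglongrightarrow> 0" by simp
    have ge: "\<forall>n. 0 \<le> p ((y n + smul c (z n)) - (l + smul c l'))"
      by (intro allI cs_nonneg p carrier_diff yz carrier_add carrier_scale l)
    show "(\<lambda>n. p ((y n + smul c (z n)) - (l + smul c l'))) \<longlonglongrightarrow> 0"
      by (rule tendsto_sandwich[OF always_eventually[OF ge] always_eventually[OF le] tendsto_const to0])
  qed
qed

lemma series_combine:
  assumes "admissible a" "admissible b"
  shows "series (\<lambda>n. a n + c * b n) = series a + smul c (series b)"
proof (rule series_eqI)
  show "admissible (\<lambda>n. a n + c * b n)" by (intro admissible_add admissible_scale assms)
  have "(\<Sum>n<N. smul (a n + c * b n) (e n)) = (\<Sum>n<N. smul (a n) (e n)) + smul c (\<Sum>n<N. smul (b n) (e n))" for N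
    by (simp add: scale_left_distrib sum.distrib scale_sum_right)
  then show "limitin Z (\<lambda>N. \<Sum>n<N. smul (a n + c * b n) (e n)) (series a + smul c (series b)) sequentially"
    using limitin_combine[OF partial_sum_carrier partial_sum_carrier series_limit[OF assms(1)]
        series_limit[OF assms(2)], of c] by simp
qed

lemma series_add: "admissible a \<Longrightarrow> admissible b \<Longrightarrow> series (\<lambda>n. a n + b n) = series a + series b"
  using series_combine[of a b 1] by simp

lemma series_diff: "admissible a \<Longrightarrow> admissible b \<Longrightarrow> series (\<lambda>n. a n - b n) = series a - series b"
  using series_combine[of a b "- 1"] by simp

lemma series_zero: "series (\<lambda>n. 0) = 0"
proof (rule series_eqI)
  show "admissible (\<lambda>n. 0)" by (rule admissibleI[of _ 0]) simp
qed (simp add: limitin_const_iff carrier_zero)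

lemma series_scale: "admissible a \<Longrightarrow> series (\<lambda>n. c * a n) = smul c (series a)"
  using series_combine[of "\<lambda>n. 0" a c] admissibleI[of "\<lambda>n. 0" 0] series_zero by simp

lemma finite_support_admissible:
  assumes "\<And>n. n \<ge> N \<Longrightarrow> a n = 0"
  shows "admissible a"
proof (rule admissibleI)
  fix n
  show "norm (a n) \<le> (\<Sum>m<N. norm (a m) / s m) * s n"
  proof (cases "n < N")
    case True
    have "norm (a n) / s n \<le> (\<Sum>m<N. norm (a m) / s m)"
      using True by (intro member_le_sum) (auto simp: less_imp_le[OF s_pos])
    then show ?thesis using s_pos[of n] by (simp add: divide_le_eq)
  next
    case False
    then show ?thesis using assms[of n] s_pos by (auto intro!: mult_nonneg_nonneg sum_nonneg simp: less_imp_le)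
  qed
qed

lemma series_finite:
  assumes "\<And>n. n \<ge> N \<Longrightarrow> a n = 0"
  shows "series a = (\<Sum>n<N. smul (a n) (e n))"
proof (rule series_eqI[OF finite_support_admissible[OF assms]])
  have "(\<Sum>n<N'. smul (a n) (e n)) = (\<Sum>n<N. smul (a n) (e n))" if "N' \<ge> N" for N'
    using that assms by (intro sum.mono_neutral_right) auto
  then have "\<forall>\<^sub>F N' in sequentially. (\<Sum>n<N. smul (a n) (e n)) = (\<Sum>n<N'. smul (a n) (e n))"
    unfolding eventually_sequentially by metis
  then show "limitin Z (\<lambda>N'. \<Sum>n<N'. smul (a n) (e n)) (\<Sum>n<N. smul (a n) (e n)) sequentially"
    by (rule limitin_transform_eventually) (simp add: limitin_const_iff partial_sum_carrier)
qed simp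

section \<open>Series indexed by the integers\<close>

definition iseries :: "(int \<Rightarrow> 'k) \<Rightarrow> 'v" where
  "iseries a = series (a \<circ> int_decode)"

definition iadmissible :: "(int \<Rightarrow> 'k) \<Rightarrow> bool" where
  "iadmissible a \<longleftrightarrow> (\<exists>M. \<forall>i. norm (a i) \<le> M * s (int_encode i))"

lemma iadmissible_iff: "iadmissible a \<longleftrightarrow> admissible (a \<circ> int_decode)"
  unfolding iadmissible_def admissible_def
  by (metis comp_apply int_decode_inverse int_encode_inverse)

lemma iseries_bound:
  assumes "cs p"
  obtains C where "C \<ge> 0"
    "\<And>a M. (\<And>i. norm (a i) \<le> M * s (int_encode i)) \<Longrightarrow> p (iseries a) \<le> C * M"
proof -
  obtain C where C: "C \<ge> 0" "\<And>a M. (\<And>n. norm (a n) \<le> M * s n) \<Longrightarrow> p (series a) \<le> C * M"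
    using series_bound[OF assms] by blast
  have "p (iseries a) \<le> C * M" if "\<And>i. norm (a i) \<le> M * s (int_encode i)" for a M
    unfolding iseries_def using that[of "int_decode _"] by (intro C(2)) simp
  then show thesis using that C(1) by blast
qed

text \<open>Summation is continuous for the weighted sup norm, so it suffices to approximate
  finitely supported targets with entries in a dense set of scalars, whose sums are dense along with
  the span of \<open>e\<close>.\<close>

lemma hypercyclic_transfer:
  assumes dense: "S \<subseteq> Z closure_of (span (range e))"
    and B: "\<And>a. iadmissible a \<Longrightarrow> iadmissible (B a) \<and> T (iseries a) = iseries (B a)"
    and z: "iadmissible z"
    and D: "0 \<in> D" "\<And>c \<epsilon>. \<epsilon> > 0 \<Longrightarrow> \<exists>d\<in>D. norm (c - d) < \<epsilon>"
    and hits: "\<And>u \<epsilon>. finite {i. u i \<noteq> 0} \<Longrightarrow> range u \<subseteq> D \<Longrightarrow> \<epsilon> > 0 \<Longrightarrow>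
       \<exists>n. \<forall>i. norm ((B ^^ n) z i - u i) \<le> \<epsilon> * s (int_encode i)"
  shows "hypercyclic Z T"
  unfolding hypercyclic_def
proof (intro bexI[of _ "iseries z"] antisym closure_of_subset_topspace subsetI)
  have adm: "iadmissible ((B ^^ n) z)" for n by (induction n) (use z B in auto)
  have orbit: "(T ^^ n) (iseries z) = iseries ((B ^^ n) z)" for n
    by (induction n) (use adm B in auto)
  show "iseries z \<in> S" unfolding iseries_def using z by (intro series_carrier) (simp add: iadmissible_iff)
  fix v assume v: "v \<in> S"
  show "v \<in> Z closure_of range (\<lambda>n. (T ^^ n) (iseries z))"
    unfolding in_closure_of
  proof (intro conjI allI impI v)
    fix U assume U: "v \<in> U \<and> openin Z U"
    obtain p where p: "cs p" and pU: "\<forall>w\<in>S. p (w - v) < 1 \<longrightarrow> w \<in> U"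
      using seminorm_base[OF conjunct2[OF U] conjunct1[OF U]] by metis
    obtain C where C: "C \<ge> 0"
      "\<And>a M. (\<And>i. norm (a i) \<le> M * s (int_encode i)) \<Longrightarrow> p (iseries a) \<le> C * M"
      using iseries_bound[OF p] by blast
    \<comment> \<open>Three errors of at most 1/4 add up: orbit to \<open>series d\<close>,
      \<open>series d\<close> to \<open>h\<close>, and \<open>h\<close> to \<open>v\<close>. The
      summand 1 keeps the quotient defined for \<open>C = 0\<close>.\<close>
    define \<epsilon> where "\<epsilon> = 1 / (4 * (C + 1))"
    have \<epsilon>: "\<epsilon> > 0" "C * \<epsilon> \<le> 1 / 4" using C(1) by (auto simp: \<epsilon>_def field_simps)
    have O: "openin Z {w \<in> S. p (w - v) < 1 / 4}" "v \<in> {w \<in> S. p (w - v) < 1 / 4}"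
      using cs_open[OF p v, of "1/4"] v cs_zero[OF p] by auto
    obtain h where h: "h \<in> span (range e)" "h \<in> {w \<in> S. p (w - v) < 1 / 4}"
      by (rule closure_of_meets[OF subsetD[OF dense v] O])
    obtain c N where c: "h = (\<Sum>n<N. smul (c n) (e n))" "\<And>n. n \<ge> N \<Longrightarrow> c n = 0"
      using span_range_finite_sum[OF h(1)] by metis
    \<comment> \<open>Beyond \<open>N\<close> the rounded coefficients are exactly 0, which keeps
      the target finitely supported; here \<open>0 \<in> D\<close> enters.\<close>
    have "\<exists>d\<in>D. norm (c n - d) \<le> \<epsilon> * s n \<and> (n \<ge> N \<longrightarrow> d = 0)" for n
    proof (cases "n \<ge> N")
      case True
      then show ?thesis using c(2)[OF True] D(1) \<epsilon>(1) s_pos[of n] by (intro bexI[of _ 0]) auto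
    next
      case False
      then show ?thesis using D(2)[of "\<epsilon> * s n" "c n"] \<epsilon>(1) s_pos[of n] by (auto intro: less_imp_le)
    qed
    then obtain d where d: "\<And>n. d n \<in> D" "\<And>n. norm (c n - d n) \<le> \<epsilon> * s n" "\<And>n. n \<ge> N \<Longrightarrow> d n = 0"
      by metis
    define u where "u = d \<circ> int_encode"
    have fin: "finite {i. u i \<noteq> 0}"
    proof (rule finite_subset)
      show "{i. u i \<noteq> 0} \<subseteq> int_decode ` {..<N}"
      proof
        fix i assume "i \<in> {i. u i \<noteq> 0}"
        then have "\<not> int_encode i \<ge> N" using d(3) by (auto simp: u_def)
        then show "i \<in> int_decode ` {..<N}" by (intro image_eqI[of _ _ "int_encode i"]) auto
      qed
    qed simp
    obtain n where n: "\<And>i. norm ((B ^^ n) z i - u i) \<le> \<epsilon> * s (int_encode i)"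
      using hits[OF fin _ \<epsilon>(1)] d(1) by (force simp: u_def)
    let ?w = "iseries ((B ^^ n) z)"
    have u_dec: "u \<circ> int_decode = d" by (simp add: u_def fun_eq_iff)
    have adms: "admissible ((B ^^ n) z \<circ> int_decode)" "admissible d" "admissible c"
      using adm[of n] d(3) c(2) by (auto simp: iadmissible_iff intro: finite_support_admissible)
    have "p (?w - series d) \<le> C * \<epsilon>"
    proof -
      have "?w - series d = iseries (\<lambda>i. (B ^^ n) z i - u i)"
        unfolding iseries_def using series_diff[OF adms(1,2)] u_dec by (simp add: comp_def fun_eq_iff)
      then show ?thesis using C(2)[OF n] by simp
    qed
    moreover have "p (series d - h) \<le> C * \<epsilon>"
    proof -
      have "h = series c" unfolding c(1) by (rule series_finite[symmetric]) (rule c(2))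
      then have "series d - h = iseries (\<lambda>i. d (int_encode i) - c (int_encode i))"
        unfolding iseries_def using series_diff[OF adms(2,3)] by (simp add: comp_def)
      then show ?thesis using d(2)[of "int_encode _"] by (simp add: C(2) norm_minus_commute)
    qed
    moreover have S: "?w \<in> S" "series d \<in> S" "h \<in> S"
      unfolding iseries_def using adms h(2) by (auto intro: series_carrier)
    ultimately have "p (?w - v) < 1"
      using cs_triangle[OF p S(1) S(2) v] cs_triangle[OF p S(2) S(3) v] h(2) \<epsilon>(2) by simp
    then have "?w \<in> U" using pU S(1) by blast
    then show "\<exists>y. y \<in> range (\<lambda>n. (T ^^ n) (iseries z)) \<and> y \<in> U"
      using orbit[of n] by (metis rangeI)
  qed
qed

end

context seminorm_topology
begin

lemma weighted_series_of_combinations: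
  assumes x: "ell1_sequence smul Z x"
    and e: "\<And>n. e n = (\<Sum>k<K n. smul (\<alpha> n k) (x k))"
    and s: "\<And>n. s n > 0" "\<And>n. s n * (\<Sum>k<K n. norm (\<alpha> n k)) \<le> (1/2) ^ n"
  shows "weighted_series smul Z e s"
proof unfold_locales
  show eS: "e n \<in> S" for n
    unfolding e by (intro carrier_sum carrier_scale ell1_carrier[OF x])
  show "s n > 0" for n by (rule s)
  have M0: "M \<ge> 0" if "\<And>n. norm (a n) \<le> M * s n" for a :: "nat \<Rightarrow> 'k" and M
    using order_trans[OF norm_ge_zero that[of 0]] s(1)[of 0] by (simp add: zero_le_mult_iff)
  show "\<exists>l. limitin Z (\<lambda>N. \<Sum>n<N. smul (a n) (e n)) l sequentially"
    if a: "\<And>n. norm (a n) \<le> M * s n" for a M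
    using series_of_combinations[OF x e s(2) a M0[OF a]] by metis
  show "\<exists>C. \<forall>a M l. (\<forall>n. norm (a n) \<le> M * s n) \<longrightarrow>
      limitin Z (\<lambda>N. \<Sum>n<N. smul (a n) (e n)) l sequentially \<longrightarrow> p l \<le> C * M" if p: "cs p" for p
  proof -
    obtain C where C: "C > 0" "\<And>k. p (x k) \<le> C" using ell1_bounded[OF x p] by metis
    have "p l \<le> (C * 2) * M" if a: "\<And>n. norm (a n) \<le> M * s n"
      and l: "limitin Z (\<lambda>N. \<Sum>n<N. smul (a n) (e n)) l sequentially" for a M l
    proof -
      have ES: "(\<Sum>n<N. smul (a n) (e n)) \<in> S" for N by (intro carrier_sum carrier_scale eS)
      obtain l' where l': "limitin Z (\<lambda>N. \<Sum>n<N. smul (a n) (e n)) l' sequentially"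
        "\<forall>p C. cs p \<longrightarrow> (\<forall>k. p (x k) \<le> C) \<longrightarrow> p l' \<le> C * (2 * M)"
        using series_of_combinations[OF x e s(2) a M0[OF a]] by metis
      have "l = l'" by (rule limit_unique[OF ES l l'(1)])
      then show ?thesis using l'(2)[rule_format, OF p C(2)] by simp
    qed
    then show ?thesis by blast
  qed
qed

end

section \<open>Biorthogonal sequences\<close>

context locally_convex_space
begin

definition biorthogonal :: "('a \<times> ('a \<Rightarrow> 'k)) list \<Rightarrow> bool" where
  "biorthogonal L \<longleftrightarrow> (\<forall>i<length L. snd (L ! i) \<in> dual \<and>
     (\<forall>j<length L. snd (L ! i) (fst (L ! j)) = (if i = j then 1 else 0)))"

text \<open>For biorthogonal \<open>L\<close> this is the projection onto the common kernel of the
  functionals along the span of the vectors; \<open>dual_residual\<close> is its transpose.\<close>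

definition residual :: "('a \<times> ('a \<Rightarrow> 'k)) list \<Rightarrow> 'a \<Rightarrow> 'a" where
  "residual L v = v - (\<Sum>i<length L. smul (snd (L ! i) v) (fst (L ! i)))"

definition dual_residual :: "('a \<times> ('a \<Rightarrow> 'k)) list \<Rightarrow> ('a \<Rightarrow> 'k) \<Rightarrow> 'a \<Rightarrow> 'k" where
  "dual_residual L \<phi> = \<phi> - (\<Sum>i<length L. fun_smul (\<phi> (fst (L ! i))) (snd (L ! i)))"

lemma dual_residual_apply:
  assumes "\<phi> \<in> dual"
  shows "dual_residual L \<phi> v = \<phi> (residual L v)"
  by (simp add: dual_residual_def residual_def dual_diff[OF assms] dual_sum[OF assms]
      dual_scale[OF assms] fun_sum_apply mult.commute)

lemma dual_residual_in_dual:
  assumes "\<phi> \<in> dual" "biorthogonal L"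
  shows "dual_residual L \<phi> \<in> dual"
proof -
  have "dual_residual L \<phi> \<in> topspace sdual"
    unfolding dual_residual_def using assms
    by (intro D.carrier_diff D.carrier_sum D.carrier_scale) (auto simp: topspace_strong_dual biorthogonal_def)
  then show ?thesis by (simp add: topspace_strong_dual)
qed

lemma functional_residual:
  assumes L: "biorthogonal L" and i: "i < length L"
  shows "snd (L ! i) (residual L v) = 0"
proof -
  have g: "snd (L ! i) \<in> dual" using L i by (simp add: biorthogonal_def)
  have "snd (L ! i) (residual L v) = snd (L ! i) v - (\<Sum>j<length L. snd (L ! j) v * (if i = j then 1 else 0))"
    unfolding residual_def using L i
    by (simp add: dual_diff[OF g] dual_sum[OF g] dual_scale[OF g] biorthogonal_def)
  then show ?thesis using i by (simp add: if_distrib cong: if_cong)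
qed

lemma residual_basis:
  assumes L: "biorthogonal L" and j: "j < length L"
  shows "residual L (fst (L ! j)) = 0"
proof -
  have "(\<Sum>i<length L. smul (snd (L ! i) (fst (L ! j))) (fst (L ! i))) =
      (\<Sum>i<length L. if i = j then fst (L ! i) else 0)"
    using L j by (intro sum.cong) (auto simp: biorthogonal_def)
  then show ?thesis using j by (simp add: residual_def)
qed

text \<open>One step of Markushevich's biorthogonalisation; it absorbs both \<open>a\<close> and \<open>\<psi>\<close> into the spans.\<close>
lemma biorthogonal_extend:
  assumes L: "biorthogonal L" and \<psi>: "\<psi> \<in> dual" and nz: "\<psi> (residual L a) \<noteq> 0"
  defines "L' \<equiv> L @ [(residual L a, fun_smul (1 / \<psi> (residual L a)) (dual_residual L \<psi>))]"
  shows "biorthogonal L'"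
    and "a \<in> span (fst ` set L')" and "\<psi> \<in> D.span (snd ` set L')"
proof -
  let ?c = "\<psi> (residual L a)" and ?n = "length L"
  let ?e = "residual L a" and ?g = "fun_smul (1 / \<psi> (residual L a)) (dual_residual L \<psi>)"
  have g: "?g \<in> dual"
    using D.carrier_scale[of "dual_residual L \<psi>"] dual_residual_in_dual[OF \<psi> L]
    by (simp add: topspace_strong_dual)
  have rr: "residual L ?e = ?e"
    using functional_residual[OF L] by (simp add: residual_def[of L "residual L a"])
  have "?g ?e = 1" using nz by (simp add: fun_smul_def dual_residual_apply[OF \<psi>] rr)
  moreover have "?g (fst (L ! j)) = 0" if "j < ?n" for j
    using residual_basis[OF L that] by (simp add: fun_smul_def dual_residual_apply[OF \<psi>] dual_zero[OF \<psi>])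
  moreover have "snd (L ! i) ?e = 0" if "i < ?n" for i by (rule functional_residual[OF L that])
  ultimately show "biorthogonal L'"
    using L g unfolding biorthogonal_def L'_def by (auto simp: nth_append less_Suc_eq)
  have sub: "fst (L ! i) \<in> fst ` set L'" "snd (L ! i) \<in> snd ` set L'" if "i < ?n" for i
    using that by (auto simp: L'_def)
  have e_span: "?e \<in> span (fst ` set L')" by (intro span_base) (simp add: L'_def)
  have "?e + (\<Sum>i<?n. smul (snd (L ! i) a) (fst (L ! i))) \<in> span (fst ` set L')"
    using sub by (intro span_add[OF e_span] span_sum span_scale span_base) auto
  then show "a \<in> span (fst ` set L')" by (simp add: residual_def)
  have g_span: "?g \<in> D.span (snd ` set L')" by (intro D.span_base) (simp add: L'_def)
  have "fun_smul ?c ?g + (\<Sum>i<?n. fun_smul (\<psi> (fst (L ! i))) (snd (L ! i))) \<in> D.span (snd ` set L')"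
    using sub by (intro D.span_add[OF D.span_scale[OF g_span]] D.span_sum D.span_scale D.span_base) auto
  moreover have "fun_smul ?c ?g = dual_residual L \<psi>" using nz by (simp add: fun_smul_def fun_eq_iff)
  ultimately show "\<psi> \<in> D.span (snd ` set L')" by (simp add: dual_residual_def)
qed

text \<open>Otherwise the projection would vanish on a dense subspace, hence everywhere, and
  finitely many vectors would span the space. Its continuity is tested through functionals, as
  \<open>dual_residual L \<phi>\<close> lies in the dual.\<close>

lemma residual_nonzero:
  assumes inf: "infinite_dimensional smul" and x: "has_dense_span smul X x" and L: "biorthogonal L"
  shows "\<exists>j. residual L (x j) \<noteq> 0"
proof (rule ccontr)
  assume "\<nexists>j. residual L (x j) \<noteq> 0"
  then have 0: "\<And>j. residual L (x j) = 0" by blast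
  have "residual L v = 0" for v
  proof (rule ccontr)
    assume "residual L v \<noteq> 0"
    then obtain \<phi> where \<phi>: "\<phi> \<in> dual" "\<phi> (residual L v) \<noteq> 0" by (rule dual_separates_points)
    have "dual_residual L \<phi> v = 0"
      by (rule dual_vanishing_on_dense[OF x dual_residual_in_dual[OF \<phi>(1) L]])
        (simp add: dual_residual_apply[OF \<phi>(1)] 0 dual_zero[OF \<phi>(1)])
    then show False using \<phi> by (simp add: dual_residual_apply)
  qed
  then have "v = (\<Sum>i<length L. smul (snd (L ! i) v) (fst (L ! i)))" for v
    by (simp add: residual_def)
  moreover have "(\<Sum>i<length L. smul (snd (L ! i) v) (fst (L ! i))) \<in> span (fst ` set L)" for v
    by (intro span_sum span_scale span_base) simp
  ultimately have "span (fst ` set L) = UNIV" by (metis UNIV_eq_I)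
  then show False using inf unfolding infinite_dimensional_def by blast
qed

text \<open>The flag \<open>b\<close> selects whether \<open>x k\<close> or \<open>f k\<close> is
  absorbed. The list must grow even when the selected element already lies in the span; infinite
  dimension then provides a substitute pair.\<close>

lemma biorthogonal_step:
  assumes inf: "infinite_dimensional smul" and x: "has_dense_span smul X x"
    and f: "has_dense_span fun_smul sdual f" and fD: "\<And>k. f k \<in> dual"
    and L: "biorthogonal L" "\<forall>p\<in>set L. fst p \<in> span (range x)" "\<forall>p\<in>set L. snd p \<in> D.span (range f)"
  shows "\<exists>p. biorthogonal (L @ [p]) \<and> fst p \<in> span (range x) \<and> snd p \<in> D.span (range f) \<and>
    (if b then x k \<in> span (fst ` set (L @ [p])) else f k \<in> D.span (snd ` set (L @ [p])))"
proof -
  have sep: "\<exists>l. f l v \<noteq> 0" if "v \<noteq> 0" for v using separated_by_dense[OF f] that by blast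
  \<comment> \<open>A vanishing residual says that the selected element is already in the span; only
    then may the chosen index differ from \<open>k\<close>.\<close>
  obtain j l where jl: "f l (residual L (x j)) \<noteq> 0"
    "b \<Longrightarrow> residual L (x k) = 0 \<or> j = k" "\<not> b \<Longrightarrow> dual_residual L (f k) = 0 \<or> l = k"
  proof (cases b)
    case True
    show thesis
    proof (cases "residual L (x k) = 0")
      case z: True
      obtain j where "residual L (x j) \<noteq> 0" using residual_nonzero[OF inf x L(1)] by blast
      then show thesis using sep[of "residual L (x j)"] that z True by blast
    next
      case False
      then show thesis using sep[of "residual L (x k)"] that[of _ k] True by blast
    qed
  next
    case False
    show thesis
    proof (cases "dual_residual L (f k) = 0")
      case z: True
      obtain j where "residual L (x j) \<noteq> 0" using residual_nonzero[OF inf x L(1)] by blast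
      then show thesis using sep[of "residual L (x j)"] that z False by blast
    next
      case nz: False
      have "\<exists>j. dual_residual L (f k) (x j) \<noteq> 0"
      proof (rule ccontr)
        assume "\<nexists>j. dual_residual L (f k) (x j) \<noteq> 0"
        then have "dual_residual L (f k) v = 0" for v
          using dual_vanishing_on_dense[OF x dual_residual_in_dual[OF fD L(1)]] by blast
        then show False using nz by (simp add: fun_eq_iff)
      qed
      then show thesis using that False by (metis dual_residual_apply[OF fD])
    qed
  qed
  let ?p = "(residual L (x j), fun_smul (1 / f l (residual L (x j))) (dual_residual L (f l)))"
  note ext = biorthogonal_extend[OF L(1) fD jl(1)]
  have Li: "fst (L ! i) \<in> span (range x)" "snd (L ! i) \<in> D.span (range f)" if "i < length L" for i
    using L(2,3) that by auto
  have "residual L (x j) \<in> span (range x)"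
    unfolding residual_def using Li by (intro span_diff span_sum span_scale) (auto intro: span_base)
  moreover have "fun_smul (1 / f l (residual L (x j))) (dual_residual L (f l)) \<in> D.span (range f)"
    unfolding dual_residual_def using Li by (intro D.span_scale D.span_diff D.span_sum) (auto intro: D.span_base)
  moreover have "x k \<in> span (fst ` set (L @ [?p]))" if b
  proof (cases "j = k")
    case False
    then have "x k = (\<Sum>i<length L. smul (snd (L ! i) (x k)) (fst (L ! i)))"
      using jl(2)[OF that] by (simp add: residual_def)
    also have "\<dots> \<in> span (fst ` set (L @ [?p]))"
      by (intro span_sum span_scale span_base) simp
    finally show ?thesis .
  qed (use ext(2) in simp)
  moreover have "f k \<in> D.span (snd ` set (L @ [?p]))" if "\<not> b"
  proof (cases "l = k")
    case False
    then have "f k = (\<Sum>i<length L. fun_smul (f k (fst (L ! i))) (snd (L ! i)))"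
      using jl(3)[OF that] by (simp add: dual_residual_def)
    also have "\<dots> \<in> D.span (snd ` set (L @ [?p]))"
      by (intro D.span_sum D.span_scale D.span_base) simp
    finally show ?thesis .
  qed (use ext(3) in simp)
  ultimately show ?thesis using ext(1) by (intro exI[of _ ?p]) simp
qed

text \<open>Lists grow by appending, so their entries stabilise to sequences. Even stages absorb the
  \<open>x k\<close> and odd stages the \<open>f k\<close>, which passes density on to both new
  spans.\<close>

lemma biorthogonal_sequences:
  fixes x :: "nat \<Rightarrow> 'a" and f :: "nat \<Rightarrow> 'a \<Rightarrow> 'k"
  assumes inf: "infinite_dimensional smul" and x: "has_dense_span smul X x"
    and f: "has_dense_span fun_smul sdual f" and fD: "\<And>k. f k \<in> dual"
  shows "\<exists>(e :: nat \<Rightarrow> 'a) (g :: nat \<Rightarrow> 'a \<Rightarrow> 'k).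
    (\<forall>n. e n \<in> span (range x)) \<and> (\<forall>n. g n \<in> D.span (range f)) \<and>
    (\<forall>m n. g m (e n) = (if m = n then 1 else 0)) \<and> (\<forall>n. g n \<in> dual) \<and>
    (\<forall>k. x k \<in> span (range e)) \<and> (\<forall>k. f k \<in> D.span (range g))"
proof -
  define P where "P n L \<longleftrightarrow> length L = n \<and> biorthogonal L \<and> (\<forall>p\<in>set L. fst p \<in> span (range x)) \<and>
      (\<forall>p\<in>set L. snd p \<in> D.span (range f))" for n :: nat and L
  define Q where "Q n L L' \<longleftrightarrow> (\<exists>p. L' = L @ [p]) \<and>
      (if even n then x (n div 2) \<in> span (fst ` set L') else f (n div 2) \<in> D.span (snd ` set L'))"
    for n :: nat and L L'
  have "\<exists>F. \<forall>n. P n (F n) \<and> Q n (F n) (F (Suc n))"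
  proof (rule dependent_nat_choice)
    show "\<exists>L. P 0 L" by (intro exI[of _ "[]"]) (simp add: P_def biorthogonal_def)
    show "\<exists>L'. P (Suc n) L' \<and> Q n L L'" if "P n L" for L n
    proof -
      have L: "biorthogonal L" "\<forall>p\<in>set L. fst p \<in> span (range x)" "\<forall>p\<in>set L. snd p \<in> D.span (range f)"
        using that by (auto simp: P_def)
      obtain p where "biorthogonal (L @ [p])" "fst p \<in> span (range x)" "snd p \<in> D.span (range f)"
        "if even n then x (n div 2) \<in> span (fst ` set (L @ [p])) else f (n div 2) \<in> D.span (snd ` set (L @ [p]))"
        using biorthogonal_step[OF inf x f fD L, of "even n" "n div 2"] by blast
      then show ?thesis
        using that unfolding P_def Q_def by (intro exI[of _ "L @ [p]"]) auto
    qed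
  qed
  then obtain F where P: "\<And>n. P n (F n)" and Q: "\<And>n. Q n (F n) (F (Suc n))" by blast
  have len: "length (F n) = n" for n using P[of n] by (simp add: P_def)
  define e g where "e n = fst (F (Suc n) ! n)" and "g n = snd (F (Suc n) ! n)" for n
  have nth: "F m ! n = F (Suc n) ! n" if "n < m" for m n
    using that
  proof (induction m)
    case (Suc m)
    obtain p where "F (Suc m) = F m @ [p]" using Q[of m] by (auto simp: Q_def)
    then show ?case using Suc len[of m] by (cases "n < m") (auto simp: nth_append less_Suc_eq)
  qed simp
  have set_eq: "fst ` set (F m) \<subseteq> range e" "snd ` set (F m) \<subseteq> range g" for m
  proof -
    have "\<exists>n. p = (e n, g n)" if "p \<in> set (F m)" for p
    proof -
      obtain n where "n < m" "p = F m ! n" using \<open>p \<in> set (F m)\<close> len[of m] by (auto simp: in_set_conv_nth)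
      then show ?thesis using nth[of n m] by (auto simp: e_def g_def)
    qed
    then show "fst ` set (F m) \<subseteq> range e" "snd ` set (F m) \<subseteq> range g" by force+
  qed
  have mem: "F (Suc n) ! n \<in> set (F (Suc n))" for n using len[of "Suc n"] by simp
  show ?thesis
  proof (intro exI[of _ e] exI[of _ g] conjI allI)
    show "e n \<in> span (range x)" "g n \<in> D.span (range f)" for n
      using P[of "Suc n"] mem[of n] by (auto simp: P_def e_def g_def)
    show "g m (e n) = (if m = n then 1 else 0)" for m n
    proof -
      let ?N = "Suc (max m n)"
      have mn: "m < ?N" "n < ?N" by auto
      have "biorthogonal (F ?N)" using P by (simp add: P_def)
      then have "snd (F ?N ! m) (fst (F ?N ! n)) = (if m = n then 1 else 0)"
        using mn unfolding biorthogonal_def len by blast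
      then show ?thesis by (simp only: e_def g_def nth[OF mn(1)] nth[OF mn(2)])
    qed
    show "g n \<in> dual" for n
      using P[of "Suc n"] len[of "Suc n"] unfolding P_def biorthogonal_def g_def by auto
    show "x k \<in> span (range e)" for k
      using Q[of "2 * k"] span_mono[OF set_eq(1)] by (auto simp: Q_def)
    show "f k \<in> D.span (range g)" for k
      using Q[of "2 * k + 1"] D.span_mono[OF set_eq(2)] by (auto simp: Q_def)
  qed
qed

end

section \<open>The dual hypercyclic operator\<close>

text \<open>Finitely supported families are decoded from association lists, of which there are
  countably many.\<close>

lemma countable_finite_support:
  assumes "countable D"
  shows "countable {u :: 'i::countable \<Rightarrow> 'd::zero. finite {i. u i \<noteq> 0} \<and> range u \<subseteq> D}"
proof (rule countable_subset)
  let ?F = "\<lambda>xs :: ('i \<times> 'd) list. \<lambda>i. case map_of xs i of None \<Rightarrow> 0 | Some d \<Rightarrow> d"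
  show "countable (?F ` lists (UNIV \<times> D))"
    using assms by (intro countable_image countable_lists countable_SIGMA) auto
  show "{u. finite {i. u i \<noteq> 0} \<and> range u \<subseteq> D} \<subseteq> ?F ` lists (UNIV \<times> D)"
  proof
    fix u assume "u \<in> {u :: 'i \<Rightarrow> 'd. finite {i. u i \<noteq> 0} \<and> range u \<subseteq> D}"
    then have u: "finite {i. u i \<noteq> 0}" "\<And>i. u i \<in> D" by auto
    obtain ks where ks: "set ks = {i. u i \<noteq> 0}" using finite_list[OF u(1)] by blast
    have "u i = ?F (map (\<lambda>i. (i, u i)) ks) i" for i
      unfolding map_of_map_restrict ks by (simp add: restrict_map_def)
    then have "u = ?F (map (\<lambda>i. (i, u i)) ks)" by (rule ext)
    moreover have "map (\<lambda>i. (i, u i)) ks \<in> lists (UNIV \<times> D)"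
      using u(2) by (simp add: lists_eq_set image_subset_iff)
    ultimately show "u \<in> ?F ` lists (UNIV \<times> D)" by (rule image_eqI)
  qed
qed

context locally_convex_space
begin

text \<open>By linearity, boundedness near 0 in each seminorm suffices; the neighbourhood may depend
  on \<open>p\<close>.\<close>

lemma continuous_linear_of_seminorm_bounds:
  assumes add: "\<And>x y. N (x + y) = N x + N y" and hom: "\<And>c x. N (smul c x) = smul c (N x)"
    and bound: "\<And>p. cs p \<Longrightarrow> \<exists>C U. openin X U \<and> 0 \<in> U \<and> (\<forall>v\<in>U. p (N v) \<le> C)"
  shows "continuous_map X X N"
  unfolding continuous_map_def
proof (intro conjI allI impI)
  fix G assume G: "openin X G"
  show "openin X {v \<in> S. N v \<in> G}"
  proof (subst openin_subopen, intro ballI)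
    fix v0 assume "v0 \<in> {v \<in> S. N v \<in> G}"
    then have "N v0 \<in> G" by simp
    then obtain p where p: "cs p" "\<forall>w\<in>S. p (w - N v0) < 1 \<longrightarrow> w \<in> G"
      using seminorm_base[OF G] by metis
    obtain C U where U: "openin X U" "0 \<in> U" "\<forall>v\<in>U. p (N v) \<le> C" using bound[OF p(1)] by blast
    \<comment> \<open>Stretching \<open>v - v0\<close> by a factor above
      \<open>\<bar>C\<bar>\<close> before applying the bound brings \<open>p\<close> below
      1.\<close>
    define r where "r = \<bar>C\<bar> + 1"
    let ?O = "{v. smul (of_real r) (v + (- v0)) \<in> U}"
    have diff: "N (v - v0) = N v - N v0" for v using add[of "v - v0" v0] by simp
    have "?O \<subseteq> {v \<in> S. N v \<in> G}"
    proof
      fix v assume "v \<in> ?O"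
      then have "p (N (smul (of_real r) (v - v0))) \<le> C" using U(3) by simp
      moreover have "r > 0" by (simp add: r_def)
      moreover have "N v - N v0 = smul (of_real (1 / r)) (N (smul (of_real r) (v - v0)))"
        using \<open>r > 0\<close> by (simp add: hom diff)
      then have "p (N v - N v0) \<le> norm (of_real (1 / r) :: 'k) * p (N (smul (of_real r) (v - v0)))"
        using cs_scale[OF p(1)] by (simp only: topspace_UNIV UNIV_I)
      then have "p (N v - N v0) \<le> (1 / r) * p (N (smul (of_real r) (v - v0)))"
        using \<open>r > 0\<close> unfolding norm_of_real by simp
      ultimately have "p (N v - N v0) \<le> (1 / r) * C"
        by (meson divide_nonneg_pos less_eq_real_def mult_left_mono order_trans zero_le_one)
      also have "\<dots> < 1" by (simp add: r_def divide_less_eq_1_pos)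
      finally show "v \<in> {v \<in> S. N v \<in> G}" using p(2) by (simp add: topspace_UNIV)
    qed
    moreover have "openin X ?O" by (rule openin_affine_vimage[OF U(1)])
    moreover have "v0 \<in> ?O" using U(2) by simp
    ultimately show "\<exists>T. openin X T \<and> v0 \<in> T \<and> T \<subseteq> {v \<in> S. N v \<in> G}" by blast
  qed
qed (simp add: topspace_UNIV)

lemma functional_bounded_on_sequence:
  assumes "\<phi> \<in> dual" "ell1_sequence smul X x"
  obtains C where "C \<ge> 0" "\<And>k. norm (\<phi> (x k)) \<le> C"
proof -
  have "limitin X x 0 sequentially" using assms(2) unfolding ell1_sequence_def by blast
  then have "convergent (\<lambda>k. \<phi> (x k))" using dual_tendsto[OF assms(1)] by (auto simp: convergent_def)
  then have "Bseq (\<lambda>k. \<phi> (x k))" by (rule convergent_imp_Bseq)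
  then obtain C where "C > 0" "\<forall>k. norm (\<phi> (x k)) \<le> C" by (auto elim: BseqE)
  then show thesis using that[of C] by auto
qed

text \<open>Merges the last two alternatives: damping by \<open>(1/2) ^ k\<close> preserves
  equicontinuity, and the damped family is the one that the Mackey case controls.\<close>

lemma equicontinuous_or_weak:
  assumes f: "ell1_sequence fun_smul sdual f"
    and cases: "X = weak_topology smul X \<or> X = mackey_topology smul X \<or> uniformly_equicontinuous X (range f)"
  shows "X = weak_topology smul X \<or> uniformly_equicontinuous X (range (\<lambda>k. fun_smul ((1/2) ^ k) (f k)))"
proof -
  have "uniformly_equicontinuous X (range (\<lambda>k. fun_smul ((1/2) ^ k) (f k)))"
    if eq: "uniformly_equicontinuous X (range f)"
  proof -
    obtain U where U: "openin X U" "0 \<in> U" "\<And>x k. x \<in> U \<Longrightarrow> norm (f k x) \<le> 1"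
      using eq unfolding uniformly_equicontinuous_def by blast
    have "norm (fun_smul ((1/2) ^ k) (f k) x) \<le> 1" if "x \<in> U" for x k
    proof -
      have "(1/2 :: real) ^ k \<le> 1" by (simp add: power_le_one)
      then have "(1/2) ^ k * norm (f k x) \<le> 1 * 1" using U(3)[OF that, of k] by (intro mult_mono) auto
      then show ?thesis by (simp add: fun_smul_def norm_mult norm_power norm_divide)
    qed
    then show ?thesis using U(1,2) unfolding uniformly_equicontinuous_def by blast
  qed
  then show ?thesis using cases mackey_equicontinuous[OF f] by blast
qed

end

text \<open>\<open>g_bounded\<close> and \<open>e_summable\<close> make the coefficients of the
  perturbation and of its transpose admissible. Summability, as opposed to boundedness, permits the
  rearrangement in \<open>functional_pert\<close>.\<close>

locale dual_weighted_series = locally_convex_space smul X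
  for smul :: "'k::real_or_complex \<Rightarrow> 'a::ab_group_add \<Rightarrow> 'a" and X :: "'a topology" +
  fixes e :: "nat \<Rightarrow> 'a" and g :: "nat \<Rightarrow> 'a \<Rightarrow> 'k" and s t :: "nat \<Rightarrow> real"
  assumes primal: "weighted_series smul X e s"
    and dual_series: "weighted_series fun_smul sdual g t"
    and g_dual: "g n \<in> dual"
    and biorth: "g m (e n) = (if m = n then 1 else 0)"
    and t_le_1: "t n \<le> 1"
    and g_bounded: "\<exists>C. \<forall>n. t n * norm (g n v) \<le> C"
    and e_summable: "\<phi> \<in> dual \<Longrightarrow> summable (\<lambda>n. s n * norm (\<phi> (e n)))"
begin

sublocale E: weighted_series smul X e s by (rule primal)
sublocale G: weighted_series fun_smul sdual g t by (rule dual_series)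

definition sZ :: "int \<Rightarrow> real" where "sZ i = s (int_encode i)"
definition tZ :: "int \<Rightarrow> real" where "tZ i = t (int_encode i)"

section \<open>The operator 1 + weighted shift and its transpose\<close>

definition weight :: "(int \<Rightarrow> 'k) \<Rightarrow> bool" where
  "weight w \<longleftrightarrow> (\<forall>i. norm (w i) \<le> sZ (i - 1) * tZ i)"

definition pert :: "(int \<Rightarrow> 'k) \<Rightarrow> 'a \<Rightarrow> 'a" where
  "pert w v = E.iseries (\<lambda>i. w (i + 1) * g (int_encode (i + 1)) v)"

definition shift_operator :: "(int \<Rightarrow> 'k) \<Rightarrow> 'a \<Rightarrow> 'a" where
  "shift_operator w v = v + pert w v"

lemma sZ_pos: "sZ i > 0" and tZ_pos: "tZ i > 0"
  by (simp_all add: sZ_def tZ_def E.s_pos G.s_pos)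

text \<open>Of the weight bound, \<open>tZ (i + 1)\<close> is spent on the coordinate of
  \<open>v\<close> and \<open>sZ i\<close> on admissibility. A constant \<open>C\<close> uniform in
  \<open>v\<close> will give continuity.\<close>

lemma pert_coefficient:
  assumes w: "weight w" and C: "\<And>n. t n * norm (g n v) \<le> C"
  shows "norm (w (i + 1) * g (int_encode (i + 1)) v) \<le> C * s (int_encode i)"
proof -
  have "norm (w (i + 1)) \<le> sZ i * tZ (i + 1)"
    using w[unfolded weight_def, rule_format, of "i + 1"] by simp
  then have "norm (w (i + 1)) * norm (g (int_encode (i + 1)) v)
      \<le> (sZ i * tZ (i + 1)) * norm (g (int_encode (i + 1)) v)"
    by (rule mult_right_mono) simp
  also have "\<dots> = sZ i * (t (int_encode (i + 1)) * norm (g (int_encode (i + 1)) v))"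
    by (simp add: tZ_def)
  also have "\<dots> \<le> sZ i * C" using sZ_pos[of i] by (intro mult_left_mono C) simp
  finally show ?thesis by (simp add: norm_mult sZ_def mult.commute)
qed

lemma pert_admissible:
  assumes w: "weight w"
  shows "E.iadmissible (\<lambda>i. w (i + 1) * g (int_encode (i + 1)) v)"
proof -
  obtain C where "\<And>n. t n * norm (g n v) \<le> C" using g_bounded[of v] by blast
  then show ?thesis unfolding E.iadmissible_def using pert_coefficient[OF w] by blast
qed

lemma pert_add: "weight w \<Longrightarrow> pert w (u + v) = pert w u + pert w v"
  using E.series_add[of "(\<lambda>i. w (i + 1) * g (int_encode (i + 1)) u) \<circ> int_decode"
      "(\<lambda>i. w (i + 1) * g (int_encode (i + 1)) v) \<circ> int_decode"]
    pert_admissible[of w]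
  unfolding pert_def E.iseries_def E.iadmissible_iff
  by (simp add: dual_add[OF g_dual] distrib_left comp_def)

lemma pert_scale: "weight w \<Longrightarrow> pert w (smul c v) = smul c (pert w v)"
  using E.series_scale[of "(\<lambda>i. w (i + 1) * g (int_encode (i + 1)) v) \<circ> int_decode" c]
    pert_admissible[of w]
  unfolding pert_def E.iseries_def E.iadmissible_iff
  by (simp add: dual_scale[OF g_dual] mult.left_commute comp_def)

text \<open>By biorthogonality the partial sums eventually have the constant coordinate
  \<open>a i\<close>, and the functional is continuous. Thus \<open>pert\<close> recovers the
  coefficients that it has to shift.\<close>

lemma coordinate_of_iseries:
  assumes "E.iadmissible a"
  shows "g (int_encode i) (E.iseries a) = a i"
proof -
  let ?a = "a \<circ> int_decode" and ?m = "int_encode i"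
  have "(\<lambda>N. g ?m (\<Sum>n<N. smul (?a n) (e n))) \<longlonglongrightarrow> g ?m (E.iseries a)"
    unfolding E.iseries_def
    by (rule dual_tendsto[OF g_dual E.series_limit[OF assms[unfolded E.iadmissible_iff]]])
  moreover have "g ?m (\<Sum>n<N. smul (?a n) (e n)) = a i" if "N > ?m" for N
  proof -
    have "g ?m (\<Sum>n<N. smul (?a n) (e n)) = (\<Sum>n<N. if n = ?m then ?a n else 0)"
      unfolding dual_sum[OF g_dual] dual_scale[OF g_dual] biorth by (rule sum.cong) auto
    then show ?thesis using that by simp
  qed
  then have "\<forall>\<^sub>F N in sequentially. g ?m (\<Sum>n<N. smul (?a n) (e n)) = a i"
    unfolding eventually_sequentially by (meson Suc_le_lessD)
  then have "(\<lambda>N. g ?m (\<Sum>n<N. smul (?a n) (e n))) \<longlonglongrightarrow> a i"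
    by (rule tendsto_eventually)
  ultimately show ?thesis by (rule LIMSEQ_unique)
qed

lemma coordinate_of_dual_iseries:
  assumes "G.iadmissible b"
  shows "G.iseries b (e (int_encode i)) = b i"
proof -
  let ?b = "b \<circ> int_decode" and ?m = "int_encode i"
  have PD: "(\<Sum>n<N. fun_smul (?b n) (g n)) \<in> dual" for N
    using G.partial_sum_carrier by (simp add: topspace_strong_dual)
  have "(\<lambda>N. (\<Sum>n<N. fun_smul (?b n) (g n)) (e ?m)) \<longlonglongrightarrow> G.iseries b (e ?m)"
    unfolding G.iseries_def
    by (rule strong_limit_pointwise[OF PD G.series_limit[OF assms[unfolded G.iadmissible_iff]]])
  moreover have "(\<Sum>n<N. fun_smul (?b n) (g n)) (e ?m) = b i" if "N > ?m" for N
  proof -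
    have "(\<Sum>n<N. fun_smul (?b n) (g n)) (e ?m) = (\<Sum>n<N. if n = ?m then ?b n else 0)"
      unfolding fun_sum_apply biorth by (rule sum.cong) auto
    then show ?thesis using that by simp
  qed
  then have "\<forall>\<^sub>F N in sequentially. (\<Sum>n<N. fun_smul (?b n) (g n)) (e ?m) = b i"
    unfolding eventually_sequentially by (meson Suc_le_lessD)
  then have "(\<lambda>N. (\<Sum>n<N. fun_smul (?b n) (g n)) (e ?m)) \<longlonglongrightarrow> b i"
    by (rule tendsto_eventually)
  ultimately show ?thesis by (rule LIMSEQ_unique)
qed

lemma bshift_admissible:
  assumes w: "weight w" and a: "E.iadmissible a"
  shows "E.iadmissible (bshift w a)" and "shift_operator w (E.iseries a) = E.iseries (bshift w a)"
proof -
  let ?c = "\<lambda>i. w (i + 1) * g (int_encode (i + 1)) (E.iseries a)"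
  have eq: "bshift w a = (\<lambda>i. a i + ?c i)"
    by (rule ext) (simp add: bshift_def coordinate_of_iseries[OF a])
  have adm: "E.admissible (a \<circ> int_decode)" "E.admissible (?c \<circ> int_decode)"
    using a pert_admissible[OF w, of "E.iseries a"] by (simp_all add: E.iadmissible_iff)
  show "E.iadmissible (bshift w a)"
    using E.admissible_add[OF adm] by (simp add: E.iadmissible_iff eq comp_def)
  show "shift_operator w (E.iseries a) = E.iseries (bshift w a)"
    using E.series_add[OF adm] by (simp add: shift_operator_def pert_def E.iseries_def eq comp_def)
qed

text \<open>Mirror image of \<open>pert_coefficient\<close>: now \<open>sZ (i - 1)\<close> is spent
  on the value of \<open>\<phi>\<close>, and \<open>tZ i\<close> remains.\<close>

lemma dual_coefficient:
  assumes w: "weight w" and \<phi>: "\<phi> \<in> dual"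
  shows "G.iadmissible (\<lambda>i. w i * \<phi> (e (int_encode (i - 1))))"
proof -
  obtain C where C: "\<And>n. s n * norm (\<phi> (e n)) \<le> C"
    using summable_imp_bounded[OF e_summable[OF \<phi>]] unfolding bounded_iff
    by (metis abs_le_D1 rangeI real_norm_def)
  have "norm (w i * \<phi> (e (int_encode (i - 1)))) \<le> C * t (int_encode i)" for i
  proof -
    have "norm (w i) * norm (\<phi> (e (int_encode (i - 1)))) \<le> (sZ (i - 1) * tZ i) * norm (\<phi> (e (int_encode (i - 1))))"
      using w unfolding weight_def by (intro mult_right_mono) auto
    also have "\<dots> = tZ i * (s (int_encode (i - 1)) * norm (\<phi> (e (int_encode (i - 1)))))"
      by (simp add: sZ_def)
    also have "\<dots> \<le> tZ i * C" using tZ_pos[of i] by (intro mult_left_mono C) simp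
    finally show ?thesis by (simp add: norm_mult tZ_def mult.commute)
  qed
  then show ?thesis unfolding G.iadmissible_def by blast
qed

text \<open>Both sides are the sum of \<open>w (i+1) * g\<^sub>i\<^sub>+\<^sub>1 v * \<phi> e\<^sub>i\<close> over the integers, enumerated
  differently.\<close>
lemma functional_pert:
  assumes w: "weight w" and \<phi>: "\<phi> \<in> dual"
  shows "\<phi> (pert w v) = G.iseries (\<lambda>i. w i * \<phi> (e (int_encode (i - 1)))) v"
proof -
  define h where "h i = w (i + 1) * g (int_encode (i + 1)) v * \<phi> (e (int_encode i))" for i
  obtain C where C: "\<And>n. t n * norm (g n v) \<le> C" using g_bounded[of v] by blast
  let ?c = "(\<lambda>i. w (i + 1) * g (int_encode (i + 1)) v) \<circ> int_decode"
  have "summable (\<lambda>n. norm (h (int_decode n)))"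
  proof (rule summable_comparison_test'[of _ 0])
    show "summable (\<lambda>n. C * (s n * norm (\<phi> (e n))))"
      by (intro summable_mult e_summable[OF \<phi>])
    show "norm (norm (h (int_decode n))) \<le> C * (s n * norm (\<phi> (e n)))" for n
    proof -
      have "norm (h (int_decode n)) \<le> (C * s n) * norm (\<phi> (e n))"
        using mult_right_mono[OF pert_coefficient[OF w C, of "int_decode n"], of "norm (\<phi> (e n))"]
        by (simp add: h_def norm_mult)
      then show ?thesis by (simp add: mult.assoc)
    qed
  qed
  moreover have "(\<lambda>n. h (int_decode n)) sums \<phi> (pert w v)"
  proof -
    have "(\<lambda>N. \<phi> (\<Sum>n<N. smul (?c n) (e n))) \<longlonglongrightarrow> \<phi> (pert w v)"
      unfolding pert_def E.iseries_def
      by (rule dual_tendsto[OF \<phi> E.series_limit[OF pert_admissible[OF w, unfolded E.iadmissible_iff]]])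
    then show ?thesis
      by (simp add: sums_def dual_sum[OF \<phi>] dual_scale[OF \<phi>] h_def)
  qed
  ultimately have "((\<lambda>n. h (int_decode n)) has_sum \<phi> (pert w v)) UNIV"
    by (rule norm_summable_imp_has_sum)
  then have hs: "(h has_sum \<phi> (pert w v)) UNIV"
    using has_sum_reindex_bij_betw[OF bij_int_decode, of h "\<phi> (pert w v)"] by simp
  \<comment> \<open>Term \<open>i\<close> of the dual series is \<open>h (i - 1)\<close>;
    unconditional summability carries the value over to this shifted enumeration.\<close>
  have "bij_betw (\<lambda>n. int_decode n - 1) UNIV UNIV"
    using bij_betw_trans[OF bij_int_decode, of "\<lambda>i. i - 1" UNIV]
    by (simp add: comp_def bij_betw_def inj_on_def surj_def)
  then have "((\<lambda>n. h (int_decode n - 1)) has_sum \<phi> (pert w v)) UNIV"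
    using has_sum_reindex_bij_betw[of "\<lambda>n. int_decode n - 1" UNIV UNIV h "\<phi> (pert w v)"] hs by simp
  then have 1: "(\<lambda>n. h (int_decode n - 1)) sums \<phi> (pert w v)"
    by (rule has_sum_imp_sums)
  let ?d = "(\<lambda>i. w i * \<phi> (e (int_encode (i - 1)))) \<circ> int_decode"
  have PD: "(\<Sum>n<N. fun_smul (?d n) (g n)) \<in> dual" for N
    using G.partial_sum_carrier by (simp add: topspace_strong_dual)
  have "(\<lambda>N. (\<Sum>n<N. fun_smul (?d n) (g n)) v) \<longlonglongrightarrow> G.iseries (\<lambda>i. w i * \<phi> (e (int_encode (i - 1)))) v"
    unfolding G.iseries_def
    by (rule strong_limit_pointwise[OF PD G.series_limit[OF dual_coefficient[OF w \<phi>, unfolded G.iadmissible_iff]]])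
  then have "(\<lambda>n. h (int_decode n - 1)) sums G.iseries (\<lambda>i. w i * \<phi> (e (int_encode (i - 1)))) v"
    unfolding sums_def fun_sum_apply by (simp add: h_def mult_ac)
  with 1 show ?thesis by (rule sums_unique2)
qed

lemma fshift_admissible:
  assumes w: "weight w" and b: "G.iadmissible b"
  shows "G.iadmissible (fshift w b)"
    and "dual_operator (shift_operator w) (G.iseries b) = G.iseries (fshift w b)"
proof -
  let ?\<phi> = "G.iseries b"
  have \<phi>: "?\<phi> \<in> dual"
    using b G.series_carrier by (simp add: G.iseries_def G.iadmissible_iff topspace_strong_dual)
  let ?d = "\<lambda>i. w i * ?\<phi> (e (int_encode (i - 1)))"
  have eq: "fshift w b = (\<lambda>i. b i + ?d i)"
    by (rule ext) (simp only: fshift_def coordinate_of_dual_iseries[OF b])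
  have adm: "G.admissible (b \<circ> int_decode)" "G.admissible (?d \<circ> int_decode)"
    using b dual_coefficient[OF w \<phi>] by (simp_all add: G.iadmissible_iff)
  show "G.iadmissible (fshift w b)"
    unfolding G.iadmissible_iff eq using G.admissible_add[OF adm] by (simp only: comp_def)
  have "G.iseries (fshift w b) = ?\<phi> + G.iseries ?d"
    using G.series_add[OF adm] unfolding G.iseries_def eq by (simp only: comp_def)
  then show "dual_operator (shift_operator w) ?\<phi> = G.iseries (fshift w b)"
    by (simp add: dual_operator_def shift_operator_def fun_eq_iff dual_add[OF \<phi>] functional_pert[OF w \<phi>])
qed

text \<open>In the weak case continuity is tested by functionals, and \<open>functional_pert\<close>
  keeps their compositions with \<open>pert\<close> in the dual. Otherwise the coordinates are
  bounded by \<open>1 / t n\<close> on a single neighbourhood, where every seminorm of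
  \<open>pert\<close> is then bounded.\<close>

lemma shift_operator_continuous:
  assumes w: "weight w"
    and X: "X = weak_topology smul X \<or> (\<exists>U. openin X U \<and> 0 \<in> U \<and> (\<forall>v\<in>U. \<forall>n. t n * norm (g n v) \<le> 1))"
  shows "shift_operator w \<in> continuous_operators smul X"
proof -
  have "continuous_map X X (pert w)"
    using X
  proof
    assume weak: "X = weak_topology smul X"
    have "continuous_map X (weak_topology smul X) (pert w)"
    proof (rule continuous_map_into_weak)
      fix \<phi> assume \<phi>: "\<phi> \<in> dual"
      have "G.iseries (\<lambda>i. w i * \<phi> (e (int_encode (i - 1)))) \<in> dual"
        using dual_coefficient[OF w \<phi>] G.series_carrier
        by (simp add: G.iseries_def G.iadmissible_iff topspace_strong_dual)
      then show "continuous_map X euclidean (\<lambda>v. \<phi> (pert w v))"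
        using dual_continuous unfolding functional_pert[OF w \<phi>] by blast
    qed
    then show ?thesis using weak by simp
  next
    assume "\<exists>U. openin X U \<and> 0 \<in> U \<and> (\<forall>v\<in>U. \<forall>n. t n * norm (g n v) \<le> 1)"
    then obtain U where U: "openin X U" "0 \<in> U" "\<And>v n. v \<in> U \<Longrightarrow> t n * norm (g n v) \<le> 1" by blast
    show ?thesis
    proof (rule continuous_linear_of_seminorm_bounds)
      fix p assume p: "cs p"
      obtain C where C: "\<And>a M. (\<And>i. norm (a i) \<le> M * s (int_encode i)) \<Longrightarrow> p (E.iseries a) \<le> C * M"
        using E.iseries_bound[OF p] by blast
      have "p (pert w v) \<le> C * 1" if "v \<in> U" for v
        unfolding pert_def by (rule C) (rule pert_coefficient[OF w U(3)[OF that]])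
      then show "\<exists>C U. openin X U \<and> 0 \<in> U \<and> (\<forall>v\<in>U. p (pert w v) \<le> C)" using U(1,2) by blast
    qed (simp_all add: pert_add[OF w] pert_scale[OF w])
  qed
  then have "continuous_map X (prod_topology X X) (\<lambda>v. (v, pert w v))"
    by (intro continuous_map_pairedI) auto
  from continuous_map_compose[OF this continuous_add]
  have "continuous_map X X (shift_operator w)" by (simp add: comp_def shift_operator_def[abs_def])
  moreover have "Vector_Spaces.linear smul smul (shift_operator w)"
    unfolding Vector_Spaces.linear_iff shift_operator_def
    using vector_space_axioms by (simp add: pert_add[OF w] pert_scale[OF w] scale_right_distrib algebra_simps)
  ultimately show ?thesis unfolding continuous_operators_def by blast
qed

lemma exists_dual_hypercyclic:
  assumes s_le_1: "\<And>n. s n \<le> 1"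
    and e: "S \<subseteq> X closure_of (span (range e))"
    and g: "dual \<subseteq> sdual closure_of (D.span (range g))"
    and X: "X = weak_topology smul X \<or> (\<exists>U. openin X U \<and> 0 \<in> U \<and> (\<forall>v\<in>U. \<forall>n. t n * norm (g n v) \<le> 1))"
  shows "\<exists>T. dual_hypercyclic smul X T"
proof -
  obtain R :: "'k set" where R: "countable R" "0 \<in> R" "\<And>z \<epsilon>. \<epsilon> > 0 \<Longrightarrow> \<exists>d\<in>R. norm (z - d) < \<epsilon>"
    using countable_dense_scalars by metis
  \<comment> \<open>Targets are paired with accuracies \<open>1 / Suc m\<close>, so that one
    enumeration has every finite target over \<open>R\<close> hit to any precision.\<close>
  define A where "A = {u :: int \<Rightarrow> 'k. finite {i. u i \<noteq> 0} \<and> range u \<subseteq> R} \<times> (UNIV :: nat set)"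
  have "countable A" unfolding A_def by (intro countable_SIGMA countable_finite_support R) auto
  moreover have "A \<noteq> {}"
  proof -
    have "(\<lambda>_. 0, 0) \<in> A" using R(2) by (auto simp: A_def)
    then show ?thesis by blast
  qed
  ultimately have A: "range (from_nat_into A) = A" by (intro range_from_nat_into)
  define u where "u k = fst (from_nat_into A k)" for k
  define \<epsilon> where "\<epsilon> k = 1 / real (Suc (snd (from_nat_into A k)))" for k
  have \<epsilon>_pos: "\<epsilon> k > 0" for k by (simp add: \<epsilon>_def)
  have uA: "from_nat_into A k \<in> A" for k using A by blast
  have ufin: "finite {i. u k i \<noteq> 0}" for k
    using uA[of k] unfolding A_def u_def by (cases "from_nat_into A k") auto
  have enum: "\<exists>k. u k = v \<and> \<epsilon> k \<le> \<eta>" if v: "finite {i. v i \<noteq> 0}" "range v \<subseteq> R" and "\<eta> > 0" for v \<eta>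
  proof -
    obtain m where m: "inverse (real (Suc m)) < \<eta>" using reals_Archimedean[OF \<open>\<eta> > 0\<close>] by blast
    have "(v, m) \<in> A" using v by (simp add: A_def)
    then obtain k where "from_nat_into A k = (v, m)" using A by (metis rangeE)
    then show ?thesis using m by (intro exI[of _ k]) (simp add: u_def \<epsilon>_def inverse_eq_divide)
  qed
  have sZ_le_1: "sZ i \<le> 1" and tZ_le_1: "tZ i \<le> 1" for i by (simp_all add: sZ_def tZ_def s_le_1 t_le_1)
  obtain w x y where w: "\<And>i. norm (w i) \<le> sZ (i - 1) * tZ i"
    and x: "\<And>i. norm (x i) \<le> sZ i" and y: "\<And>i. norm (y i) \<le> tZ i"
    and hx: "\<And>k. \<exists>n. \<forall>i. norm ((bshift w ^^ n) x i - u k i) \<le> \<epsilon> k * sZ i"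
    and hy: "\<And>k. \<exists>n. \<forall>i. norm ((fshift w ^^ n) y i - u k i) \<le> \<epsilon> k * tZ i"
    using simultaneous_universal_vectors[of sZ tZ u \<epsilon>, OF sZ_pos sZ_le_1 tZ_pos tZ_le_1 ufin \<epsilon>_pos]
    by blast
  have w': "weight w" using w by (simp add: weight_def)
  have "hypercyclic X (shift_operator w)"
  proof (rule E.hypercyclic_transfer[OF e _ _ R(2,3)])
    show "E.iadmissible a \<Longrightarrow> E.iadmissible (bshift w a) \<and> shift_operator w (E.iseries a) = E.iseries (bshift w a)" for a
      using bshift_admissible[OF w'] by blast
    show "E.iadmissible x" unfolding E.iadmissible_def using x by (intro exI[of _ 1]) (simp add: sZ_def)
    fix v :: "int \<Rightarrow> 'k" and \<eta> :: real assume v: "finite {i. v i \<noteq> 0}" "range v \<subseteq> R" "\<eta> > 0"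
    obtain k where k: "u k = v" "\<epsilon> k \<le> \<eta>" using enum[OF v] by blast
    obtain n where n: "\<And>i. norm ((bshift w ^^ n) x i - v i) \<le> \<epsilon> k * sZ i" using hx[of k] k(1) by blast
    have "norm ((bshift w ^^ n) x i - v i) \<le> \<eta> * s (int_encode i)" for i
      using order_trans[OF n[of i] mult_right_mono[OF k(2) less_imp_le[OF sZ_pos]]] by (simp add: sZ_def)
    then show "\<exists>n. \<forall>i. norm ((bshift w ^^ n) x i - v i) \<le> \<eta> * s (int_encode i)" by blast
  qed
  moreover have "hypercyclic sdual (dual_operator (shift_operator w))"
  proof (rule G.hypercyclic_transfer[OF _ _ _ R(2,3)])
    show "topspace sdual \<subseteq> sdual closure_of (D.span (range g))" using g by (simp add: topspace_strong_dual)
    show "G.iadmissible a \<Longrightarrow> G.iadmissible (fshift w a) \<and>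
        dual_operator (shift_operator w) (G.iseries a) = G.iseries (fshift w a)" for a
      using fshift_admissible[OF w'] by blast
    show "G.iadmissible y" unfolding G.iadmissible_def using y by (intro exI[of _ 1]) (simp add: tZ_def)
    fix v :: "int \<Rightarrow> 'k" and \<eta> :: real assume v: "finite {i. v i \<noteq> 0}" "range v \<subseteq> R" "\<eta> > 0"
    obtain k where k: "u k = v" "\<epsilon> k \<le> \<eta>" using enum[OF v] by blast
    obtain n where n: "\<And>i. norm ((fshift w ^^ n) y i - v i) \<le> \<epsilon> k * tZ i" using hy[of k] k(1) by blast
    have "norm ((fshift w ^^ n) y i - v i) \<le> \<eta> * t (int_encode i)" for i
      using order_trans[OF n[of i] mult_right_mono[OF k(2) less_imp_le[OF tZ_pos]]] by (simp add: tZ_def)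
    then show "\<exists>n. \<forall>i. norm ((fshift w ^^ n) y i - v i) \<le> \<eta> * t (int_encode i)" by blast
  qed
  ultimately show ?thesis
    using shift_operator_continuous[OF w' X] unfolding dual_hypercyclic_def by blast
qed

end

theorem theorem1p15:
  fixes smul :: "'k::real_or_complex \<Rightarrow> 'a::ab_group_add \<Rightarrow> 'a"
    and X :: "'a topology"
    and f :: "nat \<Rightarrow> 'a \<Rightarrow> 'k"
  assumes "locally_convex_space smul X"
    and "infinite_dimensional smul"
    and "\<exists>x. ell1_sequence smul X x \<and> has_dense_span smul X x"
    and "ell1_sequence fun_smul (strong_dual smul X) f"
    and "has_dense_span fun_smul (strong_dual smul X) f"
    and "X = weak_topology smul X \<or>
         X = mackey_topology smul X \<or>
         uniformly_equicontinuous X (range f)"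
  shows "\<exists>T. dual_hypercyclic smul X T"
proof -
  interpret locally_convex_space smul X by (rule assms(1))
  obtain x where x: "ell1_sequence smul X x" "has_dense_span smul X x" using assms(3) by blast
  note f = assms(4,5)
  have fD: "f k \<in> dual" for k using D.ell1_carrier[OF f(1)] by (simp add: topspace_strong_dual)
  obtain e :: "nat \<Rightarrow> 'a" and g :: "nat \<Rightarrow> 'a \<Rightarrow> 'k" where e: "\<And>n. e n \<in> span (range x)" and g: "\<And>n. g n \<in> D.span (range f)"
    and bi: "\<And>m n. g m (e n) = (if m = n then 1 else 0)" and gD: "\<And>n. g n \<in> dual"
    and xe: "\<And>k. x k \<in> span (range e)" and fg: "\<And>k. f k \<in> D.span (range g)"
    using biorthogonal_sequences[OF assms(2) x(2) f(2) fD] by blast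
  have "\<forall>n. \<exists>K \<alpha>. e n = (\<Sum>k<K. smul (\<alpha> k) (x k))" using span_range_finite_sum[OF e] by metis
  then obtain K \<alpha> where \<alpha>: "\<And>n. e n = (\<Sum>k<K n. smul (\<alpha> n k) (x k))" by metis
  have "\<forall>n. \<exists>L \<beta>. g n = (\<Sum>k<L. fun_smul (\<beta> k) (f k))" using D.span_range_finite_sum[OF g] by metis
  then obtain L \<beta> where \<beta>: "\<And>n. g n = (\<Sum>k<L n. fun_smul (\<beta> n k) (f k))" by metis
  \<comment> \<open>These measure the expansions of \<open>e n\<close> and \<open>g n\<close>. The
    factor \<open>2 ^ k\<close> compensates for the damping in the equicontinuous family
    \<open>(1/2) ^ k\<close> times \<open>f k\<close>.\<close>
  define a b where "a n = (\<Sum>k<K n. norm (\<alpha> n k))" and "b n = (\<Sum>k<L n. 2 ^ k * norm (\<beta> n k))" for n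
  have ab: "a n \<ge> 0" "b n \<ge> 0" for n by (auto simp: a_def b_def intro!: sum_nonneg)
  \<comment> \<open>The summand 1 keeps \<open>s n\<close> and \<open>t n\<close> at most 1, and the
    quotients make \<open>s n * a n\<close> and \<open>t n * b n\<close> at most
    \<open>(1/2) ^ n\<close>, the decay that \<open>series_of_combinations\<close> requires.\<close>
  define s t where "s n = (1/2) ^ n / (1 + a n)" and "t n = (1/2) ^ n / (1 + b n)" for n
  have pos: "s n > 0" "t n > 0" for n using ab[of n] by (auto simp: s_def t_def)
  have frac: "(1/2) ^ n / (1 + c) * c \<le> (1/2) ^ n" "(1/2) ^ n / (1 + c) \<le> 1" if "c \<ge> 0" for n and c :: real
  proof -
    have "c / (1 + c) \<le> 1" using that by simp
    then show "(1/2) ^ n / (1 + c) * c \<le> (1/2) ^ n"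
      using mult_left_mono[of "c / (1 + c)" 1 "(1/2) ^ n"] by simp
    have "(1/2 :: real) ^ n \<le> 1" by (simp add: power_le_one)
    then show "(1/2) ^ n / (1 + c) \<le> 1" using that by (simp add: divide_le_eq)
  qed
  have sa: "s n * a n \<le> (1/2) ^ n" and tb: "t n * b n \<le> (1/2) ^ n" for n
    using frac(1)[OF ab(1)] frac(1)[OF ab(2)] by (simp_all add: s_def t_def)
  have half: "(1/2 :: real) ^ n \<le> 1" for n by (simp add: power_le_one)
  \<comment> \<open>Serves twice: with a constant depending on \<open>v\<close> for
    \<open>g_bounded\<close>, and with \<open>C = 1\<close> on the equicontinuity
    neighbourhood.\<close>
  have g_est: "t n * norm (g n v) \<le> C" if C: "\<And>k. (1/2) ^ k * norm (f k v) \<le> C" for n v C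
  proof -
    have C0: "C \<ge> 0" using order_trans[OF norm_ge_zero[of "f 0 v"], of C] C[of 0] by simp
    have "norm (g n v) \<le> (\<Sum>k<L n. norm (\<beta> n k) * norm (f k v))"
      unfolding \<beta> fun_sum_apply by (rule order_trans[OF norm_sum]) (simp add: norm_mult)
    also have "\<dots> \<le> (\<Sum>k<L n. (2 ^ k * norm (\<beta> n k)) * C)"
    proof (rule sum_mono)
      fix k
      have "norm (\<beta> n k) * norm (f k v) = (2 ^ k * norm (\<beta> n k)) * ((1/2) ^ k * norm (f k v))"
        by (simp add: power_divide)
      also have "\<dots> \<le> (2 ^ k * norm (\<beta> n k)) * C" by (intro mult_left_mono C) simp
      finally show "norm (\<beta> n k) * norm (f k v) \<le> (2 ^ k * norm (\<beta> n k)) * C" .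
    qed
    also have "\<dots> = b n * C" by (simp add: b_def sum_distrib_right)
    finally have "t n * norm (g n v) \<le> t n * (b n * C)" using pos(2)[of n] by simp
    also have "\<dots> = (t n * b n) * C" by simp
    also have "\<dots> \<le> 1 * C" by (rule mult_right_mono[OF order_trans[OF tb half] C0])
    finally show ?thesis by simp
  qed
  \<comment> \<open>\<open>b\<close> also dominates the undamped coefficient sum, so
    \<open>t\<close> meets the requirement for series in the strong dual.\<close>
  have b_ge: "(\<Sum>k<L n. norm (\<beta> n k)) \<le> b n" for n
    unfolding b_def by (intro sum_mono) (simp add: mult_le_cancel_right1)
  interpret P: dual_weighted_series smul X e g s t
  proof (intro dual_weighted_series.intro dual_weighted_series_axioms.intro)
    show "weighted_series smul X e s"
      using sa by (intro weighted_series_of_combinations[OF x(1) \<alpha> pos(1)]) (simp add: a_def)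
    show "weighted_series fun_smul sdual g t"
    proof (rule D.weighted_series_of_combinations[OF f(1) \<beta> pos(2)])
      show "t n * (\<Sum>k<L n. norm (\<beta> n k)) \<le> (1/2) ^ n" for n
        by (rule order_trans[OF mult_left_mono[OF b_ge less_imp_le[OF pos(2)]] tb])
    qed
    show "t n \<le> 1" for n using frac(2)[OF ab(2)] by (simp add: t_def)
    show "\<exists>C. \<forall>n. t n * norm (g n v) \<le> C" for v
    proof -
      obtain p where p: "D.cs p" "\<forall>\<phi>\<in>dual. norm (\<phi> v) \<le> p \<phi>" using evaluation_seminorm[of v] by blast
      obtain C where C: "C > 0" "\<And>k. p (f k) \<le> C" using D.ell1_bounded[OF f(1) p(1)] by metis
      have "(1/2) ^ k * norm (f k v) \<le> 1 * C" for k
        by (rule mult_mono[OF half order_trans[OF p(2)[rule_format, OF fD] C(2)]]) simp_all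
      then have "t n * norm (g n v) \<le> C" for n by (intro g_est) simp
      then show ?thesis by blast
    qed
    show "summable (\<lambda>n. s n * norm (\<phi> (e n)))" if \<phi>: "\<phi> \<in> dual" for \<phi>
    proof -
      obtain C where C: "C \<ge> 0" "\<And>k. norm (\<phi> (x k)) \<le> C" using functional_bounded_on_sequence[OF \<phi> x(1)] by metis
      have "norm (s n * norm (\<phi> (e n))) \<le> C * (1/2) ^ n" for n
      proof -
        have "norm (\<phi> (e n)) \<le> (\<Sum>k<K n. norm (\<alpha> n k) * norm (\<phi> (x k)))"
          unfolding \<alpha> dual_sum[OF \<phi>] dual_scale[OF \<phi>] by (rule order_trans[OF norm_sum]) (simp add: norm_mult)
        also have "\<dots> \<le> (\<Sum>k<K n. norm (\<alpha> n k) * C)" by (intro sum_mono mult_left_mono C) simp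
        also have "\<dots> = a n * C" by (simp add: a_def sum_distrib_right)
        finally have "s n * norm (\<phi> (e n)) \<le> s n * (a n * C)" using pos(1)[of n] by simp
        also have "\<dots> = (s n * a n) * C" by simp
        also have "\<dots> \<le> (1/2) ^ n * C" using sa[of n] C(1) by (rule mult_right_mono)
        finally show ?thesis using pos(1)[of n] by (simp add: mult.commute)
      qed
      moreover have "summable (\<lambda>n. C * (1/2) ^ n)" by (intro summable_mult summable_geometric) simp
      ultimately show ?thesis by (rule summable_comparison_test'[rotated])
    qed
  qed (use assms(1) gD bi in auto)
  show ?thesis
  proof (rule P.exists_dual_hypercyclic)
    show "s n \<le> 1" for n using frac(2)[OF ab(1)] by (simp add: s_def)
    have "span (range x) \<subseteq> span (range e)" using xe by (intro span_minimal) auto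
    then show "S \<subseteq> X closure_of (span (range e))"
      using x(2) closure_of_mono[of "span (range x)" "span (range e)" X] unfolding has_dense_span_def by simp
    have "D.span (range f) \<subseteq> D.span (range g)" using fg by (intro D.span_minimal) auto
    then show "dual \<subseteq> sdual closure_of (D.span (range g))"
      using f(2) closure_of_mono[of "D.span (range f)" "D.span (range g)" sdual]
      unfolding has_dense_span_def topspace_strong_dual by simp
    show "X = weak_topology smul X \<or> (\<exists>U. openin X U \<and> 0 \<in> U \<and> (\<forall>v\<in>U. \<forall>n. t n * norm (g n v) \<le> 1))"
      using equicontinuous_or_weak[OF f(1) assms(6)]
    proof
      assume "uniformly_equicontinuous X (range (\<lambda>k. fun_smul ((1/2) ^ k) (f k)))"
      then obtain U where U: "openin X U" "0 \<in> U" "\<And>v k. v \<in> U \<Longrightarrow> norm (fun_smul ((1/2) ^ k) (f k) v) \<le> 1"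
        unfolding uniformly_equicontinuous_def by blast
      have "t n * norm (g n v) \<le> 1" if "v \<in> U" for v n
      proof (rule g_est)
        show "(1/2) ^ k * norm (f k v) \<le> 1" for k
          using U(3)[OF that, of k] by (simp add: fun_smul_def norm_mult norm_power norm_divide)
      qed
      then show ?thesis using U(1,2) by blast
    qed blast
  qed
qed

end
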